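(* Let $\epsilon=\epsilon(n)>0$ satisfy $\epsilon(n)\to 0$ as $n\to\infty$ and $\liminf_{n\to\infty}\frac{\epsilon(n)^2 n}{\log n}=\infty$. For every $n$ let $x_1,\dots,x_n$ be i.i.d. uniform points on $\mathbb S^2$ and let $\mathbb G_n=(V,\mathcal E)$, $V=\{x_1,\dots,x_n\}$, be the associated weighted random geometric graph with parameters $(K,\epsilon)$. Let $u_0\in C^{2,\alpha}(\mathbb S^2)$ be a real-valued function, for some $\alpha\in(0,1)$, and let $u_0^n:V\to\mathbb R$ be (possibly random) initial conditions such that for every $\delta>0$ $$\sum_{n=1}^\infty\mathbb P\Big(\sup_{1\le i\le n}|u_0^n(x_i)-u_0(x_i)|>\delta\Big)<\infty.$$ Let $A_n$ be the event that the solution $u^n$ of the Kuramoto system $$\frac{d}{dt}u^n(t,x_i)=\frac{1}{\epsilon\,\mathbb E(N_i)}\sum_{j=1,\,j\neq i}^n\sin\big(u^n(t,x_j)-u^n(t,x_i)\big)\,K\Big(\frac{\|x_i-x_j\|^2}{\epsilon}\Big),\qquad t>0,\ i=1,\dots,n,$$ with initial condition $u^n(0,x_i)=u_0^n(x_i)$ achieves phase synchronization. Then $$\mathbb P\big(A_n\text{ occurs for all } n \text{ large enough}\big)=1.$$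
   Context: $\mathbb S^2=\{x\in\mathbb R^3:\|x\|=1\}$ with surface area measure $\sigma$; $\|\cdot\|$ is the Euclidean norm in $\mathbb R^3$. $C^{2,\alpha}(\mathbb S^2)$ is the space of real-valued functions with continuous derivatives up to order $2$, all $\alpha$-Hölder continuous. Kernel: $K:\mathbb R_+\to\mathbb R_+$ is a fixed bounded function with compact support in $[0,1]$ and $K(r)>0$ for every $r\in[0,1)$; moreover either $K$ is continuously differentiable with bounded derivative, or $K$ is the indicator function of $[0,1]$. Random geometric graph with parameters $(K,\epsilon)$: for each $n$, the points $x_1,\dots,x_n$ (which may depend on $n$) are i.i.d. with the uniform distribution (normalized $\sigma$) on $\mathbb S^2$; $\{x_i,x_j\}$, $i\ne j$, is an edge iff $\|x_i-x_j\|^2<\epsilon$, with weight $K(\|x_i-x_j\|^2/\epsilon)$. $N_i$ is the number of $j\neq i$ with $\|x_i-x_j\|^2<\epsilon$, and $\mathbb E(N_i)$ is its expectation (a deterministic number independent of $i$). For $n=1$ the right-hand side of the Kuramoto system is read as $0$. All random quantities, for all $n$, are defined on a common probability space $(\Omega,\mathcal F,\mathbb P)$. The values $u^n(t,x_i)$ represent phases, i.e. elements of $\mathbb S^1=\mathbb R/2\pi\mathbb Z$. The solution achieves phase synchronization if, as $t\to\infty$, it converges to a state in which all phases are equal, i.e. there is $\theta\in\mathbb R/2\pi\mathbb Z$ with $u^n(t,x_i)\to\theta$ modulo $2\pi$ for all $i=1,\dots,n$. *)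

theory Defs
  imports "HOL-Probability.Probability"
begin

text \<open>
  The surface area measure of the unit sphere in the usual polar-coordinates form
  \<open>\<sigma>(A) = 3 vol {r x | 0 < r < 1, x \<in> A}\<close>. It is a Borel measure on the whole space, carried by
  \<open>sphere 0 1\<close>; note that \<open>sgn x = x /\<^sub>R norm x\<close>.
\<close>

definition sphere_area :: "(real^3) measure" where
  "sphere_area = scale_measure 3 (distr (restrict_space lborel (ball 0 1 - {0})) borel sgn)"

definition uniform_sphere :: "(real^3) measure" where
  "uniform_sphere = uniform_measure sphere_area (sphere 0 1)"

definition holder_on :: "real \<Rightarrow> 'a::metric_space set \<Rightarrow> ('a \<Rightarrow> 'b::metric_space) \<Rightarrow> bool" where
  "holder_on \<alpha> S f \<longleftrightarrow> (\<exists>C. \<forall>x\<in>S. \<forall>y\<in>S. dist (f x) (f y) \<le> C * dist x y powr \<alpha>)"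

text \<open>
  Derivatives of a function \<open>f\<close> on the sphere are those of its extension \<open>x \<mapsto> f (x / |x|)\<close>, which
  is constant along rays: on the sphere, the first derivative of this extension is the surface
  gradient of \<open>f\<close>, and the second derivative restricted to tangent vectors is the covariant Hessian.
  Hoelder continuity of the derivatives (with \<open>\<alpha> > 0\<close>) includes their continuity.
\<close>

definition C2_holder_sphere :: "real \<Rightarrow> (real^3 \<Rightarrow> real) \<Rightarrow> bool" where
  "C2_holder_sphere \<alpha> f \<longleftrightarrow>
    (\<exists>(D1 :: real^3 \<Rightarrow> ((real^3) \<Rightarrow>\<^sub>L real)) (D2 :: real^3 \<Rightarrow> ((real^3) \<Rightarrow>\<^sub>L ((real^3) \<Rightarrow>\<^sub>L real))).
      (\<forall>x. x \<noteq> 0 \<longrightarrow> ((\<lambda>y. f (sgn y)) has_derivative blinfun_apply (D1 x)) (at x)) \<and>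
      (\<forall>x. x \<noteq> 0 \<longrightarrow> (D1 has_derivative blinfun_apply (D2 x)) (at x)) \<and>
      holder_on \<alpha> (sphere 0 1) f \<and> holder_on \<alpha> (sphere 0 1) D1 \<and> holder_on \<alpha> (sphere 0 1) D2)"

text \<open>Kernels live on \<open>{0..}\<close>; their values at negative arguments are irrelevant.\<close>

definition rgg_kernel :: "(real \<Rightarrow> real) \<Rightarrow> bool" where
  "rgg_kernel K \<longleftrightarrow>
    (\<forall>r\<ge>0. 0 \<le> K r) \<and> bounded (K ` {0..}) \<and>
    closure {r. 0 \<le> r \<and> K r \<noteq> 0} \<subseteq> {0..1} \<and> (\<forall>r\<in>{0..<1}. 0 < K r) \<and>
    ((\<exists>K'. (\<forall>r\<ge>0. (K has_real_derivative K' r) (at r within {0..})) \<and>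
           continuous_on {0..} K' \<and> bounded (K' ` {0..})) \<or>
     (\<forall>r\<ge>0. K r = indicator {0..1} r))"

text \<open>
  The vertex \<open>x i\<close> is represented by its index \<open>i \<in> {1..n}\<close>. The weight is given by the kernel for
  all pairs; it vanishes on non-edges except possibly at \<open>(norm (x i - x j))\<^sup>2 = \<epsilon>\<close>, a null event.
\<close>

definition rgg_edge :: "real \<Rightarrow> (nat \<Rightarrow> real^3) \<Rightarrow> nat \<Rightarrow> nat \<Rightarrow> bool" where
  "rgg_edge \<epsilon> x i j \<longleftrightarrow> i \<noteq> j \<and> (norm (x i - x j))\<^sup>2 < \<epsilon>"

definition rgg_weight :: "(real \<Rightarrow> real) \<Rightarrow> real \<Rightarrow> (nat \<Rightarrow> real^3) \<Rightarrow> nat \<Rightarrow> nat \<Rightarrow> real" where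
  "rgg_weight K \<epsilon> x i j = K ((norm (x i - x j))\<^sup>2 / \<epsilon>)"

definition rgg_degree :: "real \<Rightarrow> nat \<Rightarrow> (nat \<Rightarrow> real^3) \<Rightarrow> nat \<Rightarrow> nat" where
  "rgg_degree \<epsilon> n x i = card {j \<in> {1..n}. rgg_edge \<epsilon> x i j}"

text \<open>
  \<open>d i\<close> stands for the expected degree of vertex \<open>i\<close>. For \<open>n = 1\<close> the sum is empty, so the right-hand
  side is \<open>0\<close> although \<open>d i = 0\<close>.
\<close>

definition kuramoto_solution ::
  "(real \<Rightarrow> real) \<Rightarrow> real \<Rightarrow> nat \<Rightarrow> (nat \<Rightarrow> real) \<Rightarrow> (nat \<Rightarrow> real^3) \<Rightarrow> (nat \<Rightarrow> real)
    \<Rightarrow> (real \<Rightarrow> nat \<Rightarrow> real) \<Rightarrow> bool" where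
  "kuramoto_solution K \<epsilon> n d x v u \<longleftrightarrow>
    (\<forall>i\<in>{1..n}. u 0 i = v i \<and> continuous_on {0..} (\<lambda>t. u t i) \<and>
      (\<forall>t>0. ((\<lambda>s. u s i) has_real_derivative
        1 / (\<epsilon> * d i) * (\<Sum>j\<in>{1..n} - {i}. sin (u t j - u t i) * rgg_weight K \<epsilon> x i j)) (at t)))"

text \<open>Convergence of \<open>f\<close> to the class of \<open>\<theta>\<close> in \<open>\<real> / 2\<pi>\<int>\<close>.\<close>

definition tendsto_mod_2pi :: "('a \<Rightarrow> real) \<Rightarrow> real \<Rightarrow> 'a filter \<Rightarrow> bool" where
  "tendsto_mod_2pi f \<theta> F \<longleftrightarrow>
    (\<forall>e>0. \<forall>\<^sub>F t in F. \<exists>k::int. \<bar>f t - (\<theta> + 2 * pi * of_int k)\<bar> < e)"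

definition phase_synchronizes :: "nat \<Rightarrow> (real \<Rightarrow> nat \<Rightarrow> real) \<Rightarrow> bool" where
  "phase_synchronizes n u \<longleftrightarrow> (\<exists>\<theta>. \<forall>i\<in>{1..n}. tendsto_mod_2pi (\<lambda>t. u t i) \<theta> at_top)"

text \<open>
  ``The solution synchronizes'': a solution exists, and every solution (it is unique on
  \<open>{0..} \<times> {1..n}\<close>) synchronizes.
\<close>

definition kuramoto_synchronizes ::
  "(real \<Rightarrow> real) \<Rightarrow> real \<Rightarrow> nat \<Rightarrow> (nat \<Rightarrow> real) \<Rightarrow> (nat \<Rightarrow> real^3) \<Rightarrow> (nat \<Rightarrow> real) \<Rightarrow> bool" where
  "kuramoto_synchronizes K \<epsilon> n d x v \<longleftrightarrow>
    (\<exists>u. kuramoto_solution K \<epsilon> n d x v u) \<and>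
    (\<forall>u. kuramoto_solution K \<epsilon> n d x v u \<longrightarrow> phase_synchronizes n u)"

end

(* A sum w(t,x) of modes exp(-l(l+1)t/2) P(b.x), where P is a polynomial with Legendre eigenvalue
   -l(l+1) and |b| = 1, solves the heat equation w_t = (1/2) Laplace w on the sphere, so no PDE theory
   is needed: such sums at time 0 are uniformly dense (Stone-Weierstrass on the algebra spanned by the
   functions exp(a.x)) and each of them converges to a constant.

   Averaging over the rotations by multiples of 90 degrees about x shows that the expected coupling
   applied to a mode is a multiple of the Laplacian up to O(sqrt eps). Since eps^2 n / log n tends to
   infinity, a Chernoff bound with a fixed exponent, conditional on x_i, and a union bound over i make
   this true for the random sums as well, almost surely for large n; sin s = s + O(s^3) absorbs the
   nonlinearity.

   A comparison principle then keeps the Kuramoto solution close to w up to a time at which w is nearly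
   constant. From there on all phases stay in a short arc, and on a connected graph the variance of the
   phases decays exponentially. *)

theory Submission
  imports
    Defs
    "HOL-Computational_Algebra.Polynomial"
    "HOL-Real_Asymp.Real_Asymp"
begin

section \<open>Legendre modes and the heat flow on the sphere\<close>

text \<open>The growth condition is what a Chernoff bound with one fixed exponent needs: the drift
  to be detected at a vertex is of order eps^2 per sample, so the tail of the sum is exp (- const
  eps^2 n), which is smaller than every power of n.

  The comparison works in the sup norm. As u_0 is real valued, phases are followed as real numbers
  without winding, and the sine coupling is monotone as long as the differences along edges stay
  below pi/2. The price is an error growing linearly in time; it is affordable because the heat flow
  is needed only up to one fixed heat time. The factor between heat time and Kuramoto time is the
  kernel moment divided by eps times the edge probability; it is bounded below uniformly in n, for
  which crude bounds on cap areas are enough.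

  Connectedness comes from the same concentration bound: every vertex away from a fixed pole has a
  neighbour nearer to it. The final decay rate may depend on the graph, since there n is fixed and
  only t tends to infinity.\<close>

lemma smult_sum_right: "smult c (sum f A) = (\<Sum>i\<in>A. smult c (f i))"
  by (induction A rule: infinite_finite_induct) (auto simp: smult_add_right)

text \<open>On a ridge function x -> p (b . x) with |b| = 1, the Laplacian of the sphere acts as
  this operator on p in the variable z = b . x.\<close>

definition legendre_op :: "real poly \<Rightarrow> real poly" where
  "legendre_op p = [:1, 0, -1:] * pderiv (pderiv p) - [:0, 2:] * pderiv p"

lemma legendre_op_add: "legendre_op (p + q) = legendre_op p + legendre_op q"
  by (simp add: legendre_op_def pderiv_add smult_add_right algebra_simps)

lemma legendre_op_smult: "legendre_op (smult c p) = smult c (legendre_op p)"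
  by (simp add: legendre_op_def pderiv_smult smult_diff_right)

lemma legendre_op_sum: "legendre_op (sum f A) = (\<Sum>i\<in>A. legendre_op (f i))"
  by (induction A rule: infinite_finite_induct) (auto simp: legendre_op_add, auto simp: legendre_op_def)

lemma poly_legendre_op:
  "poly (legendre_op p) z = (1 - z\<^sup>2) * poly (pderiv (pderiv p)) z - 2 * z * poly (pderiv p) z"
  by (simp add: legendre_op_def algebra_simps power2_eq_square)

text \<open>The operator is triangular on monomials: it sends z^m to m (m - 1) z^(m - 2) - m (m + 1)
  z^m, and the added multiple cancels the diagonal entry.\<close>

lemma degree_legendre_op_monom:
  "degree (legendre_op (monom 1 (Suc n)) + smult (real (Suc n * (Suc n + 1))) (monom 1 (Suc n))) \<le> n"
proof -
  have "coeff (legendre_op (monom 1 (Suc n)) + smult (real (Suc n * (Suc n + 1))) (monom 1 (Suc n))) i = 0"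
    if "i > n" for i
    using that
    by (auto simp: legendre_op_def coeff_pderiv coeff_pCons pderiv_monom of_nat_diff algebra_simps
        less_Suc_eq split: nat.splits)
  then show ?thesis
    by (intro degree_le) auto
qed

text \<open>A triangular operator with distinct diagonal entries is diagonalizable: each induction
  step corrects the top monomial by lower eigenvectors into a new eigenvector. The component l = 0
  is recorded as constant because it does not decay and becomes the limit of the heat flow.\<close>

lemma legendre_decomposition:
  fixes q :: "real poly"
  assumes "degree q \<le> n"
  shows "\<exists>r. q = (\<Sum>l\<le>n. r l) \<and> degree (r 0) = 0 \<and>
    (\<forall>l\<le>n. degree (r l) \<le> n \<and> legendre_op (r l) = smult (- real (l * (l + 1))) (r l))"
  using assms
proof (induction n arbitrary: q)
  case 0
  then obtain c where "q = [:c:]" by (auto elim: degree_eq_zeroE)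
  then show ?case
    by (intro exI[of _ "\<lambda>_. q"]) (auto simp: legendre_op_def)
next
  case (Suc n)
  define N where "N = real (Suc n * (Suc n + 1))"
  define m :: "real poly" where "m = monom 1 (Suc n)"
  obtain s where s: "legendre_op m + smult N m = (\<Sum>l\<le>n. s l)" "degree (s 0) = 0"
    "\<And>l. l \<le> n \<Longrightarrow> degree (s l) \<le> n"
    "\<And>l. l \<le> n \<Longrightarrow> legendre_op (s l) = smult (- real (l * (l + 1))) (s l)"
    using Suc.IH[OF degree_legendre_op_monom[of n]] unfolding m_def N_def by blast
  \<comment> \<open>\<open>k l\<close> solves \<open>1 + k l * (N - l * (l + 1)) = 0\<close>, so
    that adding \<open>smult (k l) (s l)\<close> cancels the component \<open>s l\<close> of the
    remainder.\<close>
  define k where "k l = - (1 / (N - real (l * (l + 1))))" for l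
  have pos: "N - real (l * (l + 1)) > 0" if "l \<le> n" for l
  proof -
    have "l * (l + 1) < Suc n * (Suc n + 1)"
      using that by (intro mult_strict_mono) auto
    then show ?thesis unfolding N_def by (simp del: of_nat_mult)
  qed
  define p where "p = m + (\<Sum>l\<le>n. smult (k l) (s l))"
  have "legendre_op p + smult N p
    = (legendre_op m + smult N m) + (\<Sum>l\<le>n. smult (k l) (legendre_op (s l)) + smult N (smult (k l) (s l)))"
    unfolding p_def
    by (simp add: legendre_op_add legendre_op_sum legendre_op_smult smult_add_right smult_sum_right sum.distrib
        algebra_simps)
  also have "\<dots> = (\<Sum>l\<le>n. s l + (smult (k l) (legendre_op (s l)) + smult N (smult (k l) (s l))))"
    by (simp add: s(1) sum.distrib)
  also have "\<dots> = 0"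
  proof (intro sum.neutral ballI)
    fix l assume "l \<in> {..n}"
    then have l: "l \<le> n" by simp
    have "s l + (smult (k l) (legendre_op (s l)) + smult N (smult (k l) (s l)))
        = smult (1 + k l * (N - real (l * (l + 1)))) (s l)"
      by (rule poly_eqI) (simp add: s(4)[OF l] algebra_simps)
    also have "1 + k l * (N - real (l * (l + 1))) = 0"
      using pos[OF l] by (simp add: k_def)
    finally show "s l + (smult (k l) (legendre_op (s l)) + smult N (smult (k l) (s l))) = 0"
      by simp
  qed
  finally have eig: "legendre_op p = smult (- N) p"
    by (simp add: eq_neg_iff_add_eq_0)
  have deg_sum: "degree (\<Sum>l\<le>n. smult (k l) (s l)) \<le> n"
    using s(3) by (intro degree_sum_le) auto
  then have "degree p \<le> Suc n"
    unfolding p_def m_def by (intro degree_add_le) (auto simp: degree_monom_eq)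
  moreover have "coeff p (Suc n) = 1"
    using deg_sum unfolding p_def m_def by (simp add: coeff_eq_0)
  ultimately have z: "coeff (q - smult (coeff q (Suc n)) p) i = 0" if "i > n" for i
    using Suc.prems that by (cases "i = Suc n") (auto simp: coeff_eq_0)
  have "degree (q - smult (coeff q (Suc n)) p) \<le> n"
    by (intro degree_le allI impI z)
  from Suc.IH[OF this] obtain r where r: "q - smult (coeff q (Suc n)) p = (\<Sum>l\<le>n. r l)"
    "degree (r 0) = 0"
    "\<And>l. l \<le> n \<Longrightarrow> degree (r l) \<le> n"
    "\<And>l. l \<le> n \<Longrightarrow> legendre_op (r l) = smult (- real (l * (l + 1))) (r l)"
    by blast
  define r' where "r' = r(Suc n := smult (coeff q (Suc n)) p)"
  have "(\<Sum>l\<le>n. r' l) = (\<Sum>l\<le>n. r l)"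
    unfolding r'_def by (intro sum.cong) auto
  then have "q = (\<Sum>l\<le>Suc n. r' l)"
    using r(1) by (simp add: r'_def algebra_simps)
  moreover have "degree (r' 0) = 0"
    using r(2) by (simp add: r'_def)
  moreover have "degree (r' l) \<le> Suc n" if "l \<le> Suc n" for l
  proof (cases "l = Suc n")
    case True
    then show ?thesis
      using \<open>degree p \<le> Suc n\<close> degree_smult_le[of "coeff q (Suc n)" p] by (simp add: r'_def)
  next
    case False
    then show ?thesis using r(3)[of l] that by (simp add: r'_def)
  qed
  moreover have "legendre_op (r' l) = smult (- real (l * (l + 1))) (r' l)" if "l \<le> Suc n" for l
  proof (cases "l = Suc n")
    case True
    then show ?thesis
      using eig by (simp add: r'_def legendre_op_smult N_def mult.commute)
  next
    case False
    then show ?thesis using r(4)[of l] that by (simp add: r'_def)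
  qed
  ultimately show ?case by blast
qed

text \<open>An inductive predicate, so that decay, Lipschitz bound and consistency with the random
  coupling are each checked for one mode and passed on to sums. The 2 in the eigenvalue undoes the
  1/2 in front of the Laplacian; \<mu> > 0 separates the decaying modes from the constants.\<close>

inductive heat_sum :: "(real \<Rightarrow> real^3 \<Rightarrow> real) \<Rightarrow> bool" where
  const: "heat_sum (\<lambda>t x. c)"
| mode: "norm b = 1 \<Longrightarrow> \<mu> > 0 \<Longrightarrow> legendre_op p = smult (- (2 * \<mu>)) p \<Longrightarrow>
    heat_sum (\<lambda>t x. exp (- \<mu> * t) * poly p (b \<bullet> x))"
| add: "heat_sum w \<Longrightarrow> heat_sum w' \<Longrightarrow> heat_sum (\<lambda>t x. w t x + w' t x)"

lemma heat_sum_sum: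
  assumes "finite A" "\<And>i. i \<in> A \<Longrightarrow> heat_sum (w i)"
  shows "heat_sum (\<lambda>t x. \<Sum>i\<in>A. w i t x)"
  using assms
proof (induction A rule: finite_induct)
  case empty
  then show ?case by (simp add: heat_sum.const)
next
  case (insert i A)
  then have "heat_sum (\<lambda>t x. w i t x + (\<Sum>i\<in>A. w i t x))"
    by (intro heat_sum.add) simp_all
  then show ?case using insert.hyps by simp
qed

lemma heat_sum_ridge:
  assumes b: "norm b = 1"
  shows "\<exists>w. heat_sum w \<and> (\<forall>x. w 0 x = poly q (b \<bullet> x))"
proof -
  define n where "n = degree q"
  obtain r where r: "q = (\<Sum>l\<le>n. r l)" "degree (r 0) = 0"
    "\<And>l. l \<le> n \<Longrightarrow> legendre_op (r l) = smult (- real (l * (l + 1))) (r l)"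
    using legendre_decomposition[of q n] unfolding n_def by auto
  define \<mu> where "\<mu> l = real (l * (l + 1)) / 2" for l
  define w where "w l t x = exp (- \<mu> l * t) * poly (r l) (b \<bullet> x)" for l t x
  have "heat_sum (w l)" if "l \<le> n" for l
  proof (cases "l = 0")
    case True
    obtain c where "r 0 = [:c:]" using r(2) by (auto elim: degree_eq_zeroE)
    then have "w l = (\<lambda>t x. c)" using True by (auto simp: w_def \<mu>_def fun_eq_iff)
    then show ?thesis by (auto intro: heat_sum.const)
  next
    case False
    show ?thesis
      unfolding w_def[abs_def]
    proof (rule heat_sum.mode[OF b])
      show "\<mu> l > 0" using False by (simp add: \<mu>_def del: of_nat_mult of_nat_add)
      show "legendre_op (r l) = smult (- (2 * \<mu> l)) (r l)"
        using r(3)[OF that] by (simp add: \<mu>_def del: of_nat_mult of_nat_add)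
    qed
  qed
  then have "heat_sum (\<lambda>t x. \<Sum>l\<le>n. w l t x)"
    by (intro heat_sum_sum) auto
  moreover have "(\<Sum>l\<le>n. w l 0 x) = poly q (b \<bullet> x)" for x
    unfolding w_def by (subst r(1)) (simp add: poly_sum)
  ultimately show ?thesis by blast
qed

section \<open>Uniform density of the initial values of heat sums\<close>

inductive exp_sum :: "('a::real_inner \<Rightarrow> real) \<Rightarrow> bool" where
  exp: "exp_sum (\<lambda>x. c * exp (a \<bullet> x))"
| add: "exp_sum f \<Longrightarrow> exp_sum g \<Longrightarrow> exp_sum (\<lambda>x. f x + g x)"

lemma exp_sum_mult_exp:
  assumes "exp_sum g"
  shows "exp_sum (\<lambda>x. c * exp (a \<bullet> x) * g x)"
  using assms
proof induction
  case (exp d b)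
  have "(\<lambda>x. c * exp (a \<bullet> x) * (d * exp (b \<bullet> x))) = (\<lambda>x. (c * d) * exp ((a + b) \<bullet> x))"
    by (auto simp: inner_add_left exp_add)
  then show ?case by (simp only: exp_sum.exp)
next
  case (add f g)
  then show ?case by (simp only: distrib_left exp_sum.add)
qed

lemma exp_sum_mult:
  assumes "exp_sum f" "exp_sum g"
  shows "exp_sum (\<lambda>x. f x * g x)"
  using assms
proof induction
  case (exp c a)
  then show ?case by (rule exp_sum_mult_exp)
next
  case (add f f')
  then show ?case by (simp only: distrib_right exp_sum.add)
qed

text \<open>Exponentials do two things at once: products stay in the span, as Stone-Weierstrass
  requires, and each generator depends on x through a single inner product. Powers of b . x have
  only the second property, since a product for two different b is in general no ridge
  function.\<close>

lemma exp_sum_dense: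
  fixes f :: "'a::euclidean_space \<Rightarrow> real"
  assumes "compact S" "continuous_on S f" "e > 0"
  shows "\<exists>g. exp_sum g \<and> (\<forall>x\<in>S. \<bar>f x - g x\<bar> < e)"
proof -
  interpret function_ring_on "Collect exp_sum" S
  proof
    show "continuous_on S g" if "g \<in> Collect exp_sum" for g :: "'a \<Rightarrow> real"
    proof -
      from that have "exp_sum g" by simp
      then show ?thesis by induction (auto intro!: continuous_intros)
    qed
    show "(\<lambda>_::'a. c) \<in> Collect exp_sum" for c
      using exp_sum.exp[of c "0::'a"] by simp
    show "\<exists>g\<in>Collect exp_sum. g x \<noteq> g y" if "x \<noteq> y" for x y :: 'a
    \<comment> \<open>The exponential in direction x - y separates x from y, as its exponents at the
      two points differ by |x - y|^2.\<close>
    proof (rule bexI[of _ "\<lambda>z. 1 * exp ((x - y) \<bullet> z)"])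
      have "(x - y) \<bullet> x - (x - y) \<bullet> y \<noteq> 0"
        using that by (simp flip: inner_diff_right)
      then show "1 * exp ((x - y) \<bullet> x) \<noteq> 1 * exp ((x - y) \<bullet> y)" by simp
    qed (simp only: mem_Collect_eq exp_sum.exp)
    show "compact S" by fact
    show "(\<lambda>x. f x + g x) \<in> Collect exp_sum" if "f \<in> Collect exp_sum" "g \<in> Collect exp_sum"
      for f g :: "'a \<Rightarrow> real"
      using that by (simp add: exp_sum.add)
    show "(\<lambda>x. f x * g x) \<in> Collect exp_sum" if "f \<in> Collect exp_sum" "g \<in> Collect exp_sum"
      for f g :: "'a \<Rightarrow> real"
      using that by (simp add: exp_sum_mult)
  qed
  show ?thesis using Stone_Weierstrass_basic[OF assms(2,3)] by auto
qed

lemma real_poly_dense: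
  fixes f :: "real \<Rightarrow> real"
  assumes "compact S" "continuous_on S f" "e > 0"
  shows "\<exists>p. \<forall>x\<in>S. \<bar>f x - poly p x\<bar> < e"
proof -
  obtain g where g: "real_polynomial_function g" "\<And>x. x \<in> S \<Longrightarrow> \<bar>f x - g x\<bar> < e"
    using Stone_Weierstrass_real_polynomial_function[OF assms] by blast
  then obtain a n where "g = (\<lambda>x. \<Sum>i\<le>n. a i * x ^ i)"
    unfolding real_polynomial_function_iff_sum by blast
  then have "g x = poly (\<Sum>i\<le>n. monom (a i) i) x" for x
    by (simp add: poly_sum poly_monom)
  with g(2) show ?thesis by metis
qed

text \<open>With a = |a| b each generator is a function of z = b . x in [-1, 1], and approximating
  it by a polynomial in one variable leads to \<open>heat_sum_ridge\<close>.\<close>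

lemma heat_sum_dense_exp:
  assumes "exp_sum f" "e > 0"
  shows "\<exists>w. heat_sum w \<and> (\<forall>x\<in>sphere 0 1. \<bar>f x - w 0 x\<bar> < e)"
  using assms
proof (induction arbitrary: e)
  case (exp c a)
  obtain b :: "real^3" where b: "norm b = 1" "a = norm a *\<^sub>R b"
  proof (cases "a = 0")
    case True
    then show thesis using that[of "axis 1 1"] by simp
  next
    case False
    then show thesis using that[of "a /\<^sub>R norm a"] by simp
  qed
  obtain q where q: "\<And>z. z \<in> {-1..1} \<Longrightarrow> \<bar>c * exp (norm a * z) - poly q z\<bar> < e"
  proof -
    have "continuous_on {-1..1} (\<lambda>z. c * exp (norm a * z))"
      by (intro continuous_intros)
    from real_poly_dense[OF compact_Icc this exp] that show thesis by blast
  qed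
  obtain w where w: "heat_sum w" "\<And>x. w 0 x = poly q (b \<bullet> x)"
    using heat_sum_ridge[OF b(1)] by blast
  have "\<bar>c * exp (a \<bullet> x) - w 0 x\<bar> < e" if "x \<in> sphere 0 1" for x
  proof -
    have "\<bar>b \<bullet> x\<bar> \<le> 1"
      using Cauchy_Schwarz_ineq2[of b x] that b(1) by simp
    then have "\<bar>c * exp (norm a * (b \<bullet> x)) - poly q (b \<bullet> x)\<bar> < e"
      by (intro q) auto
    also have "norm a * (b \<bullet> x) = a \<bullet> x"
      by (metis b(2) inner_scaleR_left)
    finally show ?thesis by (simp add: w(2))
  qed
  with w(1) show ?case by blast
next
  case (add f g)
  obtain w where w: "heat_sum w" "\<And>x. x \<in> sphere 0 1 \<Longrightarrow> \<bar>f x - w 0 x\<bar> < e / 2"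
    using add.IH(1)[of "e / 2"] add.prems by auto
  obtain w' where w': "heat_sum w'" "\<And>x. x \<in> sphere 0 1 \<Longrightarrow> \<bar>g x - w' 0 x\<bar> < e / 2"
    using add.IH(2)[of "e / 2"] add.prems by auto
  show ?case
  proof (intro exI[of _ "\<lambda>t x. w t x + w' t x"] conjI ballI)
    show "heat_sum (\<lambda>t x. w t x + w' t x)" using w(1) w'(1) by (rule heat_sum.add)
    fix x :: "real^3" assume "x \<in> sphere 0 1"
    from w(2)[OF this] w'(2)[OF this] show "\<bar>f x + g x - (w 0 x + w' 0 x)\<bar> < e"
      by linarith
  qed
qed

lemma heat_sum_dense:
  assumes "continuous_on (sphere 0 1) f" "e > 0"
  shows "\<exists>w. heat_sum w \<and> (\<forall>x\<in>sphere 0 1. \<bar>f x - w 0 x\<bar> < e)"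
proof -
  obtain g where g: "exp_sum g" "\<And>x. x \<in> sphere 0 1 \<Longrightarrow> \<bar>f x - g x\<bar> < e / 2"
    using exp_sum_dense[OF compact_sphere assms(1), of "e / 2"] assms(2) by auto
  obtain w where w: "heat_sum w" "\<And>x. x \<in> sphere 0 1 \<Longrightarrow> \<bar>g x - w 0 x\<bar> < e / 2"
    using heat_sum_dense_exp[OF g(1), of "e / 2"] assms(2) by auto
  have "\<bar>f x - w 0 x\<bar> < e" if "x \<in> sphere 0 1" for x
    using g(2)[OF that] w(2)[OF that] by linarith
  with w(1) show ?thesis by blast
qed

section \<open>Long-time limit and Lipschitz bound of heat sums\<close>

lemma poly_bounded_on_Icc:
  fixes p :: "real poly"
  obtains B where "B \<ge> 0" "\<And>z. \<bar>z\<bar> \<le> 1 \<Longrightarrow> \<bar>poly p z\<bar> \<le> B"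
proof -
  have "compact (poly p ` {-1..1})"
    by (intro compact_continuous_image continuous_intros) auto
  then have "bounded (poly p ` {-1..1})" by (rule compact_imp_bounded)
  then obtain B where B: "B > 0" "\<And>y. y \<in> poly p ` {-1..1} \<Longrightarrow> norm y \<le> B"
    unfolding bounded_pos by blast
  show thesis
  proof (rule that[of B])
    show "\<bar>poly p z\<bar> \<le> B" if "\<bar>z\<bar> \<le> 1" for z
      using B(2)[of "poly p z"] that by (simp add: image_iff) (metis abs_le_iff atLeastAtMost_iff minus_le_iff)
  qed (use B in auto)
qed

lemma abs_inner_unit_le:
  assumes "norm b = 1" "norm x = 1"
  shows "\<bar>b \<bullet> x\<bar> \<le> 1"
  using Cauchy_Schwarz_ineq2[of b x] assms by simp

lemma heat_sum_tendsto_const: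
  assumes "heat_sum w"
  shows "\<exists>c. \<forall>e>0. \<forall>\<^sub>F t in at_top. \<forall>x\<in>sphere 0 1. \<bar>w t x - c\<bar> < e"
  using assms
proof induction
  case (const c)
  show ?case by (intro exI[of _ c]) auto
next
  case (mode b \<mu> p)
  obtain B where B: "B \<ge> 0" "\<And>z. \<bar>z\<bar> \<le> 1 \<Longrightarrow> \<bar>poly p z\<bar> \<le> B"
    using poly_bounded_on_Icc by blast
  have "((\<lambda>t. exp (- \<mu> * t) * B) \<longlongrightarrow> 0) at_top"
    using mode(2) by real_asymp
  then have ev: "\<forall>\<^sub>F t in at_top. exp (- \<mu> * t) * B < e" if "e > 0" for e
    using that by (rule order_tendstoD)
  have "\<forall>\<^sub>F t in at_top. \<forall>x\<in>sphere 0 1. \<bar>exp (- \<mu> * t) * poly p (b \<bullet> x) - 0\<bar> < e" if "e > 0" for e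
    using ev[OF that]
  proof eventually_elim
    case (elim t)
    have "\<bar>exp (- \<mu> * t) * poly p (b \<bullet> x)\<bar> \<le> exp (- \<mu> * t) * B" if "x \<in> sphere 0 1" for x
      using B(2)[OF abs_inner_unit_le[OF mode(1), of x]] that by (simp add: abs_mult)
    with elim show ?case by fastforce
  qed
  then show ?case by blast
next
  case (add w w')
  then obtain c c' where
    c: "\<And>e. e > 0 \<Longrightarrow> \<forall>\<^sub>F t in at_top. \<forall>x\<in>sphere 0 1. \<bar>w t x - c\<bar> < e" and
    c': "\<And>e. e > 0 \<Longrightarrow> \<forall>\<^sub>F t in at_top. \<forall>x\<in>sphere 0 1. \<bar>w' t x - c'\<bar> < e"
    by blast
  have "\<forall>\<^sub>F t in at_top. \<forall>x\<in>sphere 0 1. \<bar>w t x + w' t x - (c + c')\<bar> < e" if "e > 0" for e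
    using c[OF half_gt_zero[OF that]] c'[OF half_gt_zero[OF that]]
  proof eventually_elim
    case (elim t)
    show ?case
    proof
      fix x :: "real^3" assume "x \<in> sphere 0 1"
      with elim have "\<bar>w t x - c\<bar> < e / 2" "\<bar>w' t x - c'\<bar> < e / 2" by blast+
      then show "\<bar>w t x + w' t x - (c + c')\<bar> < e" by linarith
    qed
  qed
  then show ?case by blast
qed

lemma poly_lipschitz_on_Icc:
  fixes p :: "real poly"
  obtains B where "B \<ge> 0" "\<And>z y. \<bar>z\<bar> \<le> 1 \<Longrightarrow> \<bar>y\<bar> \<le> 1 \<Longrightarrow> \<bar>poly p z - poly p y\<bar> \<le> B * \<bar>z - y\<bar>"
proof -
  obtain B where B: "B \<ge> 0" "\<And>z. \<bar>z\<bar> \<le> 1 \<Longrightarrow> \<bar>poly (pderiv p) z\<bar> \<le> B"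
    using poly_bounded_on_Icc by blast
  have "\<bar>poly p z - poly p y\<bar> \<le> B * \<bar>z - y\<bar>" if "\<bar>z\<bar> \<le> 1" "\<bar>y\<bar> \<le> 1" for z y
  proof -
    have "norm (poly p z - poly p y) \<le> B * norm (z - y)"
      by (rule field_differentiable_bound[of "{-1..1}" "poly p" "poly (pderiv p)"])
        (use B(2) that in \<open>auto intro!: has_field_derivative_at_within poly_DERIV\<close>)
    then show ?thesis by simp
  qed
  with B(1) show thesis by (rule that)
qed

lemma abs_inner_diff_unit_le:
  assumes "norm b = 1"
  shows "\<bar>b \<bullet> x - b \<bullet> y\<bar> \<le> norm (x - y)"
  using Cauchy_Schwarz_ineq2[of b "x - y"] assms by (simp add: inner_diff_right)

text \<open>Uniform in time because exp (- \<mu> t) is at most 1. The bound controls the phase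
  difference along every edge, whose length is at most the square root of \<epsilon>.\<close>

lemma heat_sum_lipschitz:
  assumes "heat_sum w"
  shows "\<exists>L\<ge>0. \<forall>t\<ge>0. \<forall>x\<in>sphere 0 1. \<forall>y\<in>sphere 0 1. \<bar>w t x - w t y\<bar> \<le> L * norm (x - y)"
  using assms
proof induction
  case (const c)
  show ?case by (intro exI[of _ 0]) auto
next
  case (mode b \<mu> p)
  obtain B where B: "B \<ge> 0"
    "\<And>z y. \<bar>z\<bar> \<le> 1 \<Longrightarrow> \<bar>y\<bar> \<le> 1 \<Longrightarrow> \<bar>poly p z - poly p y\<bar> \<le> B * \<bar>z - y\<bar>"
    using poly_lipschitz_on_Icc by blast
  have "\<bar>exp (- \<mu> * t) * poly p (b \<bullet> x) - exp (- \<mu> * t) * poly p (b \<bullet> y)\<bar> \<le> B * norm (x - y)"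
    if "t \<ge> 0" "x \<in> sphere 0 1" "y \<in> sphere 0 1" for t x y
  proof -
    have "\<bar>exp (- \<mu> * t) * poly p (b \<bullet> x) - exp (- \<mu> * t) * poly p (b \<bullet> y)\<bar>
        = exp (- \<mu> * t) * \<bar>poly p (b \<bullet> x) - poly p (b \<bullet> y)\<bar>"
      by (simp add: abs_mult flip: right_diff_distrib)
    also have "\<dots> \<le> 1 * (B * \<bar>b \<bullet> x - b \<bullet> y\<bar>)"
      using mode(1,2) that abs_inner_unit_le[of b] by (intro mult_mono B(2)) auto
    also have "\<dots> \<le> B * norm (x - y)"
      using abs_inner_diff_unit_le[OF mode(1), of x y] B(1) by (simp add: mult_left_mono)
    finally show ?thesis .
  qed
  with B(1) show ?case by blast
next
  case (add w w')
  obtain L where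
    L: "L \<ge> 0" "\<And>t x y. t \<ge> 0 \<Longrightarrow> x \<in> sphere 0 1 \<Longrightarrow> y \<in> sphere 0 1 \<Longrightarrow> \<bar>w t x - w t y\<bar> \<le> L * norm (x - y)"
    using add.IH(1) by blast
  obtain L' where
    L': "L' \<ge> 0" "\<And>t x y. t \<ge> 0 \<Longrightarrow> x \<in> sphere 0 1 \<Longrightarrow> y \<in> sphere 0 1 \<Longrightarrow> \<bar>w' t x - w' t y\<bar> \<le> L' * norm (x - y)"
    using add.IH(2) by blast
  have "\<bar>w t x + w' t x - (w t y + w' t y)\<bar> \<le> (L + L') * norm (x - y)"
    if "t \<ge> 0" "x \<in> sphere 0 1" "y \<in> sphere 0 1" for t x y
    using L(2)[OF that] L'(2)[OF that] unfolding distrib_right by linarith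
  with L(1) L'(1) show ?case by (intro exI[of _ "L + L'"]) auto
qed

section \<open>The uniform measure on the sphere\<close>

definition punctured_ball :: "(real^3) set" where
  "punctured_ball = ball 0 1 - {0}"

lemma punctured_ball_sets [measurable]: "punctured_ball \<in> sets borel"
  by (simp add: punctured_ball_def)

lemma sgn_measurable_borel [measurable]: "(sgn :: real^3 \<Rightarrow> real^3) \<in> borel_measurable borel"
  unfolding sgn_div_norm by measurable

lemma emeasure_sphere_area:
  assumes [measurable]: "A \<in> sets borel"
  shows "emeasure sphere_area A = 3 * emeasure lborel {x \<in> punctured_ball. sgn x \<in> A}"
proof -
  have m: "sgn \<in> measurable (restrict_space lborel (ball 0 1 - {0})) (borel :: (real^3) measure)"
    by (rule measurable_restrict_space1) simp
  have "emeasure sphere_area A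
      = 3 * emeasure (restrict_space lborel (ball 0 1 - {0})) (sgn -` A \<inter> (ball 0 1 - {0}))"
    unfolding sphere_area_def using m
    by (simp add: emeasure_distr space_restrict_space)
  also have "emeasure (restrict_space lborel (ball 0 1 - {0})) (sgn -` A \<inter> (ball 0 1 - {0}))
      = emeasure lborel (sgn -` A \<inter> (ball 0 1 - {0}))"
    by (rule emeasure_restrict_space) auto
  also have "sgn -` A \<inter> (ball 0 1 - {0}) = {x \<in> punctured_ball. sgn x \<in> A}"
    by (auto simp: punctured_ball_def)
  finally show ?thesis .
qed

lemma sets_uniform_sphere [measurable_cong, simp]: "sets uniform_sphere = sets borel"
  and space_uniform_sphere [simp]: "space uniform_sphere = UNIV"
  by (simp_all add: uniform_sphere_def sphere_area_def space_scale_measure)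

lemma sets_sphere_area: "sets sphere_area = sets borel"
  by (simp add: sphere_area_def)

text \<open>Reduces the uniform measure to volumes of cones in the unit ball; the factor 3 of the
  surface area cancels in the normalization.\<close>

lemma emeasure_uniform_sphere:
  assumes [measurable]: "A \<in> sets borel"
  shows "emeasure uniform_sphere A
    = emeasure lborel {x \<in> punctured_ball. sgn x \<in> A} / emeasure lborel (punctured_ball)"
proof -
  have s: "sphere 0 1 \<in> sets (borel :: (real^3) measure)" by simp
  have 1: "{x \<in> punctured_ball. sgn x \<in> sphere 0 1 \<inter> A} = {x \<in> punctured_ball. sgn x \<in> A}"
    "{x \<in> punctured_ball. sgn x \<in> sphere 0 1} = punctured_ball"
    by (auto simp: punctured_ball_def norm_sgn)
  have "emeasure uniform_sphere A = emeasure sphere_area (sphere 0 1 \<inter> A) / emeasure sphere_area (sphere 0 1)"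
    unfolding uniform_sphere_def
    by (rule emeasure_uniform_measure) (simp_all add: sets_sphere_area)
  also have "\<dots> = (3 * emeasure lborel {x \<in> punctured_ball. sgn x \<in> A}) / (3 * emeasure lborel punctured_ball)"
    by (subst (1 2) emeasure_sphere_area) (simp_all only: 1, simp_all)
  also have "\<dots> = emeasure lborel {x \<in> punctured_ball. sgn x \<in> A} / emeasure lborel punctured_ball"
    by (subst (1 2) mult.commute, rule divide_mult_eq) auto
  finally show ?thesis .
qed

lemma emeasure_punctured_ball:
  shows "emeasure lborel punctured_ball < \<infinity>" "emeasure lborel punctured_ball > 0"
proof -
  have "emeasure lborel punctured_ball \<le> emeasure lborel (ball (0::real^3) 1)"
    by (rule emeasure_mono) (auto simp: punctured_ball_def)
  also have "\<dots> < \<infinity>" by (rule emeasure_lborel_ball_finite)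
  finally show "emeasure lborel punctured_ball < \<infinity>" .
  have "emeasure lborel punctured_ball = emeasure lborel (ball (0::real^3) 1)"
    unfolding punctured_ball_def by (rule emeasure_Diff_null_set) auto
  also have "\<dots> > 0"
    using content_ball_pos[of 1 "0::real^3"] by (simp add: measure_def enn2real_positive_iff)
  finally show "emeasure lborel punctured_ball > 0" .
qed

lemma prob_space_uniform_sphere: "prob_space uniform_sphere"
proof
  have "{x \<in> punctured_ball. sgn x \<in> UNIV} = punctured_ball" by auto
  then show "emeasure uniform_sphere (space uniform_sphere) = 1"
    using emeasure_punctured_ball
    by (simp add: emeasure_uniform_sphere ennreal_divide_self order.strict_iff_order)
qed

interpretation US: prob_space uniform_sphere
  by (rule prob_space_uniform_sphere)

lemma measure_uniform_sphere:
  assumes [measurable]: "A \<in> sets borel"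
  shows "measure uniform_sphere A
    = measure lborel {x \<in> punctured_ball. sgn x \<in> A} / measure lborel punctured_ball"
proof -
  have fin: "emeasure lborel {x \<in> punctured_ball. sgn x \<in> A} < \<infinity>"
  proof -
    have "emeasure lborel {x \<in> punctured_ball. sgn x \<in> A} \<le> emeasure lborel punctured_ball"
      by (rule emeasure_mono) auto
    also note emeasure_punctured_ball(1)
    finally show ?thesis .
  qed
  have pos: "measure lborel punctured_ball > 0"
    using emeasure_punctured_ball by (simp add: measure_def enn2real_positive_iff)
  have "emeasure uniform_sphere A
      = ennreal (measure lborel {x \<in> punctured_ball. sgn x \<in> A} / measure lborel punctured_ball)"
    using fin emeasure_punctured_ball pos
    by (subst emeasure_uniform_sphere) (simp_all add: emeasure_eq_ennreal_measure divide_ennreal less_top)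
  then show ?thesis
    using pos by (simp add: measure_def[of uniform_sphere])
qed

lemma AE_uniform_sphere: "AE x in uniform_sphere. x \<in> sphere 0 1"
proof (rule US.AE_prob_1)
  have "{x \<in> punctured_ball. sgn x \<in> sphere 0 1} = punctured_ball"
    by (auto simp: punctured_ball_def norm_sgn)
  moreover have "measure lborel punctured_ball \<noteq> 0"
    using emeasure_punctured_ball by (auto simp: measure_def enn2real_eq_0_iff)
  ultimately show "US.prob (sphere 0 1) = 1"
    by (subst measure_uniform_sphere) simp_all
qed

text \<open>An orthogonal map commutes with \<open>sgn\<close> and preserves the punctured ball, so
  it maps the cone over the preimage of A onto the cone over A; it also preserves Lebesgue
  measure.\<close>

lemma distr_orthogonal_uniform_sphere:
  fixes f :: "real^3 \<Rightarrow> real^3"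
  assumes f: "orthogonal_transformation f"
  shows "distr uniform_sphere borel f = uniform_sphere"
proof (rule measure_eqI)
  have lin: "linear f" using f by (simp add: orthogonal_transformation_def)
  have [measurable]: "f \<in> borel_measurable borel"
    using lin by (intro borel_measurable_continuous_onI) (simp add: linear_continuous_on linear_conv_bounded_linear)
  have nf: "norm (f x) = norm x" for x using f by (simp add: orthogonal_transformation)
  have sf: "sgn (f x) = f (sgn x)" for x
    using lin by (simp add: sgn_div_norm nf linear_scale)
  fix A assume "A \<in> sets (distr uniform_sphere borel f)"
  then have [measurable]: "A \<in> sets borel" by simp
  let ?S = "{x \<in> punctured_ball. sgn x \<in> f -` A}"
  let ?T = "{x \<in> punctured_ball. sgn x \<in> A}"
  have fS: "f -` A \<in> sets borel"
    using measurable_sets[OF \<open>f \<in> borel_measurable borel\<close> \<open>A \<in> sets borel\<close>] by simp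
  have "f ` ?S = ?T"
  proof (intro set_eqI iffI)
    fix y assume "y \<in> f ` ?S"
    then obtain x where "y = f x" "x \<in> punctured_ball" "f (sgn x) \<in> A" by auto
    then show "y \<in> ?T" using nf[of x] by (auto simp: punctured_ball_def sf)
  next
    fix y assume y: "y \<in> ?T"
    obtain x where x: "y = f x" using f orthogonal_transformation_surj by (metis surjD)
    with y nf[of x] show "y \<in> f ` ?S" by (auto simp: punctured_ball_def sf)
  qed
  moreover have meas: "?S \<in> sets lborel" using fS by measurable
  have "emeasure lborel ?S < \<infinity>"
  proof -
    have "emeasure lborel ?S \<le> emeasure lborel punctured_ball"
      by (rule emeasure_mono) auto
    also note emeasure_punctured_ball(1)
    finally show ?thesis .
  qed
  then have "?S \<in> lmeasurable" using meas by (intro fmeasurableI) auto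
  then have "measure lebesgue (f ` ?S) = measure lebesgue ?S"
    by (rule measure_orthogonal_image[OF f])
  ultimately have "measure lebesgue ?T = measure lebesgue ?S" by simp
  then have "measure lborel ?T = measure lborel ?S"
    using meas by (simp add: measure_completion)
  then have "US.prob A = US.prob (f -` A)"
    using fS by (simp add: measure_uniform_sphere)
  then show "emeasure (distr uniform_sphere borel f) A = emeasure uniform_sphere A"
    by (simp add: emeasure_distr US.emeasure_eq_measure)
qed simp

lemma integral_orthogonal_uniform_sphere:
  fixes f :: "real^3 \<Rightarrow> real^3" and g :: "real^3 \<Rightarrow> real"
  assumes f: "orthogonal_transformation f" and [measurable]: "g \<in> borel_measurable borel"
  shows "(\<integral>y. g (f y) \<partial>uniform_sphere) = (\<integral>y. g y \<partial>uniform_sphere)"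
proof -
  have "f \<in> borel_measurable borel"
    using f by (intro borel_measurable_continuous_onI)
      (simp add: linear_continuous_on linear_conv_bounded_linear orthogonal_transformation_def)
  then show ?thesis
    by (subst (2) distr_orthogonal_uniform_sphere[OF f, symmetric], subst integral_distr) simp_all
qed

text \<open>Orthogonal maps act transitively on each sphere around the origin. Hence all vertices
  have the same edge probability and the same kernel moment.\<close>

lemma integral_radial_uniform_sphere:
  fixes \<phi> :: "real \<Rightarrow> real"
  assumes [measurable]: "\<phi> \<in> borel_measurable borel" and "norm x = norm x'"
  shows "(\<integral>y. \<phi> ((norm (x - y))\<^sup>2) \<partial>uniform_sphere) = (\<integral>y. \<phi> ((norm (x' - y))\<^sup>2) \<partial>uniform_sphere)"
proof -
  obtain f where f: "orthogonal_transformation f" "f x = x'"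
    using orthogonal_transformation_exists[OF assms(2)] by blast
  have "norm (x' - f y) = norm (x - y)" for y
    using f unfolding orthogonal_transformation_def
    by (metis f(1) linear_diff orthogonal_transformation_norm)
  then have "(\<integral>y. \<phi> ((norm (x - y))\<^sup>2) \<partial>uniform_sphere) = (\<integral>y. \<phi> ((norm (x' - f y))\<^sup>2) \<partial>uniform_sphere)"
    by simp
  also have "\<dots> = (\<integral>y. \<phi> ((norm (x' - y))\<^sup>2) \<partial>uniform_sphere)"
    by (rule integral_orthogonal_uniform_sphere[OF f(1), of "\<lambda>y. \<phi> ((norm (x' - y))\<^sup>2)"]) simp
  finally show ?thesis .
qed

section \<open>Area of spherical caps up to constants\<close>

lemma prod_3: "(\<Prod>i\<in>UNIV. f (i::3)) = f 1 * f 2 * f 3"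
  by (simp only: UNIV_3) (simp add: mult.assoc)

text \<open>Orders of magnitude are enough: after rotating x to \<open>e\<close>, the cone over the
  cap contains one box and lies in another, both of volume proportional to r.\<close>

lemma measure_cap_bounds:
  "\<exists>c>0. \<exists>C>0. \<forall>r. 0 < r \<longrightarrow> r \<le> 1 \<longrightarrow> (\<forall>x\<in>sphere 0 1.
     c * r \<le> measure uniform_sphere {y. (norm (x - y))\<^sup>2 < r} \<and>
     measure uniform_sphere {y. (norm (x - y))\<^sup>2 \<le> r} \<le> C * r)"
proof -
  define e :: "real^3" where "e = axis 3 1"
  define V where "V = measure lborel punctured_ball"
  have V: "V > 0"
    unfolding V_def using emeasure_punctured_ball
    by (simp add: measure_def enn2real_positive_iff)
  have rot: "measure uniform_sphere {y. P ((norm (x - y))\<^sup>2)} = measure uniform_sphere {y. P ((norm (e - y))\<^sup>2)}"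
    if "x \<in> sphere 0 1" and [measurable]: "Measurable.pred borel P" for x P
  proof -
    have ind: "measure uniform_sphere {y. P ((norm (z - y))\<^sup>2)}
        = (\<integral>y. indicator {s. P s} ((norm (z - y))\<^sup>2) \<partial>uniform_sphere)" for z
    proof -
      have "(\<lambda>y. indicator {s. P s} ((norm (z - y))\<^sup>2)) = (indicator {y. P ((norm (z - y))\<^sup>2)} :: _ \<Rightarrow> real)"
        by (auto simp: indicator_def)
      then show ?thesis by simp
    qed
    show ?thesis unfolding ind
      by (rule integral_radial_uniform_sphere) (use that in \<open>auto simp: e_def\<close>)
  qed
  have ee: "(norm (e - y))\<^sup>2 = 2 - 2 * y $ 3" if "norm y = 1" for y
    using that by (simp add: e_def power2_norm_eq_inner inner_diff norm_eq_1 inner_axis inner_axis' inner_commute)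
  have upper: "measure uniform_sphere {y. (norm (e - y))\<^sup>2 \<le> r} \<le> (8 / V) * r" if "0 < r" "r \<le> 1" for r
  proof -
    let ?S = "{x \<in> punctured_ball. sgn x \<in> {y. (norm (e - y))\<^sup>2 \<le> r}}"
    \<comment> \<open>On the cap y_3 >= 1 - r/2, hence y_1^2 + y_2^2 <= r. The box has sides 2 sqrt
      r, 2 sqrt r and 2, so its volume is 8 r.\<close>
    define b :: "real^3" where "b = (\<chi> i. if i = 3 then 1 else sqrt r)"
    have "?S \<subseteq> cbox (-b) b"
    proof
      fix x assume x: "x \<in> ?S"
      then have n: "norm x > 0" "norm x < 1" by (auto simp: punctured_ball_def)
      define y where "y = sgn x"
      have y: "norm y = 1" "x = norm x *\<^sub>R y" using n by (auto simp: y_def norm_sgn sgn_div_norm)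
      have "1 - r / 2 \<le> y $ 3" using x ee[OF y(1)] by (simp add: y_def)
      moreover have "(y $ 1)\<^sup>2 + (y $ 2)\<^sup>2 + (y $ 3)\<^sup>2 = 1"
        using y(1) by (simp add: norm_eq_1 inner_vec_def sum_3 power2_eq_square)
      moreover have "(1 - r / 2)\<^sup>2 \<ge> 1 - r" by (simp add: power2_diff)
      ultimately have "(y $ 1)\<^sup>2 + (y $ 2)\<^sup>2 \<le> r"
        using power_mono[OF \<open>1 - r / 2 \<le> y $ 3\<close>, of 2] that by linarith
      then have "(y $ 1)\<^sup>2 \<le> r" "(y $ 2)\<^sup>2 \<le> r"
        using zero_le_power2[of "y $ 1"] zero_le_power2[of "y $ 2"] by linarith+
      then have "\<bar>y $ 1\<bar> \<le> sqrt r" "\<bar>y $ 2\<bar> \<le> sqrt r" "\<bar>y $ 3\<bar> \<le> 1"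
        using component_le_norm_cart[of y 3] y(1) by (auto intro: real_le_rsqrt)
      moreover have "\<bar>x $ i\<bar> \<le> \<bar>y $ i\<bar>" for i
        using n by (subst y(2)) (simp add: abs_mult mult_left_le_one_le)
      ultimately have "\<bar>x $ 1\<bar> \<le> sqrt r" "\<bar>x $ 2\<bar> \<le> sqrt r" "\<bar>x $ 3\<bar> \<le> 1"
        by (meson order_trans)+
      then have "\<forall>i. - b $ i \<le> x $ i \<and> x $ i \<le> b $ i"
        by (simp add: forall_3 b_def abs_le_iff)
      then show "x \<in> cbox (-b) b" by (simp add: mem_box_cart)
    qed
    then have "measure lborel ?S \<le> measure lborel (cbox (-b) b)"
      by (rule measure_mono_fmeasurable) (auto simp: fmeasurable_cbox)
    also have "\<dots> = (\<Prod>i\<in>UNIV. b $ i - (- b) $ i)"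
      using that by (subst content_cbox_cart) (auto simp: interval_eq_empty_cart b_def not_less)
    also have "\<dots> = 8 * r"
      using that by (simp add: prod_3 b_def)
    finally show ?thesis
      using V by (subst measure_uniform_sphere) (auto simp: V_def divide_right_mono)
  qed
  have lower: "(1 / 256) / V * r \<le> measure uniform_sphere {y. (norm (e - y))\<^sup>2 < r}" if "0 < r" "r \<le> 1" for r
  proof -
    let ?S = "{x \<in> punctured_ball. sgn x \<in> {y. (norm (e - y))\<^sup>2 < r}}"
    \<comment> \<open>Heights between 1/2 and 3/4 keep the box inside the ball and |x| at least 1/2.
      The horizontal size sqrt r / 8 gives |x| - x_3 <= r/32 < (r/2) |x|, which is the cap
      condition. The volume is (r/64) (1/4).\<close>
    define a :: "real^3" where "a = (\<chi> i. if i = 3 then 1/2 else 0)"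
    define b :: "real^3" where "b = (\<chi> i. if i = 3 then 3/4 else sqrt r / 8)"
    have "cbox a b \<subseteq> ?S"
    proof
      fix x assume "x \<in> cbox a b"
      then have "\<forall>i. a $ i \<le> x $ i \<and> x $ i \<le> b $ i" by (simp add: mem_box_cart)
      then have x: "1/2 \<le> x $ 3" "x $ 3 \<le> 3/4" "0 \<le> x $ 1" "x $ 1 \<le> sqrt r / 8" "0 \<le> x $ 2" "x $ 2 \<le> sqrt r / 8"
        by (simp_all add: forall_3 a_def b_def)
      have sq: "(x $ 1)\<^sup>2 \<le> r / 64" "(x $ 2)\<^sup>2 \<le> r / 64"
        using power_mono[OF x(4,3), of 2] power_mono[OF x(6,5), of 2] that by (simp_all add: power_divide)
      have nx: "(norm x)\<^sup>2 = (x $ 1)\<^sup>2 + (x $ 2)\<^sup>2 + (x $ 3)\<^sup>2"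
        unfolding power2_norm_eq_inner inner_vec_def sum_3 by (simp add: power2_eq_square)
      have "(x $ 3)\<^sup>2 \<le> (3/4)\<^sup>2" using x by (intro power_mono) auto
      then have "(norm x)\<^sup>2 < 1\<^sup>2" using nx sq that by (simp add: power2_eq_square)
      then have n1: "norm x < 1" by (rule power2_less_imp_less) simp
      have n3: "x $ 3 \<le> norm x" using component_le_norm_cart[of x 3] by simp
      have n0: "norm x > 0" using n3 x by linarith
      have "(norm x)\<^sup>2 - (x $ 3)\<^sup>2 \<le> r / 32" using nx sq by simp
      then have "(norm x - x $ 3) * (norm x + x $ 3) \<le> r / 32"
        by (simp add: power2_eq_square algebra_simps)
      moreover have "(norm x - x $ 3) * 1 \<le> (norm x - x $ 3) * (norm x + x $ 3)"
        using n3 x by (intro mult_left_mono) auto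
      ultimately have "norm x - x $ 3 \<le> r / 32" by simp
      then have "norm x - x $ 3 < r / 2 * (1 / 2)" using that by simp
      also have "\<dots> \<le> r / 2 * norm x" using n3 x that by (intro mult_left_mono) auto
      finally have "1 - x $ 3 / norm x < r / 2" using n0 by (simp add: field_simps)
      moreover have "sgn x $ 3 = x $ 3 / norm x"
        by (simp add: sgn_div_norm divide_inverse)
      moreover have "norm (sgn x) = 1" using n0 by (simp add: norm_sgn)
      ultimately have "(norm (e - sgn x))\<^sup>2 < r" using ee[of "sgn x"] by linarith
      then show "x \<in> ?S" using n0 n1 by (auto simp: punctured_ball_def)
    qed
    moreover have "?S \<in> fmeasurable lborel"
    proof (rule fmeasurableI)
      show "?S \<in> sets lborel" by measurable
      have "emeasure lborel ?S \<le> emeasure lborel punctured_ball"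
        by (rule emeasure_mono) auto
      also note emeasure_punctured_ball(1)
      finally show "emeasure lborel ?S < \<infinity>" .
    qed
    ultimately have "measure lborel (cbox a b) \<le> measure lborel ?S"
      by (intro measure_mono_fmeasurable) auto
    moreover have "measure lborel (cbox a b) = (\<Prod>i\<in>UNIV. b $ i - a $ i)"
      using that by (subst content_cbox_cart) (auto simp: interval_eq_empty_cart a_def b_def not_less)
    moreover have "\<dots> = r / 256"
      using that by (simp add: prod_3 a_def b_def)
    ultimately have "r / 256 \<le> measure lborel ?S" by simp
    then have "r / 256 / V \<le> measure lborel ?S / V"
      using V by (intro divide_right_mono) auto
    then show ?thesis
      by (subst measure_uniform_sphere) (auto simp: V_def)
  qed
  have "(1 / 256) / V > 0" "8 / V > 0" using V by simp_all
  moreover have "(1 / 256) / V * r \<le> measure uniform_sphere {y. (norm (x - y))\<^sup>2 < r} \<and>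
      measure uniform_sphere {y. (norm (x - y))\<^sup>2 \<le> r} \<le> 8 / V * r"
    if r: "0 < r" "r \<le> 1" and x: "x \<in> sphere 0 1" for r and x :: "real^3"
    using lower[OF r] rot[OF x, of "\<lambda>s. s < r"] upper[OF r] rot[OF x, of "\<lambda>s. s \<le> r"] by simp
  ultimately show ?thesis by blast
qed

section \<open>Concentration of pair statistics\<close>

lemma exp_le_quadratic:
  fixes z :: real
  assumes "\<bar>z\<bar> \<le> 1"
  shows "exp z \<le> 1 + z + z\<^sup>2"
proof (cases "z \<ge> 0")
  case True
  then show ?thesis using exp_bound[of z] assms by simp
next
  case False
  define w where "w = - z"
  have w: "w > 0" using False by (simp add: w_def)
  have "exp z = inverse (exp w)" by (simp add: w_def exp_minus)
  also have "\<dots> \<le> inverse (1 + w)"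
    using w exp_ge_add_one_self[of w] by (intro le_imp_inverse_le) auto
  also have "\<dots> \<le> 1 - w + w\<^sup>2"
  proof -
    \<comment> \<open>The product equals 1 + w^3.\<close>
    have "1 \<le> (1 - w + w\<^sup>2) * (1 + w)"
      using w by (simp add: algebra_simps power2_eq_square)
    then show ?thesis using w by (simp add: inverse_eq_divide pos_divide_le_eq)
  qed
  finally show ?thesis by (simp add: w_def)
qed

text \<open>Bernstein's argument: a quadratic bound for exp on [-1, 1] turns bounds on mean and
  second moment into one on the moment generating function, with 1 + a <= exp a as the last
  step.\<close>

lemma mgf_bound:
  fixes h :: "real^3 \<Rightarrow> real"
  assumes [measurable]: "h \<in> borel_measurable borel"
    and s: "s \<ge> 0"
    and bound: "\<And>y. y \<in> sphere 0 1 \<Longrightarrow> \<bar>s * h y\<bar> \<le> 1"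
    and m: "(\<integral>y. h y \<partial>uniform_sphere) \<le> m"
    and v: "(\<integral>y. (h y)\<^sup>2 \<partial>uniform_sphere) \<le> v"
  shows "(\<integral>\<^sup>+y. ennreal (exp (s * h y)) \<partial>uniform_sphere) \<le> ennreal (exp (s * m + s\<^sup>2 * v))"
proof (cases "s = 0")
  case True
  then show ?thesis using US.emeasure_space_1 by simp
next
  case False
  with s have s0: "s > 0" by simp
  have hb: "\<bar>h y\<bar> \<le> 1 / s" if "y \<in> sphere 0 1" for y
    using bound[OF that] s0 by (simp add: abs_mult field_simps)
  have int1: "integrable uniform_sphere h"
    by (rule US.integrable_const_bound[of _ "1 / s"]) (use AE_uniform_sphere hb in auto)
  have int2: "integrable uniform_sphere (\<lambda>y. (h y)\<^sup>2)"
  proof (rule US.integrable_const_bound[of _ "(1 / s)\<^sup>2"])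
    show "AE y in uniform_sphere. norm ((h y)\<^sup>2) \<le> (1 / s)\<^sup>2"
      using AE_uniform_sphere by eventually_elim (use hb s0 in \<open>auto simp: abs_le_square_iff[symmetric]\<close>)
  qed simp
  have "(\<integral>\<^sup>+y. ennreal (exp (s * h y)) \<partial>uniform_sphere)
      \<le> (\<integral>\<^sup>+y. ennreal (1 + s * h y + s\<^sup>2 * (h y)\<^sup>2) \<partial>uniform_sphere)"
  proof (rule nn_integral_mono_AE)
    show "AE y in uniform_sphere. ennreal (exp (s * h y)) \<le> ennreal (1 + s * h y + s\<^sup>2 * (h y)\<^sup>2)"
      using AE_uniform_sphere
      by eventually_elim (auto intro!: ennreal_leI exp_le_quadratic[THEN order_trans] bound simp: power_mult_distrib)
  qed
  also have "\<dots> = ennreal (\<integral>y. 1 + s * h y + s\<^sup>2 * (h y)\<^sup>2 \<partial>uniform_sphere)"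
  proof (rule nn_integral_eq_integral)
    show "AE y in uniform_sphere. 0 \<le> 1 + s * h y + s\<^sup>2 * (h y)\<^sup>2"
      using AE_uniform_sphere
    proof eventually_elim
      case (elim y)
      then have "\<bar>s * h y\<bar> \<le> 1" by (rule bound)
      then have "0 \<le> 1 + s * h y" by linarith
      moreover have "0 \<le> s\<^sup>2 * (h y)\<^sup>2" by simp
      ultimately show ?case by linarith
    qed
  qed (use int1 int2 in auto)
  also have "(\<integral>y. 1 + s * h y + s\<^sup>2 * (h y)\<^sup>2 \<partial>uniform_sphere)
      = 1 + s * (\<integral>y. h y \<partial>uniform_sphere) + s\<^sup>2 * (\<integral>y. (h y)\<^sup>2 \<partial>uniform_sphere)"
    using int1 int2 US.prob_space by simp
  also have "\<dots> \<le> 1 + (s * m + s\<^sup>2 * v)"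
    using m v s by (simp add: mult_left_mono add_mono)
  also have "\<dots> \<le> exp (s * m + s\<^sup>2 * v)" by (rule exp_ge_add_one_self)
  finally show ?thesis by (simp add: ennreal_leI)
qed

lemma distr_PiM_uniform_sphere:
  fixes X :: "'i \<Rightarrow> 'w \<Rightarrow> real^3"
  assumes "prob_space M" "I \<noteq> {}"
    and indep: "prob_space.indep_vars M (\<lambda>_. borel) X I"
    and distr: "\<And>j. j \<in> I \<Longrightarrow> distr M borel (X j) = uniform_sphere"
  shows "distr M (PiM I (\<lambda>_. borel)) (\<lambda>\<omega>. \<lambda>j\<in>I. X j \<omega>) = PiM I (\<lambda>_. uniform_sphere)"
proof -
  interpret prob_space M by fact
  have "random_variable borel (X j)" if "j \<in> I" for j
    using indep that by (auto simp: indep_vars_def)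
  with indep have "distr M (PiM I (\<lambda>_. borel)) (\<lambda>\<omega>. \<lambda>j\<in>I. X j \<omega>) = PiM I (\<lambda>i. distr M borel (X i))"
    using indep_vars_iff_distr_eq_PiM'[OF \<open>I \<noteq> {}\<close>, where M' = "\<lambda>_. borel" and X = X] by simp
  also have "\<dots> = PiM I (\<lambda>_. uniform_sphere)"
    by (rule PiM_cong) (auto simp: distr)
  finally show ?thesis .
qed

text \<open>Fubini on the product measure takes the place of conditioning on \<open>X i\<close>:
  once x is fixed, the other coordinates contribute identical independent factors.\<close>

lemma nn_integral_prod_pairs:
  fixes X :: "'i \<Rightarrow> 'w \<Rightarrow> real^3" and f :: "real^3 \<Rightarrow> real^3 \<Rightarrow> ennreal"
  assumes "prob_space M" "finite J" "i \<notin> J"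
    and indep: "prob_space.indep_vars M (\<lambda>_. borel) X (insert i J)"
    and distr: "\<And>j. j \<in> insert i J \<Longrightarrow> distr M borel (X j) = uniform_sphere"
    and f [measurable]: "(\<lambda>(x, y). f x y) \<in> borel_measurable (borel \<Otimes>\<^sub>M borel)"
  shows "(\<integral>\<^sup>+\<omega>. (\<Prod>j\<in>J. f (X i \<omega>) (X j \<omega>)) \<partial>M)
    = (\<integral>\<^sup>+x. (\<integral>\<^sup>+y. f x y \<partial>uniform_sphere) ^ card J \<partial>uniform_sphere)"
proof -
  interpret prob_space M by fact
  interpret P: product_sigma_finite "\<lambda>_::'i. uniform_sphere" ..
  have rv: "X j \<in> borel_measurable M" if "j \<in> insert i J" for j
    using indep that by (auto simp: indep_vars_def)
  have H: "(\<lambda>z. \<Prod>j\<in>J. f (z i) (z j)) \<in> borel_measurable (PiM (insert i J) (\<lambda>_. borel :: (real^3) measure))"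
  proof (rule borel_measurable_prod_ennreal)
    fix j assume j: "j \<in> J"
    have "(\<lambda>z. (z i, z j)) \<in> measurable (PiM (insert i J) (\<lambda>_. borel :: (real^3) measure)) (borel \<Otimes>\<^sub>M borel)"
      using j by (intro measurable_Pair measurable_component_singleton) auto
    from measurable_compose[OF this f]
    show "(\<lambda>z. f (z i) (z j)) \<in> borel_measurable (PiM (insert i J) (\<lambda>_. borel :: (real^3) measure))"
      by simp
  qed
  have H': "(\<lambda>z. \<Prod>j\<in>J. f (z i) (z j)) \<in> borel_measurable (PiM (insert i J) (\<lambda>_. uniform_sphere))"
    using H by (simp cong: measurable_cong_sets sets_PiM_cong)
  have "(\<integral>\<^sup>+\<omega>. (\<Prod>j\<in>J. f (X i \<omega>) (X j \<omega>)) \<partial>M)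
      = (\<integral>\<^sup>+\<omega>. (\<lambda>z. \<Prod>j\<in>J. f (z i) (z j)) (\<lambda>j\<in>insert i J. X j \<omega>) \<partial>M)"
    by (intro nn_integral_cong prod.cong) auto
  also have "\<dots> = (\<integral>\<^sup>+z. (\<Prod>j\<in>J. f (z i) (z j))
      \<partial>distr M (PiM (insert i J) (\<lambda>_. borel)) (\<lambda>\<omega>. \<lambda>j\<in>insert i J. X j \<omega>))"
    using H by (subst nn_integral_distr) (auto intro!: measurable_restrict rv)
  also have "\<dots> = (\<integral>\<^sup>+z. (\<Prod>j\<in>J. f (z i) (z j)) \<partial>PiM (insert i J) (\<lambda>_. uniform_sphere))"
    by (subst distr_PiM_uniform_sphere[OF assms(1) _ indep distr]) auto
  also have "\<dots> = (\<integral>\<^sup>+x. (\<integral>\<^sup>+z. (\<Prod>j\<in>J. f ((z(i := x)) i) ((z(i := x)) j)) \<partial>PiM J (\<lambda>_. uniform_sphere)) \<partial>uniform_sphere)"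
    by (rule P.product_nn_integral_insert_rev[OF \<open>finite J\<close> \<open>i \<notin> J\<close> H'])
  also have "\<dots> = (\<integral>\<^sup>+x. (\<integral>\<^sup>+y. f x y \<partial>uniform_sphere) ^ card J \<partial>uniform_sphere)"
  proof (rule nn_integral_cong)
    fix x :: "real^3"
    have fx: "f x \<in> borel_measurable uniform_sphere"
      using measurable_compose[OF measurable_Pair1' f, of x] by simp
    have "(\<integral>\<^sup>+z. (\<Prod>j\<in>J. f ((z(i := x)) i) ((z(i := x)) j)) \<partial>PiM J (\<lambda>_. uniform_sphere))
        = (\<integral>\<^sup>+z. (\<Prod>j\<in>J. f x (z j)) \<partial>PiM J (\<lambda>_. uniform_sphere))"
      using \<open>i \<notin> J\<close> by (intro nn_integral_cong prod.cong) auto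
    also have "\<dots> = (\<integral>\<^sup>+y. f x y \<partial>uniform_sphere) ^ card J"
      using fx by (subst P.product_nn_integral_prod[OF \<open>finite J\<close>]) auto
    finally show "(\<integral>\<^sup>+z. (\<Prod>j\<in>J. f ((z(i := x)) i) ((z(i := x)) j)) \<partial>PiM J (\<lambda>_. uniform_sphere))
        = (\<integral>\<^sup>+y. f x y \<partial>uniform_sphere) ^ card J" .
  qed
  finally show ?thesis .
qed

text \<open>Markov's inequality for the exponential of the sum. As \<open>m\<close> and
  \<open>v\<close> are bounds for every x on the sphere, the inner integral is estimated before the
  outer one is taken.\<close>

lemma pair_chernoff:
  fixes X :: "'i \<Rightarrow> 'w \<Rightarrow> real^3" and g :: "real^3 \<Rightarrow> real^3 \<Rightarrow> real"
  assumes "prob_space M" "finite J" "i \<notin> J"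
    and indep: "prob_space.indep_vars M (\<lambda>_. borel) X (insert i J)"
    and distr: "\<And>j. j \<in> insert i J \<Longrightarrow> distr M borel (X j) = uniform_sphere"
    and g [measurable]: "(\<lambda>(x, y). g x y) \<in> borel_measurable (borel \<Otimes>\<^sub>M borel)"
    and s: "s \<ge> 0"
    and bound: "\<And>x y. x \<in> sphere 0 1 \<Longrightarrow> y \<in> sphere 0 1 \<Longrightarrow> \<bar>s * g x y\<bar> \<le> 1"
    and m: "\<And>x. x \<in> sphere 0 1 \<Longrightarrow> (\<integral>y. g x y \<partial>uniform_sphere) \<le> m"
    and v: "\<And>x. x \<in> sphere 0 1 \<Longrightarrow> (\<integral>y. (g x y)\<^sup>2 \<partial>uniform_sphere) \<le> v"
  shows "measure M {\<omega> \<in> space M. a \<le> (\<Sum>j\<in>J. g (X i \<omega>) (X j \<omega>))}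
    \<le> exp (real (card J) * (s * m + s\<^sup>2 * v) - s * a)"
proof -
  interpret prob_space M by fact
  have rv: "X j \<in> borel_measurable M" if "j \<in> insert i J" for j
    using indep that by (auto simp: indep_vars_def)
  have gX: "(\<lambda>\<omega>. g (X i \<omega>) (X j \<omega>)) \<in> borel_measurable M" if "j \<in> J" for j
    using measurable_compose[OF measurable_Pair[OF rv[of i] rv[of j]] g] that by simp
  have Fm [measurable]: "(\<lambda>\<omega>. \<Sum>j\<in>J. g (X i \<omega>) (X j \<omega>)) \<in> borel_measurable M"
    using gX by (rule borel_measurable_sum)
  have ef: "(\<lambda>(x, y). ennreal (exp (s * g x y))) \<in> borel_measurable (borel \<Otimes>\<^sub>M borel)"
    using g by (simp add: case_prod_beta')
  let ?A = "{\<omega> \<in> space M. a \<le> (\<Sum>j\<in>J. g (X i \<omega>) (X j \<omega>))}"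
  have "emeasure M ?A = (\<integral>\<^sup>+\<omega>. indicator ?A \<omega> \<partial>M)" by simp
  also have "\<dots> \<le> (\<integral>\<^sup>+\<omega>. ennreal (exp (- s * a)) * (\<Prod>j\<in>J. ennreal (exp (s * g (X i \<omega>) (X j \<omega>)))) \<partial>M)"
  proof (rule nn_integral_mono)
    fix \<omega>
    have "ennreal (exp (- s * a)) * (\<Prod>j\<in>J. ennreal (exp (s * g (X i \<omega>) (X j \<omega>))))
        = ennreal (exp (s * ((\<Sum>j\<in>J. g (X i \<omega>) (X j \<omega>)) - a)))"
      by (simp add: prod_ennreal ennreal_mult[symmetric] exp_sum[OF \<open>finite J\<close>, symmetric]
          exp_add[symmetric] sum_distrib_left[symmetric] algebra_simps)
    then show "indicator ?A \<omega> \<le> ennreal (exp (- s * a)) * (\<Prod>j\<in>J. ennreal (exp (s * g (X i \<omega>) (X j \<omega>))))"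
      using s by (auto simp: indicator_def)
  qed
  also have "\<dots> = ennreal (exp (- s * a)) * (\<integral>\<^sup>+\<omega>. (\<Prod>j\<in>J. ennreal (exp (s * g (X i \<omega>) (X j \<omega>)))) \<partial>M)"
    using gX by (intro nn_integral_cmult borel_measurable_prod_ennreal) auto
  also have "(\<integral>\<^sup>+\<omega>. (\<Prod>j\<in>J. ennreal (exp (s * g (X i \<omega>) (X j \<omega>)))) \<partial>M)
      = (\<integral>\<^sup>+x. (\<integral>\<^sup>+y. ennreal (exp (s * g x y)) \<partial>uniform_sphere) ^ card J \<partial>uniform_sphere)"
    by (rule nn_integral_prod_pairs[OF assms(1-3) indep distr ef])
  also have "\<dots> \<le> (\<integral>\<^sup>+x. ennreal (exp (s * m + s\<^sup>2 * v)) ^ card J \<partial>uniform_sphere)"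
  proof (rule nn_integral_mono_AE)
    show "AE x in uniform_sphere. (\<integral>\<^sup>+y. ennreal (exp (s * g x y)) \<partial>uniform_sphere) ^ card J
        \<le> ennreal (exp (s * m + s\<^sup>2 * v)) ^ card J"
      using AE_uniform_sphere
    proof eventually_elim
      case (elim x)
      have "g x \<in> borel_measurable borel"
        using measurable_compose[OF measurable_Pair1' g, of x] by simp
      then show ?case
        using s bound m v elim by (intro power_mono mgf_bound) auto
    qed
  qed
  also have "\<dots> = ennreal (exp (real (card J) * (s * m + s\<^sup>2 * v)))"
    using US.emeasure_space_1 by (simp add: ennreal_power exp_of_nat_mult)
  finally have "emeasure M ?A \<le> ennreal (exp (- s * a)) * ennreal (exp (real (card J) * (s * m + s\<^sup>2 * v)))"
    by (simp add: mult_left_mono)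
  also have "\<dots> = ennreal (exp (real (card J) * (s * m + s\<^sup>2 * v) - s * a))"
    by (simp add: ennreal_mult[symmetric] exp_add[symmetric])
  finally show ?thesis
    by (simp add: emeasure_eq_measure)
qed

section \<open>Almost sure bounds at all vertices simultaneously\<close>

locale sphere_samples = prob_space M for M :: "'w measure" +
  fixes \<epsilon> :: "nat \<Rightarrow> real" and X :: "nat \<Rightarrow> nat \<Rightarrow> 'w \<Rightarrow> real^3"
  assumes eps_pos: "\<And>n. n \<ge> 1 \<Longrightarrow> \<epsilon> n > 0"
    and eps_lim: "\<epsilon> \<longlonglongrightarrow> 0"
    and growth: "\<And>C. \<forall>\<^sub>F n in sequentially. C * ln (real n) \<le> (\<epsilon> n)\<^sup>2 * real n"
    and indep: "\<And>n. n \<ge> 1 \<Longrightarrow> indep_vars (\<lambda>_. borel) (X n) {1..n}"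
    and in_sphere: "\<And>n i \<omega>. i \<in> {1..n} \<Longrightarrow> \<omega> \<in> space M \<Longrightarrow> X n i \<omega> \<in> sphere 0 1"
    and distr_X: "\<And>n i. i \<in> {1..n} \<Longrightarrow> distr M borel (X n i) = uniform_sphere"
begin

lemma measurable_X:
  assumes "i \<in> {1..n}"
  shows "X n i \<in> borel_measurable M"
  using indep[of n] assms by (simp add: indep_vars_def)

lemma measurable_pair_X:
  assumes "i \<in> {1..n}" "j \<in> {1..n}"
    and "(\<lambda>(x, y). g x y) \<in> borel_measurable (borel \<Otimes>\<^sub>M borel)"
  shows "(\<lambda>\<omega>. g (X n i \<omega>) (X n j \<omega>)) \<in> borel_measurable M"
  using measurable_compose[OF measurable_Pair[OF measurable_X[OF assms(1)] measurable_X[OF assms(2)]] assms(3)]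
  by simp

text \<open>With \<open>s\<close> fixed, the mean uses a quarter of the threshold and the quadratic
  term at most another quarter, so half of s \<eta> \<epsilon>^2 (n - 1) remains in the exponent.
  Eventually this exceeds 3 ln n; the union over n vertices then has probability at most n^(-2), and
  Borel-Cantelli applies.\<close>

lemma AE_pair_sums_less:
  fixes g :: "nat \<Rightarrow> real^3 \<Rightarrow> real^3 \<Rightarrow> real"
  assumes g [measurable]: "\<And>n. (\<lambda>(x, y). g n x y) \<in> borel_measurable (borel \<Otimes>\<^sub>M borel)"
    and "\<eta> > 0"
    and ev_bound: "\<forall>\<^sub>F n in sequentially. \<forall>x\<in>sphere 0 1. \<forall>y\<in>sphere 0 1. \<bar>g n x y\<bar> \<le> B"
    and ev_m: "\<forall>\<^sub>F n in sequentially. \<forall>x\<in>sphere 0 1. (\<integral>y. g n x y \<partial>uniform_sphere) \<le> \<eta> / 4 * (\<epsilon> n)\<^sup>2"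
    and ev_v: "\<forall>\<^sub>F n in sequentially. \<forall>x\<in>sphere 0 1. (\<integral>y. (g n x y)\<^sup>2 \<partial>uniform_sphere) \<le> v * (\<epsilon> n)\<^sup>2"
  shows "AE \<omega> in M. \<forall>\<^sub>F n in sequentially. \<forall>i\<in>{1..n}.
    (\<Sum>j\<in>{1..n} - {i}. g n (X n i \<omega>) (X n j \<omega>)) < \<eta> * (\<epsilon> n)\<^sup>2 * (real n - 1)"
proof -
  \<comment> \<open>The two entries of the minimum ensure |s g| <= 1 and s v <= \<eta>/4; the maxima
    with 1 keep the quotients positive.\<close>
  define s where "s = min (1 / max B 1) (\<eta> / (4 * max v 1))"
  have s: "s > 0" "s * max B 1 \<le> 1" "s * max v 1 \<le> \<eta> / 4"
  proof -
    show "s > 0" using \<open>\<eta> > 0\<close> by (simp add: s_def)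
    have "s \<le> 1 / max B 1" "s \<le> \<eta> / (4 * max v 1)" by (simp_all add: s_def)
    then show "s * max B 1 \<le> 1" "s * max v 1 \<le> \<eta> / 4"
      by (simp_all add: field_simps)
  qed
  define A where "A n i = {\<omega> \<in> space M. \<eta> * (\<epsilon> n)\<^sup>2 * (real n - 1)
    \<le> (\<Sum>j\<in>{1..n} - {i}. g n (X n i \<omega>) (X n j \<omega>))}" for n i
  define Bad where "Bad n = (\<Union>i\<in>{1..n}. A n i)" for n
  have A_sets [measurable]: "A n i \<in> sets M" if "i \<in> {1..n}" for n i
  proof -
    have "(\<lambda>\<omega>. \<Sum>j\<in>{1..n} - {i}. g n (X n i \<omega>) (X n j \<omega>)) \<in> borel_measurable M"
      using that g by (intro borel_measurable_sum measurable_pair_X) auto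
    then show ?thesis unfolding A_def by measurable
  qed
  have Bad_sets: "Bad n \<in> sets M" for n
    unfolding Bad_def by (intro sets.finite_UN A_sets) auto
  \<comment> \<open>The growth constant 12 / (s \<eta>): since n - 1 >= n/2, the exponent is at most
    - (s \<eta> / 4) \<epsilon>^2 n, which has to be at most - 3 ln n.\<close>
  have "\<forall>\<^sub>F n in sequentially. norm (prob (Bad n)) \<le> 1 / (real n) ^ 2"
    using ev_bound ev_m ev_v growth[of "12 / (s * \<eta>)"] eventually_ge_at_top[of 2]
  proof eventually_elim
    case (elim n)
    have PA: "prob (A n i) \<le> exp (- 3 * ln (real n))" if i: "i \<in> {1..n}" for i
    proof -
      have ins: "insert i ({1..n} - {i}) = {1..n}" using i by auto
      have card: "real (card ({1..n} - {i})) = real n - 1"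
        using i elim by (simp add: of_nat_diff)
      have "prob (A n i) \<le> exp (real (card ({1..n} - {i})) * (s * (\<eta> / 4 * (\<epsilon> n)\<^sup>2) + s\<^sup>2 * (v * (\<epsilon> n)\<^sup>2))
          - s * (\<eta> * (\<epsilon> n)\<^sup>2 * (real n - 1)))"
        unfolding A_def
      proof (rule pair_chernoff)
        show "prob_space M" by (rule prob_space_axioms)
        show "indep_vars (\<lambda>_. borel) (X n) (insert i ({1..n} - {i}))"
          unfolding ins using indep[of n] elim by simp
        show "distr M borel (X n j) = uniform_sphere" if "j \<in> insert i ({1..n} - {i})" for j
          using distr_X[of j n] that unfolding ins by simp
        fix x y :: "real^3" assume xy: "x \<in> sphere 0 1" "y \<in> sphere 0 1"
        have "\<bar>s * g n x y\<bar> = s * \<bar>g n x y\<bar>" using s by (simp add: abs_mult)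
        also have "\<dots> \<le> s * max B 1" using elim(1) xy s by (intro mult_left_mono) force+
        finally show "\<bar>s * g n x y\<bar> \<le> 1" using s by linarith
      qed (use elim s in auto)
      also have "\<dots> \<le> exp (- 3 * ln (real n))"
      proof -
        have "s\<^sup>2 * v \<le> s * (s * max v 1)"
          using s by (simp add: power2_eq_square mult.assoc mult_left_mono)
        also have "\<dots> \<le> s * (\<eta> / 4)" using s by (intro mult_left_mono) auto
        finally have sv: "s\<^sup>2 * v \<le> s * \<eta> / 4" by simp
        have "(real n - 1) * (s * (\<eta> / 4 * (\<epsilon> n)\<^sup>2) + s\<^sup>2 * (v * (\<epsilon> n)\<^sup>2)) - s * (\<eta> * (\<epsilon> n)\<^sup>2 * (real n - 1))
            = ((real n - 1) * (\<epsilon> n)\<^sup>2) * (s\<^sup>2 * v - 3 / 4 * (s * \<eta>))"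
          by (simp add: field_simps)
        also have "\<dots> \<le> ((real n - 1) * (\<epsilon> n)\<^sup>2) * (- (s * \<eta> / 2))"
          using sv elim by (intro mult_left_mono) auto
        also have "\<dots> \<le> ((real n / 2) * (\<epsilon> n)\<^sup>2) * (- (s * \<eta> / 2))"
          using s \<open>\<eta> > 0\<close> elim by (intro mult_right_mono_neg mult_right_mono) auto
        also have "\<dots> = - (s * \<eta> / 4) * ((\<epsilon> n)\<^sup>2 * real n)" by simp
        also have "\<dots> \<le> - (s * \<eta> / 4) * (12 / (s * \<eta>) * ln (real n))"
          using elim s \<open>\<eta> > 0\<close> by (intro mult_left_mono_neg) auto
        also have "\<dots> = - 3 * ln (real n)" using s \<open>\<eta> > 0\<close> by simp
        finally show ?thesis unfolding card by simp
      qed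
      finally show ?thesis .
    qed
    have "prob (Bad n) \<le> (\<Sum>i\<in>{1..n}. prob (A n i))"
      unfolding Bad_def by (rule finite_measure_subadditive_finite) (auto intro: A_sets)
    also have "\<dots> \<le> (\<Sum>i\<in>{1..n}. exp (- 3 * ln (real n)))"
      by (intro sum_mono PA)
    also have "\<dots> = real n * exp (- 3 * ln (real n))" by simp
    also have "exp (- 3 * ln (real n)) = 1 / real n ^ 3"
    proof -
      have "exp (- 3 * ln (real n)) = inverse (exp (real 3 * ln (real n)))"
        by (simp flip: exp_minus)
      also have "exp (real 3 * ln (real n)) = real n ^ 3"
        using elim by (subst exp_of_nat_mult) simp
      finally show ?thesis by (simp add: inverse_eq_divide)
    qed
    also have "real n * (1 / real n ^ 3) = 1 / (real n) ^ 2"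
      using elim by (simp add: power2_eq_square power3_eq_cube)
    finally show ?case by simp
  qed
  moreover have "summable (\<lambda>n. 1 / (real n) ^ 2)"
    using inverse_power_summable[of 2, where 'a = real] by (simp add: inverse_eq_divide)
  ultimately have "summable (\<lambda>n. prob (Bad n))"
    by (rule summable_comparison_test_ev)
  then have "AE \<omega> in M. \<forall>\<^sub>F n in sequentially. \<omega> \<in> space M - Bad n"
    by (intro borel_cantelli_AE1) (auto simp: Bad_sets emeasure_eq_measure)
  then show ?thesis
  proof eventually_elim
    case (elim \<omega>)
    then show ?case
      by eventually_elim (auto simp: Bad_def A_def not_le)
  qed
qed

end

section \<open>Rotations about a point of the sphere\<close>

text \<open>For a unit vector x this is the rotation by 90 degrees about x: the component along x is
  kept, and a tangential part v becomes \<open>cross3 x v\<close>.\<close>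

definition axis_rotation :: "real^3 \<Rightarrow> real^3 \<Rightarrow> real^3" where
  "axis_rotation x y = (x \<bullet> y) *\<^sub>R x + cross3 x y"

lemma norm_axis_rotation:
  assumes "norm x = 1"
  shows "norm (axis_rotation x y) = norm y"
proof -
  have "(norm (axis_rotation x y))\<^sup>2 = (x \<bullet> y)\<^sup>2 * (norm x)\<^sup>2 + (norm (cross3 x y))\<^sup>2"
    unfolding axis_rotation_def power2_norm_eq_inner
    by (simp add: inner_add dot_cross_self power2_eq_square)
  also have "\<dots> = (norm y)\<^sup>2"
    using norm_cross_dot[of x y] assms by simp
  finally show ?thesis by simp
qed

lemma linear_axis_rotation: "linear (axis_rotation x)"
  unfolding axis_rotation_def
  by (intro linearI) (simp_all add: inner_add_right scaleR_add_left cross_add_right cross_mult_right scaleR_add_right)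

lemma orthogonal_axis_rotation:
  assumes "norm x = 1"
  shows "orthogonal_transformation (axis_rotation x)"
  using assms by (simp add: orthogonal_transformation linear_axis_rotation norm_axis_rotation)

lemma axis_rotation_self: "norm x = 1 \<Longrightarrow> axis_rotation x x = x"
  by (simp add: axis_rotation_def norm_eq_1)

lemma dist_axis_rotation:
  assumes "norm x = 1"
  shows "norm (x - axis_rotation x y) = norm (x - y)"
proof -
  have "x - axis_rotation x y = axis_rotation x (x - y)"
    using linear_diff[OF linear_axis_rotation, of x x y] axis_rotation_self[OF assms] by simp
  then show ?thesis using norm_axis_rotation[OF assms] by simp
qed

lemma axis_rotation_twice:
  assumes "norm x = 1"
  shows "axis_rotation x (axis_rotation x y) = (2 * (x \<bullet> y)) *\<^sub>R x - y"
proof -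
  have "cross3 x (cross3 x y) = (x \<bullet> y) *\<^sub>R x - y"
    using assms by (simp add: Lagrange norm_eq_1)
  then have "axis_rotation x (axis_rotation x y) = (x \<bullet> y) *\<^sub>R x + ((x \<bullet> y) *\<^sub>R x - y)"
    using assms unfolding axis_rotation_def
    by (simp add: inner_add_right dot_cross_self cross_add_right cross_mult_right norm_eq_1)
  also have "\<dots> = (2 * (x \<bullet> y)) *\<^sub>R x - y"
    using scaleR_add_left[of "x \<bullet> y" "x \<bullet> y" x] by simp
  finally show ?thesis .
qed

text \<open>The squared triple product is the Gram determinant of b, x and y, written out.\<close>

lemma triple_product_gram:
  fixes b x y :: "real^3"
  shows "(b \<bullet> cross3 x y)\<^sup>2 = (b \<bullet> b) * (x \<bullet> x) * (y \<bullet> y) + 2 * (b \<bullet> x) * (x \<bullet> y) * (b \<bullet> y)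
    - (b \<bullet> b) * (x \<bullet> y)\<^sup>2 - (x \<bullet> x) * (b \<bullet> y)\<^sup>2 - (y \<bullet> y) * (b \<bullet> x)\<^sup>2"
  unfolding inner_vec_def sum_3 cross_components inner_real_def by algebra

definition rot_offset :: "real^3 \<Rightarrow> real^3 \<Rightarrow> real^3 \<Rightarrow> nat \<Rightarrow> real" where
  "rot_offset b x y k = b \<bullet> (axis_rotation x ^^ k) y - b \<bullet> x"

text \<open>Quarter turns keep the radial part of y and turn its tangential part, so the tangential
  offsets along b run through \<tau>, q, - \<tau>, - q, while h is the common radial loss.\<close>

lemma rot_offset_simps:
  fixes b x y :: "real^3"
  assumes "norm x = 1"
  defines "\<tau> \<equiv> b \<bullet> y - (x \<bullet> y) * (b \<bullet> x)" and "q \<equiv> b \<bullet> cross3 x y" and "h \<equiv> (1 - x \<bullet> y) * (b \<bullet> x)"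
  shows "rot_offset b x y 0 = \<tau> - h" "rot_offset b x y 1 = q - h"
    "rot_offset b x y 2 = - \<tau> - h" "rot_offset b x y 3 = - q - h"
proof -
  have x: "x \<bullet> x = 1" using assms by (simp add: norm_eq_1)
  have 3: "axis_rotation x ((2 * (x \<bullet> y)) *\<^sub>R x - y) = (x \<bullet> y) *\<^sub>R x - cross3 x y"
    unfolding axis_rotation_def
    by (simp add: inner_diff_right x Cross3.right_diff_distrib cross_mult_right)
  show "rot_offset b x y 0 = \<tau> - h" "rot_offset b x y 1 = q - h"
    by (simp_all add: rot_offset_def axis_rotation_def \<tau>_def q_def h_def inner_add_right algebra_simps)
  show "rot_offset b x y 2 = - \<tau> - h"
    unfolding rot_offset_def \<tau>_def h_def
    by (simp add: numeral_2_eq_2 axis_rotation_twice[OF assms(1)] inner_diff_right) (simp add: algebra_simps)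
  show "rot_offset b x y 3 = - q - h"
    unfolding rot_offset_def q_def h_def
    by (simp add: numeral_3_eq_3 axis_rotation_twice[OF assms(1)] 3 inner_diff_right) (simp add: algebra_simps)
qed

text \<open>Pythagoras in the tangent plane: the two squared terms come from pairing the tangential
  part of b with two orthogonal tangent vectors, each of length sqrt (1 - (x . y)^2).\<close>

lemma rot_offset_squares:
  assumes "norm x = 1" "norm b = 1" "norm y = 1"
  shows "(b \<bullet> y - (x \<bullet> y) * (b \<bullet> x))\<^sup>2 + (b \<bullet> cross3 x y)\<^sup>2 = (1 - (x \<bullet> y)\<^sup>2) * (1 - (b \<bullet> x)\<^sup>2)"
proof -
  have "x \<bullet> x = 1" "b \<bullet> b = 1" "y \<bullet> y = 1" using assms by (simp_all add: norm_eq_1)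
  then show ?thesis
    unfolding triple_product_gram by (simp add: power2_eq_square algebra_simps)
qed

lemma rot_offset_abs_le:
  assumes "norm x = 1" "norm b = 1"
  shows "\<bar>rot_offset b x y k\<bar> \<le> norm (x - y)"
proof -
  have "norm (x - (axis_rotation x ^^ k) y) = norm (x - y)"
    by (induction k) (simp_all add: dist_axis_rotation assms)
  then show ?thesis
    using abs_inner_diff_unit_le[OF assms(2), of x "(axis_rotation x ^^ k) y"]
    by (simp add: rot_offset_def abs_minus_commute)
qed

lemma norm_axis_rotation_funpow:
  assumes "norm x = 1"
  shows "norm ((axis_rotation x ^^ k) y) = norm y"
  by (induction k) (simp_all add: norm_axis_rotation assms)

lemma dist_axis_rotation_funpow:
  assumes "norm x = 1"
  shows "norm (x - (axis_rotation x ^^ k) y) = norm (x - y)"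
  by (induction k) (simp_all add: dist_axis_rotation assms)

lemma sphere_inner:
  fixes x y :: "'a::real_inner"
  assumes "norm x = 1" "norm y = 1"
  shows "x \<bullet> y = 1 - (norm (x - y))\<^sup>2 / 2"
  using assms by (simp add: power2_norm_eq_inner inner_diff norm_eq_1 inner_commute diff_divide_distrib)

section \<open>Averaged second-order expansion of a ridge function\<close>

lemma poly_taylor_2:
  fixes p :: "real poly"
  obtains D where "D \<ge> 0" "\<And>z v. \<bar>z\<bar> \<le> 1 \<Longrightarrow> \<bar>v\<bar> \<le> 1 \<Longrightarrow>
    \<bar>poly p v - poly p z - poly (pderiv p) z * (v - z) - poly (pderiv (pderiv p)) z * (v - z)\<^sup>2 / 2\<bar>
      \<le> D * \<bar>v - z\<bar> ^ 3"
proof -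
  obtain D where D: "D \<ge> 0" "\<And>z. \<bar>z\<bar> \<le> 1 \<Longrightarrow> \<bar>poly (pderiv (pderiv (pderiv p))) z\<bar> \<le> D"
    using poly_bounded_on_Icc by blast
  have "\<bar>poly p v - poly p z - poly (pderiv p) z * (v - z) - poly (pderiv (pderiv p)) z * (v - z)\<^sup>2 / 2\<bar>
      \<le> D * \<bar>v - z\<bar> ^ 3" if zv: "\<bar>z\<bar> \<le> 1" "\<bar>v\<bar> \<le> 1" for z v
  proof (cases "v = z")
    case False
    have "\<exists>t. (if v < z then v < t \<and> t < z else z < t \<and> t < v) \<and>
        poly p v = (\<Sum>m<3. poly ((pderiv ^^ m) p) z / fact m * (v - z) ^ m) + poly ((pderiv ^^ 3) p) t / fact 3 * (v - z) ^ 3"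
      by (rule Taylor[of 3 "\<lambda>m. poly ((pderiv ^^ m) p)" "poly p" "-1" 1 z v])
        (use zv False in \<open>auto simp: abs_le_iff intro!: poly_DERIV\<close>)
    then obtain t where t: "if v < z then v < t \<and> t < z else z < t \<and> t < v"
      "poly p v = (\<Sum>m<3. poly ((pderiv ^^ m) p) z / fact m * (v - z) ^ m) + poly ((pderiv ^^ 3) p) t / fact 3 * (v - z) ^ 3"
      by blast
    have "\<bar>t\<bar> \<le> 1" using t(1) zv by (auto split: if_splits)
    have "poly p v - poly p z - poly (pderiv p) z * (v - z) - poly (pderiv (pderiv p)) z * (v - z)\<^sup>2 / 2
        = poly (pderiv (pderiv (pderiv p))) t / 6 * (v - z) ^ 3"
      unfolding t(2) by (simp add: eval_nat_numeral fact_numeral)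
    also have "\<bar>\<dots>\<bar> = \<bar>poly (pderiv (pderiv (pderiv p))) t\<bar> / 6 * \<bar>v - z\<bar> ^ 3"
      by (simp add: abs_mult power_abs)
    also have "\<dots> \<le> D * \<bar>v - z\<bar> ^ 3"
      using D(2)[OF \<open>\<bar>t\<bar> \<le> 1\<close>] D(1) by (intro mult_right_mono) auto
    finally show ?thesis .
  qed simp
  with D(1) show thesis by (rule that)
qed

text \<open>Averaging over the four rotations kills the odd tangential moments, so that the second-order
  Taylor polynomial of a ridge function produces exactly the Legendre operator.\<close>

lemma ridge_rotation_average:
  fixes p :: "real poly" and b :: "real^3"
  assumes b: "norm b = 1"
  obtains D where "D \<ge> 0" "\<And>x y. norm x = 1 \<Longrightarrow> norm y = 1 \<Longrightarrow>
    \<bar>(\<Sum>k<4. poly p (b \<bullet> (axis_rotation x ^^ k) y) - poly p (b \<bullet> x)) / 4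
      - (norm (x - y))\<^sup>2 / 4 * poly (legendre_op p) (b \<bullet> x)\<bar> \<le> D * norm (x - y) ^ 3"
proof -
  obtain D where D: "D \<ge> 0" "\<And>z v. \<bar>z\<bar> \<le> 1 \<Longrightarrow> \<bar>v\<bar> \<le> 1 \<Longrightarrow>
    \<bar>poly p v - poly p z - poly (pderiv p) z * (v - z) - poly (pderiv (pderiv p)) z * (v - z)\<^sup>2 / 2\<bar>
      \<le> D * \<bar>v - z\<bar> ^ 3"
    using poly_taylor_2 by blast
  obtain E where E: "E \<ge> 0" "\<And>z. \<bar>z\<bar> \<le> 1 \<Longrightarrow> \<bar>poly (pderiv (pderiv p)) z\<bar> \<le> E"
    using poly_bounded_on_Icc by blast
  have "\<bar>(\<Sum>k<4. poly p (b \<bullet> (axis_rotation x ^^ k) y) - poly p (b \<bullet> x)) / 4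
      - (norm (x - y))\<^sup>2 / 4 * poly (legendre_op p) (b \<bullet> x)\<bar> \<le> (D + E) * norm (x - y) ^ 3"
    if x: "norm x = 1" and y: "norm y = 1" for x y
  proof -
    define z where "z = b \<bullet> x"
    define \<zeta> where "\<zeta> = x \<bullet> y"
    define r where "r = norm (x - y)"
    define \<tau> where "\<tau> = b \<bullet> y - \<zeta> * z"
    define q where "q = b \<bullet> cross3 x y"
    define o4 where "o4 = rot_offset b x y"
    define P1 where "P1 = poly (pderiv p) z"
    define P2 where "P2 = poly (pderiv (pderiv p)) z"
    have z1: "\<bar>z\<bar> \<le> 1" unfolding z_def by (rule abs_inner_unit_le[OF b x])
    have o: "o4 0 = \<tau> - (1 - \<zeta>) * z" "o4 1 = q - (1 - \<zeta>) * z"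
      "o4 2 = - \<tau> - (1 - \<zeta>) * z" "o4 3 = - q - (1 - \<zeta>) * z"
      using rot_offset_simps[OF x, of b y] by (simp_all add: o4_def \<tau>_def q_def \<zeta>_def z_def)
    have sq: "\<tau>\<^sup>2 + q\<^sup>2 = (1 - \<zeta>\<^sup>2) * (1 - z\<^sup>2)"
      using rot_offset_squares[OF x b y] by (simp add: \<tau>_def q_def \<zeta>_def z_def)
    have \<zeta>: "\<zeta> = 1 - r\<^sup>2 / 2" unfolding \<zeta>_def r_def by (rule sphere_inner[OF x y])
    have r: "0 \<le> r" "r \<le> 2"
      using norm_triangle_ineq4[of x y] x y by (simp_all add: r_def)
    define R where "R k = poly p (b \<bullet> (axis_rotation x ^^ k) y) - poly p z - P1 * o4 k - P2 * (o4 k)\<^sup>2 / 2" for k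
    have R: "\<bar>R k\<bar> \<le> D * r ^ 3" for k
    proof -
      have v: "\<bar>b \<bullet> (axis_rotation x ^^ k) y\<bar> \<le> 1"
        by (rule abs_inner_unit_le[OF b]) (simp add: norm_axis_rotation_funpow x y)
      have "\<bar>R k\<bar> \<le> D * \<bar>o4 k\<bar> ^ 3"
        using D(2)[OF z1 v] by (simp add: R_def P1_def P2_def o4_def rot_offset_def z_def)
      also have "\<dots> \<le> D * r ^ 3"
        using D(1) rot_offset_abs_le[OF x b, of y k]
        by (intro mult_left_mono power_mono) (auto simp: o4_def r_def)
      finally show ?thesis .
    qed
    have "(\<Sum>k<4. poly p (b \<bullet> (axis_rotation x ^^ k) y) - poly p z)
        = (\<Sum>k<4. R k + P1 * o4 k + P2 / 2 * (o4 k)\<^sup>2)"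
      by (intro sum.cong) (auto simp: R_def)
    also have "\<dots> = (\<Sum>k<4. R k) + P1 * (\<Sum>k<4. o4 k) + P2 / 2 * (\<Sum>k<4. (o4 k)\<^sup>2)"
      by (simp add: sum.distrib sum_distrib_left)
    also have "(\<Sum>k<4. o4 k) = - 4 * (1 - \<zeta>) * z"
      using o by (simp add: eval_nat_numeral algebra_simps)
    also have "(\<Sum>k<4. (o4 k)\<^sup>2) = 2 * (\<tau>\<^sup>2 + q\<^sup>2) + 4 * ((1 - \<zeta>) * z)\<^sup>2"
    proof -
      have "(\<Sum>k<4. (o4 k)\<^sup>2) = (o4 0)\<^sup>2 + (o4 1)\<^sup>2 + (o4 2)\<^sup>2 + (o4 3)\<^sup>2"
        by (simp add: eval_nat_numeral)
      also have "\<dots> = 2 * (\<tau>\<^sup>2 + q\<^sup>2) + 4 * ((1 - \<zeta>) * z)\<^sup>2"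
        unfolding o by (simp add: power2_eq_square algebra_simps)
      finally show ?thesis .
    qed
    \<comment> \<open>Since 1 - \<zeta> = r^2/2 and 1 - \<zeta>^2 = r^2 - r^4/4, the terms in r^2
      add up to r^2/4 times the Legendre operator, and the term in r^4 is what remains of the
      squares.\<close>
    finally have "(\<Sum>k<4. poly p (b \<bullet> (axis_rotation x ^^ k) y) - poly p z) / 4
        - r\<^sup>2 / 4 * poly (legendre_op p) z = (\<Sum>k<4. R k) / 4 + P2 * ((r\<^sup>2)\<^sup>2 / 16 * (3 * z\<^sup>2 - 1))"
      unfolding sq poly_legendre_op \<zeta> P1_def[symmetric] P2_def[symmetric]
      by (simp add: field_simps power2_eq_square)
    also have "\<bar>\<dots>\<bar> \<le> D * r ^ 3 + E * r ^ 3"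
    proof -
      have "\<bar>\<Sum>k<4. R k\<bar> \<le> (\<Sum>k<(4::nat). D * r ^ 3)"
        by (rule order_trans[OF sum_abs sum_mono]) (rule R)
      moreover have "\<bar>P2 * ((r\<^sup>2)\<^sup>2 / 16 * (3 * z\<^sup>2 - 1))\<bar> \<le> E * r ^ 3"
      proof -
        have z2: "z\<^sup>2 \<le> 1" using z1 by (simp add: abs_square_le_1)
        have "\<bar>3 * z\<^sup>2 - 1\<bar> \<le> 2" using z2 zero_le_power2[of z] unfolding abs_le_iff by linarith
        then have "(r\<^sup>2)\<^sup>2 / 16 * \<bar>3 * z\<^sup>2 - 1\<bar> \<le> (r\<^sup>2)\<^sup>2 / 16 * 2"
          by (intro mult_left_mono) auto
        also have "\<dots> = r ^ 3 * (r / 8)" by (simp add: eval_nat_numeral)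
        also have "\<dots> \<le> r ^ 3 * 1" using r by (intro mult_left_mono) auto
        finally have "\<bar>P2\<bar> * ((r\<^sup>2)\<^sup>2 / 16 * \<bar>3 * z\<^sup>2 - 1\<bar>) \<le> E * r ^ 3"
          using E(2)[OF z1] E(1) r by (intro mult_mono) (auto simp: P2_def)
        then show ?thesis by (simp add: abs_mult)
      qed
      ultimately show ?thesis by (simp add: abs_le_iff)
    qed
    also have "\<dots> = (D + E) * r ^ 3" by (simp add: distrib_right)
    finally show ?thesis by (simp add: z_def r_def)
  qed
  with D(1) E(1) show thesis by (intro that[of "D + E"]) auto
qed

section \<open>Moments of the kernel\<close>

lemma integrable_uniform_sphere:
  fixes h :: "real^3 \<Rightarrow> real"
  assumes [measurable]: "h \<in> borel_measurable borel" and "\<And>y. y \<in> sphere 0 1 \<Longrightarrow> \<bar>h y\<bar> \<le> D"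
  shows "integrable uniform_sphere h"
proof (rule US.integrable_const_bound[of _ D])
  show "AE y in uniform_sphere. norm (h y) \<le> D"
    using AE_uniform_sphere by eventually_elim (simp add: assms(2))
qed simp

lemma integrable_indicator_uniform_sphere:
  "A \<in> sets borel \<Longrightarrow> integrable uniform_sphere (indicator A :: real^3 \<Rightarrow> real)"
  by (rule integrable_real_indicator) (simp_all add: US.emeasure_eq_measure)

lemma integral_mono_uniform_sphere:
  fixes h g :: "real^3 \<Rightarrow> real"
  assumes "integrable uniform_sphere h" "integrable uniform_sphere g"
    and "\<And>y. y \<in> sphere 0 1 \<Longrightarrow> h y \<le> g y"
  shows "(\<integral>y. h y \<partial>uniform_sphere) \<le> (\<integral>y. g y \<partial>uniform_sphere)"
proof (rule integral_mono_AE[OF assms(1,2)])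
  show "AE y in uniform_sphere. h y \<le> g y"
    using AE_uniform_sphere by eventually_elim (rule assms(3))
qed

lemma axis_rotation_measurable [measurable]: "axis_rotation x \<in> borel_measurable borel"
  by (intro borel_measurable_continuous_onI linear_continuous_on)
    (simp add: linear_axis_rotation flip: linear_conv_bounded_linear)

lemma axis_rotation_funpow_measurable [measurable]: "axis_rotation x ^^ k \<in> borel_measurable borel"
  by (induction k) (auto simp: measurable_comp)

lemma integral_axis_rotation_funpow:
  fixes g :: "real^3 \<Rightarrow> real"
  assumes "norm x = 1" and [measurable]: "g \<in> borel_measurable borel"
  shows "(\<integral>y. g ((axis_rotation x ^^ k) y) \<partial>uniform_sphere) = (\<integral>y. g y \<partial>uniform_sphere)"
proof (induction k)
  case (Suc k)
  have "(\<integral>y. g ((axis_rotation x ^^ Suc k) y) \<partial>uniform_sphere)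
      = (\<integral>y. (\<lambda>y. g ((axis_rotation x ^^ k) y)) (axis_rotation x y) \<partial>uniform_sphere)"
    by (simp add: funpow_swap1)
  also have "\<dots> = (\<integral>y. g ((axis_rotation x ^^ k) y) \<partial>uniform_sphere)"
    by (rule integral_orthogonal_uniform_sphere[OF orthogonal_axis_rotation[OF assms(1)]]) measurable
  finally show ?case using Suc.IH by simp
qed simp

lemma integral_rotation_average:
  fixes g :: "real^3 \<Rightarrow> real"
  assumes "norm x = 1" and [measurable]: "g \<in> borel_measurable borel"
    and D: "\<And>y. y \<in> sphere 0 1 \<Longrightarrow> \<bar>g y\<bar> \<le> D"
  shows "(\<integral>y. g y \<partial>uniform_sphere) = (\<integral>y. (\<Sum>k<4. g ((axis_rotation x ^^ k) y)) / 4 \<partial>uniform_sphere)"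
proof -
  have "integrable uniform_sphere (\<lambda>y. g ((axis_rotation x ^^ k) y))" for k
    by (rule integrable_uniform_sphere[where D = D])
      (use D in \<open>auto simp: norm_axis_rotation_funpow[OF assms(1)]\<close>)
  then have "(\<integral>y. (\<Sum>k<4. g ((axis_rotation x ^^ k) y)) / 4 \<partial>uniform_sphere)
      = (\<Sum>k<(4::nat). (\<integral>y. g ((axis_rotation x ^^ k) y) \<partial>uniform_sphere)) / 4"
    by simp
  also have "\<dots> = (\<Sum>k<(4::nat). (\<integral>y. g y \<partial>uniform_sphere)) / 4"
    by (simp add: integral_axis_rotation_funpow[OF assms(1)])
  finally show ?thesis by simp
qed

text \<open>The tangential displacements of the four rotates along a are \<tau>, q, - \<tau>, - q.
  If none outweighed the radial loss h w, then |\<tau>| and |q| would be at most h w, while \<tau>^2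
  + q^2 is of order h (1 - w^2). The distance from a gives 1 - w^2 >= e/8, and h < e/16 makes this
  impossible.\<close>

lemma ascent_rotation:
  fixes a x y :: "real^3"
  assumes unit: "norm a = 1" "norm x = 1" "norm y = 1" and "0 < e" "e \<le> 1"
    and far: "e / 4 \<le> (norm (x - a))\<^sup>2"
    and near: "0 < (norm (x - y))\<^sup>2" "(norm (x - y))\<^sup>2 < e / 8"
  shows "\<exists>k<4. a \<bullet> x < a \<bullet> (axis_rotation x ^^ k) y"
proof (rule ccontr)
  assume "\<not> ?thesis"
  then have le: "rot_offset a x y k \<le> 0" if "k < 4" for k
    using that unfolding rot_offset_def by (meson diff_le_0_iff_le not_less)
  define w where "w = a \<bullet> x"
  define h where "h = (norm (x - y))\<^sup>2 / 2"
  define \<tau> where "\<tau> = a \<bullet> y - (x \<bullet> y) * w"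
  define q where "q = a \<bullet> cross3 x y"
  have h: "x \<bullet> y = 1 - h" using sphere_inner[OF unit(2,3)] by (simp add: h_def)
  have wle: "w \<le> 1 - e / 8"
    using sphere_inner[OF unit(1,2)] far by (simp add: w_def norm_minus_commute)
  have h0: "0 < h" "h < e / 16" using near by (simp_all add: h_def)
  have "\<tau> - h * w \<le> 0" "q - h * w \<le> 0" "- \<tau> - h * w \<le> 0" "- q - h * w \<le> 0"
    using le[of 0] le[of 1] le[of 2] le[of 3] rot_offset_simps[OF unit(2), of a y]
    by (simp_all add: \<tau>_def q_def w_def h)
  then have "\<bar>\<tau>\<bar> \<le> h * w" "\<bar>q\<bar> \<le> h * w" by linarith+
  moreover from this have "0 \<le> h * w" by linarith
  ultimately have "\<tau>\<^sup>2 \<le> (h * w)\<^sup>2" "q\<^sup>2 \<le> (h * w)\<^sup>2"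
    by (simp_all flip: abs_le_square_iff)
  have w0: "0 \<le> w" using \<open>0 \<le> h * w\<close> h0 by (simp add: zero_le_mult_iff)
  note \<open>\<tau>\<^sup>2 \<le> (h * w)\<^sup>2\<close> \<open>q\<^sup>2 \<le> (h * w)\<^sup>2\<close>
  moreover have "\<tau>\<^sup>2 + q\<^sup>2 = (1 - (1 - h)\<^sup>2) * (1 - w\<^sup>2)"
    using rot_offset_squares[OF unit(2,1,3)] by (simp add: \<tau>_def q_def w_def h)
  ultimately have "(1 - (1 - h)\<^sup>2) * (1 - w\<^sup>2) \<le> 2 * (h * w)\<^sup>2" by linarith
  then have "h * ((2 - h) * (1 - w\<^sup>2)) \<le> h * (2 * h * w\<^sup>2)"
    by (simp add: power2_eq_square algebra_simps)
  then have "(2 - h) * (1 - w\<^sup>2) \<le> 2 * h * w\<^sup>2" using h0 by simp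
  moreover have "w\<^sup>2 \<le> w" using w0 wle \<open>0 < e\<close> by (simp add: power2_eq_square mult_left_le)
  then have w2: "w\<^sup>2 \<le> 1 - e / 8" using wle by linarith
  have "1 * (e / 8) \<le> (2 - h) * (1 - w\<^sup>2)"
    using w2 h0 \<open>0 < e\<close> \<open>e \<le> 1\<close> by (intro mult_mono) auto
  moreover have "2 * h * w\<^sup>2 \<le> 2 * h * 1"
    using w2 h0 \<open>0 < e\<close> by (intro mult_left_mono) auto
  ultimately show False using h0 by linarith
qed

lemma integral_square_le:
  fixes h :: "real^3 \<Rightarrow> real"
  assumes [measurable]: "h \<in> borel_measurable borel" and "\<And>y. y \<in> sphere 0 1 \<Longrightarrow> \<bar>h y\<bar> \<le> D"
  shows "(\<integral>y. (h y)\<^sup>2 \<partial>uniform_sphere) \<le> D\<^sup>2"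
proof -
  have sq: "(h y)\<^sup>2 \<le> D\<^sup>2" if "y \<in> sphere 0 1" for y
    using power_mono[OF assms(2)[OF that], of 2] by simp
  have "(\<integral>y. (h y)\<^sup>2 \<partial>uniform_sphere) \<le> (\<integral>y. D\<^sup>2 \<partial>uniform_sphere)"
    by (intro integral_mono_uniform_sphere integrable_uniform_sphere[where D = "D\<^sup>2"]) (use sq in auto)
  then show ?thesis using US.prob_space by simp
qed

text \<open>The kernel enters only through its bounds \<open>B\<close> and, on [0, 1/2],
  \<open>k\<close>, its positivity on [0, 1) and its vanishing beyond 1, so that smooth kernels and
  the indicator are treated together.\<close>

locale kernel_samples = sphere_samples M \<epsilon> X for M :: "'w measure" and \<epsilon> X +
  fixes K :: "real \<Rightarrow> real" and B k c C :: real
  assumes K_measurable [measurable]: "(\<lambda>s. K (max 0 s)) \<in> borel_measurable borel"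
    and K_nonneg: "\<And>r. 0 \<le> r \<Longrightarrow> 0 \<le> K r"
    and K_le: "\<And>r. 0 \<le> r \<Longrightarrow> K r \<le> B"
    and K_zero: "\<And>r. 1 < r \<Longrightarrow> K r = 0"
    and K_pos: "\<And>r. 0 \<le> r \<Longrightarrow> r < 1 \<Longrightarrow> 0 < K r"
    and K_ge: "\<And>r. 0 \<le> r \<Longrightarrow> r \<le> 1 / 2 \<Longrightarrow> k \<le> K r"
    and k_pos: "0 < k"
    and c_pos: "0 < c" and C_pos: "0 < C"
    and cap_lower: "\<And>r x. 0 < r \<Longrightarrow> r \<le> 1 \<Longrightarrow> x \<in> sphere 0 1 \<Longrightarrow>
      c * r \<le> measure uniform_sphere {y. (norm (x - y))\<^sup>2 < r}"
    and cap_upper: "\<And>r x. 0 < r \<Longrightarrow> r \<le> 1 \<Longrightarrow> x \<in> sphere 0 1 \<Longrightarrow>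
      measure uniform_sphere {y. (norm (x - y))\<^sup>2 \<le> r} \<le> C * r"
begin

text \<open>The kernel is constrained only on nonnegative arguments; the clamp makes this expression
  Borel for every n and changes nothing when \<epsilon> is positive.\<close>

definition weight :: "nat \<Rightarrow> real^3 \<Rightarrow> real^3 \<Rightarrow> real" where
  "weight n x y = K (max 0 ((norm (x - y))\<^sup>2 / \<epsilon> n))"

text \<open>Base point for integrals that are the same at every x, and the summit in the
  connectedness argument.\<close>

definition pole :: "real^3" where "pole = axis 3 1"

definition edge_prob :: "nat \<Rightarrow> real" where
  "edge_prob n = measure uniform_sphere {y. (norm (pole - y))\<^sup>2 < \<epsilon> n}"

definition moment :: "nat \<Rightarrow> real" where
  "moment n = (\<integral>y. (norm (pole - y))\<^sup>2 / 2 * weight n pole y \<partial>uniform_sphere)"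

text \<open>Conversion between the two clocks: Kuramoto time t corresponds to heat time
  \<open>speed n * t\<close>.\<close>

definition speed :: "nat \<Rightarrow> real" where
  "speed n = moment n / (\<epsilon> n * edge_prob n)"

lemma pole_sphere: "norm pole = 1"
  by (simp add: pole_def)

lemma measurable_weight [measurable]:
  "(\<lambda>(x, y). weight n x y) \<in> borel_measurable (borel \<Otimes>\<^sub>M borel)"
  "weight n x \<in> borel_measurable borel"
  unfolding weight_def by (auto intro!: measurable_compose[OF _ K_measurable] simp: case_prod_beta')

lemma B_pos: "0 < B"
  using K_pos[of 0] K_le[of 0] by simp

lemma weight_nonneg: "0 \<le> weight n x y"
  by (simp add: weight_def K_nonneg)

lemma weight_le: "weight n x y \<le> B"
  by (simp add: weight_def K_le)

lemma weight_zero: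
  assumes "\<epsilon> n > 0" "\<epsilon> n < (norm (x - y))\<^sup>2"
  shows "weight n x y = 0"
proof -
  have "1 < (norm (x - y))\<^sup>2 / \<epsilon> n" using assms by simp
  then show ?thesis by (simp add: weight_def K_zero)
qed

lemma weight_eq:
  assumes "\<epsilon> n > 0"
  shows "weight n x y = K ((norm (x - y))\<^sup>2 / \<epsilon> n)"
proof -
  have "0 \<le> (norm (x - y))\<^sup>2 / \<epsilon> n" using assms by simp
  then show ?thesis by (simp add: weight_def max_def)
qed

lemma eventually_small: "\<forall>\<^sub>F n in sequentially. 0 < \<epsilon> n \<and> \<epsilon> n \<le> e" if "e > 0"
proof -
  have "\<forall>\<^sub>F n in sequentially. \<epsilon> n < e"
    using eps_lim that by (rule order_tendstoD)
  then show ?thesis using eventually_ge_at_top[of 1]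
    by eventually_elim (auto intro: eps_pos)
qed

text \<open>A kernel of range \<epsilon> sees only a cap of probability at most C \<epsilon>, so
  that integration gains one factor \<epsilon>. The cap is closed because the kernel may be nonzero
  on its boundary.\<close>

lemma cap_integral:
  fixes h :: "real^3 \<Rightarrow> real"
  assumes "0 < \<epsilon> n" "\<epsilon> n \<le> 1" and x: "x \<in> sphere 0 1"
    and [measurable]: "h \<in> borel_measurable borel"
    and D: "\<And>y. y \<in> sphere 0 1 \<Longrightarrow> (norm (x - y))\<^sup>2 \<le> \<epsilon> n \<Longrightarrow> \<bar>h y\<bar> \<le> D"
    and zero: "\<And>y. y \<in> sphere 0 1 \<Longrightarrow> \<epsilon> n < (norm (x - y))\<^sup>2 \<Longrightarrow> h y = 0"
  shows "integrable uniform_sphere h" "\<bar>\<integral>y. h y \<partial>uniform_sphere\<bar> \<le> D * C * \<epsilon> n"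
proof -
  let ?A = "{y. (norm (x - y))\<^sup>2 \<le> \<epsilon> n}"
  have D0: "0 \<le> D" using D[of x] x assms(1) by fastforce
  have bd: "\<bar>h y\<bar> \<le> D * indicator ?A y" if "y \<in> sphere 0 1" for y
    using D[OF that] zero[OF that] by (auto simp: indicator_def not_le)
  then have bd': "\<bar>h y\<bar> \<le> D" if "y \<in> sphere 0 1" for y
    using D0 bd[OF that] by (cases "y \<in> ?A") auto
  show int: "integrable uniform_sphere h"
    by (rule integrable_uniform_sphere[OF _ bd']) simp_all
  have "\<bar>\<integral>y. h y \<partial>uniform_sphere\<bar> \<le> (\<integral>y. \<bar>h y\<bar> \<partial>uniform_sphere)"
    by (rule integral_abs_bound)
  also have "\<dots> \<le> (\<integral>y. D * indicator ?A y \<partial>uniform_sphere)"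
    by (rule integral_mono_uniform_sphere)
      (use int bd in \<open>auto intro!: integrable_mult_right integrable_indicator_uniform_sphere\<close>)
  also have "\<dots> = D * measure uniform_sphere ?A" by simp
  also have "\<dots> \<le> D * (C * \<epsilon> n)"
    using cap_upper[OF assms(1,2) x] D0 by (rule mult_left_mono)
  finally show "\<bar>\<integral>y. h y \<partial>uniform_sphere\<bar> \<le> D * C * \<epsilon> n" by (simp add: mult.assoc)
qed

text \<open>The inner fraction \<theta> = c / (2 C) is chosen so that the removed cap has at most
  half of the guaranteed mass: C \<theta> r = c r / 2.\<close>

lemma annulus_lower:
  assumes "0 < r" "r \<le> 1" and x: "x \<in> sphere 0 1"
  shows "c / 2 * r \<le> measure uniform_sphere {y. c / (2 * C) * r < (norm (x - y))\<^sup>2 \<and> (norm (x - y))\<^sup>2 < r}"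
proof -
  define \<theta> where "\<theta> = c / (2 * C)"
  \<comment> \<open>Comparing both cap bounds at radius 1 gives c <= C, so that \<theta> r is an
    admissible radius.\<close>
  have "c * 1 \<le> measure uniform_sphere {y. (norm (x - y))\<^sup>2 < 1}" using cap_lower[of 1 x] x by simp
  also have "\<dots> \<le> measure uniform_sphere {y. (norm (x - y))\<^sup>2 \<le> 1}"
    by (rule US.finite_measure_mono) auto
  also have "\<dots> \<le> C * 1" using cap_upper[of 1 x] x by simp
  finally have "c \<le> C" by simp
  then have \<theta>: "0 < \<theta>" "\<theta> \<le> 1" using c_pos C_pos by (simp_all add: \<theta>_def)
  then have \<theta>r: "0 < \<theta> * r" "\<theta> * r \<le> 1" using assms by (simp_all add: mult_le_one)
  let ?A = "{y. \<theta> * r < (norm (x - y))\<^sup>2 \<and> (norm (x - y))\<^sup>2 < r}"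
  have "c * r \<le> measure uniform_sphere {y. (norm (x - y))\<^sup>2 < r}"
    by (rule cap_lower[OF assms])
  also have "\<dots> \<le> measure uniform_sphere ({y. (norm (x - y))\<^sup>2 \<le> \<theta> * r} \<union> ?A)"
    by (rule US.finite_measure_mono) auto
  also have "\<dots> \<le> measure uniform_sphere {y. (norm (x - y))\<^sup>2 \<le> \<theta> * r} + measure uniform_sphere ?A"
    by (rule measure_Un_le) auto
  also have "\<dots> \<le> C * (\<theta> * r) + measure uniform_sphere ?A"
    using cap_upper[OF \<theta>r x] by simp
  also have "C * (\<theta> * r) = c / 2 * r" using C_pos by (simp add: \<theta>_def)
  finally show ?thesis by (simp add: \<theta>_def)
qed

lemma edge_prob_eq:
  assumes "x \<in> sphere 0 1"
  shows "measure uniform_sphere {y. (norm (x - y))\<^sup>2 < \<epsilon> n} = edge_prob n"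
proof -
  have "measure uniform_sphere {y. (norm (z - y))\<^sup>2 < \<epsilon> n}
      = (\<integral>y. indicator {..<\<epsilon> n} ((norm (z - y))\<^sup>2) \<partial>uniform_sphere)" for z
  proof -
    have "(\<lambda>y. indicator {..<\<epsilon> n} ((norm (z - y))\<^sup>2)) = (indicator {y. (norm (z - y))\<^sup>2 < \<epsilon> n} :: _ \<Rightarrow> real)"
      by (auto simp: indicator_def)
    then show ?thesis by simp
  qed
  then show ?thesis unfolding edge_prob_def
    using integral_radial_uniform_sphere[of "indicator {..<\<epsilon> n}" x pole] assms pole_sphere by simp
qed

lemma moment_eq:
  assumes "x \<in> sphere 0 1"
  shows "(\<integral>y. (norm (x - y))\<^sup>2 / 2 * weight n x y \<partial>uniform_sphere) = moment n"
  unfolding moment_def weight_def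
  using integral_radial_uniform_sphere[of "\<lambda>s. s / 2 * K (max 0 (s / \<epsilon> n))" x pole] assms pole_sphere
  by (simp add: measurable_compose[OF _ K_measurable])

lemma edge_prob_bounds:
  assumes "0 < \<epsilon> n" "\<epsilon> n \<le> 1"
  shows "c * \<epsilon> n \<le> edge_prob n" "edge_prob n \<le> C * \<epsilon> n"
proof -
  show "c * \<epsilon> n \<le> edge_prob n"
    using cap_lower[OF assms, of pole] pole_sphere by (simp add: edge_prob_def)
  have "edge_prob n \<le> measure uniform_sphere {y. (norm (pole - y))\<^sup>2 \<le> \<epsilon> n}"
    unfolding edge_prob_def by (rule US.finite_measure_mono) auto
  also have "\<dots> \<le> C * \<epsilon> n"
    using cap_upper[OF assms, of pole] pole_sphere by simp
  finally show "edge_prob n \<le> C * \<epsilon> n" .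
qed

lemma moment_upper:
  assumes "0 < \<epsilon> n" "\<epsilon> n \<le> 1"
  shows "\<bar>moment n\<bar> \<le> B * C * (\<epsilon> n)\<^sup>2"
proof -
  have "\<bar>moment n\<bar> \<le> (\<epsilon> n / 2 * B) * C * \<epsilon> n"
    unfolding moment_def
  proof (rule cap_integral(2)[OF assms])
    fix y assume "(norm (pole - y))\<^sup>2 \<le> \<epsilon> n"
    then show "\<bar>(norm (pole - y))\<^sup>2 / 2 * weight n pole y\<bar> \<le> \<epsilon> n / 2 * B"
      using weight_nonneg[of n pole y] weight_le[of n pole y] assms
      by (simp add: abs_mult) (intro mult_mono; simp)
  qed (use pole_sphere weight_zero[OF assms(1)] in auto)
  also have "\<dots> \<le> B * C * (\<epsilon> n)\<^sup>2"
    using B_pos C_pos by (simp add: power2_eq_square field_simps)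
  finally show ?thesis .
qed

lemma moment_lower:
  assumes "0 < \<epsilon> n" "\<epsilon> n \<le> 1"
  shows "c\<^sup>2 * k / (32 * C) * (\<epsilon> n)\<^sup>2 \<le> moment n"
proof -
  \<comment> \<open>Only squared distances between \<theta> r and r = \<epsilon>/2 are kept: below r
    the kernel is at least \<open>k\<close>, and above \<theta> r the squared distance is itself of
    order \<epsilon>.\<close>
  define r where "r = \<epsilon> n / 2"
  define \<theta> where "\<theta> = c / (2 * C)"
  have \<theta>: "\<theta> > 0" using c_pos C_pos by (simp add: \<theta>_def)
  have r: "0 < r" "r \<le> 1" using assms by (simp_all add: r_def)
  let ?A = "{y. \<theta> * r < (norm (pole - y))\<^sup>2 \<and> (norm (pole - y))\<^sup>2 < r}"
  have "(\<theta> * r / 2 * k) * (c / 2 * r) \<le> (\<theta> * r / 2 * k) * measure uniform_sphere ?A"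
    using annulus_lower[OF r, of pole] pole_sphere
    by (intro mult_left_mono mult_nonneg_nonneg divide_nonneg_nonneg)
      (use \<theta> r k_pos in \<open>simp_all add: \<theta>_def\<close>)
  also have "\<dots> = (\<integral>y. (\<theta> * r / 2 * k) * indicator ?A y \<partial>uniform_sphere)" by simp
  also have "\<dots> \<le> moment n"
    unfolding moment_def
  proof (rule integral_mono_uniform_sphere)
    show "integrable uniform_sphere (\<lambda>y. (norm (pole - y))\<^sup>2 / 2 * weight n pole y)"
    proof (rule cap_integral(1)[OF assms, of pole _ "\<epsilon> n / 2 * B"])
      fix y assume "(norm (pole - y))\<^sup>2 \<le> \<epsilon> n"
      then show "\<bar>(norm (pole - y))\<^sup>2 / 2 * weight n pole y\<bar> \<le> \<epsilon> n / 2 * B"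
        using weight_nonneg[of n pole y] weight_le[of n pole y] assms
        by (simp add: abs_mult) (intro mult_mono; simp)
    qed (use pole_sphere weight_zero[OF assms(1)] in auto)
    fix y :: "real^3"
    show "(\<theta> * r / 2 * k) * indicator ?A y \<le> (norm (pole - y))\<^sup>2 / 2 * weight n pole y"
    proof (cases "y \<in> ?A")
      case True
      then have "(norm (pole - y))\<^sup>2 / \<epsilon> n \<le> 1 / 2" using assms by (simp add: r_def field_simps)
      then have "k \<le> weight n pole y" unfolding weight_def by (intro K_ge) auto
      moreover have "\<theta> * r / 2 \<le> (norm (pole - y))\<^sup>2 / 2" using True by simp
      ultimately have "\<theta> * r / 2 * k \<le> (norm (pole - y))\<^sup>2 / 2 * weight n pole y"
        using \<theta> r k_pos by (intro mult_mono) auto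
      with True show ?thesis by simp
    next
      case False
      then show ?thesis using weight_nonneg[of n pole y] by simp
    qed
  qed (intro integrable_mult_right integrable_indicator_uniform_sphere; measurable)
  finally show ?thesis
    using c_pos C_pos by (simp add: \<theta>_def r_def power2_eq_square field_simps)
qed

text \<open>The lower bound ensures that a fixed heat time is reached within a Kuramoto time bounded
  uniformly in n.\<close>

lemma speed_bounds:
  assumes "0 < \<epsilon> n" "\<epsilon> n \<le> 1"
  shows "c\<^sup>2 * k / (32 * C\<^sup>2) \<le> speed n" "speed n \<le> B * C / c"
proof -
  note p = edge_prob_bounds[OF assms]
  have pp: "0 < edge_prob n" using p(1) c_pos assms by (smt (verit) mult_pos_pos)
  have "c\<^sup>2 * k / (32 * C\<^sup>2) * (\<epsilon> n * edge_prob n) \<le> c\<^sup>2 * k / (32 * C\<^sup>2) * (\<epsilon> n * (C * \<epsilon> n))"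
    using p assms c_pos k_pos by (intro mult_left_mono) auto
  also have "\<dots> = c\<^sup>2 * k / (32 * C) * (\<epsilon> n)\<^sup>2"
    using C_pos by (simp add: power2_eq_square)
  also note moment_lower[OF assms]
  finally show "c\<^sup>2 * k / (32 * C\<^sup>2) \<le> speed n"
    using pp assms by (simp add: speed_def pos_le_divide_eq)
  have "moment n \<le> B * C * (\<epsilon> n)\<^sup>2" using moment_upper[OF assms] by simp
  also have "\<dots> = B * C / c * (\<epsilon> n * (c * \<epsilon> n))"
    using c_pos by (simp add: power2_eq_square)
  also have "\<dots> \<le> B * C / c * (\<epsilon> n * edge_prob n)"
    using p assms c_pos B_pos C_pos by (intro mult_left_mono) auto
  finally show "speed n \<le> B * C / c"
    using pp assms by (simp add: speed_def pos_divide_le_eq)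
qed

text \<open>The total weight at a vertex has at most the order of the expected degree. This turns
  the cubic error of one sine into a bound for the whole sum.\<close>

lemma AE_weight_sums:
  "AE \<omega> in M. \<forall>\<^sub>F n in sequentially. \<forall>i\<in>{1..n}.
    (\<Sum>j\<in>{1..n} - {i}. weight n (X n i \<omega>) (X n j \<omega>)) \<le> (B * C + 1) * \<epsilon> n * (real n - 1)"
proof -
  \<comment> \<open>The factor \<epsilon> brings the second moment down to order \<epsilon>^2, and
    subtracting B C \<epsilon>^2 makes the mean nonpositive. At the end \<epsilon> is divided out
    again.\<close>
  define g where "g n x y = \<epsilon> n * weight n x y - B * C * (\<epsilon> n)\<^sup>2" for n x y
  have bd: "\<bar>g n x y\<bar> \<le> (B + B * C) * \<epsilon> n" if "0 < \<epsilon> n" "\<epsilon> n \<le> 1" for n x y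
  proof -
    have "\<epsilon> n * weight n x y \<le> \<epsilon> n * B" "0 \<le> \<epsilon> n * weight n x y"
      using that weight_le weight_nonneg by (auto intro: mult_left_mono)
    moreover have "(\<epsilon> n)\<^sup>2 \<le> \<epsilon> n" using that by (simp add: power2_eq_square mult_left_le)
    then have "B * C * (\<epsilon> n)\<^sup>2 \<le> B * C * \<epsilon> n" "0 \<le> B * C * (\<epsilon> n)\<^sup>2"
      using B_pos C_pos by (auto intro!: mult_left_mono)
    ultimately show ?thesis unfolding g_def by (simp add: abs_le_iff algebra_simps)
  qed
  have "AE \<omega> in M. \<forall>\<^sub>F n in sequentially. \<forall>i\<in>{1..n}.
    (\<Sum>j\<in>{1..n} - {i}. g n (X n i \<omega>) (X n j \<omega>)) < 1 * (\<epsilon> n)\<^sup>2 * (real n - 1)"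
  proof (rule AE_pair_sums_less[where B = "B + B * C" and v = "(B + B * C)\<^sup>2"])
    show "(\<lambda>(x, y). g n x y) \<in> borel_measurable (borel \<Otimes>\<^sub>M borel)" for n
      unfolding g_def using measurable_weight(1)[of n] by (simp add: case_prod_beta')
    show "\<forall>\<^sub>F n in sequentially. \<forall>x\<in>sphere 0 1. \<forall>y\<in>sphere 0 1. \<bar>g n x y\<bar> \<le> B + B * C"
      using eventually_small[OF zero_less_one]
    proof eventually_elim
      case (elim n)
      have "(B + B * C) * \<epsilon> n \<le> (B + B * C) * 1"
        using elim B_pos C_pos by (intro mult_left_mono) auto
      with bd[of n] elim show ?case by (auto intro: order_trans)
    qed
    show "\<forall>\<^sub>F n in sequentially. \<forall>x\<in>sphere 0 1. (\<integral>y. (g n x y)\<^sup>2 \<partial>uniform_sphere) \<le> (B + B * C)\<^sup>2 * (\<epsilon> n)\<^sup>2"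
      using eventually_small[OF zero_less_one]
    proof eventually_elim
      case (elim n)
      have "g n x \<in> borel_measurable borel" for x unfolding g_def by measurable
      with elim show ?case using integral_square_le[OF _ bd, of n] by (auto simp: power_mult_distrib)
    qed
    show "\<forall>\<^sub>F n in sequentially. \<forall>x\<in>sphere 0 1. (\<integral>y. g n x y \<partial>uniform_sphere) \<le> 1 / 4 * (\<epsilon> n)\<^sup>2"
      using eventually_small[OF zero_less_one]
    proof eventually_elim
      case (elim n)
      show ?case
      proof
        fix x :: "real^3" assume x: "x \<in> sphere 0 1"
        have w: "integrable uniform_sphere (weight n x)" "\<bar>\<integral>y. weight n x y \<partial>uniform_sphere\<bar> \<le> B * C * \<epsilon> n"
        proof -
          have "\<bar>weight n x y\<bar> \<le> B" for y using weight_nonneg[of n x y] weight_le[of n x y] by simp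
          note cap = cap_integral[of n x "weight n x" B, OF conjunct1[OF elim] conjunct2[OF elim] x
            measurable_weight(2) this weight_zero[OF conjunct1[OF elim]]]
          show "integrable uniform_sphere (weight n x)" by (rule cap(1))
          show "\<bar>\<integral>y. weight n x y \<partial>uniform_sphere\<bar> \<le> B * C * \<epsilon> n" by (rule cap(2))
        qed
        have "(\<integral>y. g n x y \<partial>uniform_sphere) = \<epsilon> n * (\<integral>y. weight n x y \<partial>uniform_sphere) - B * C * (\<epsilon> n)\<^sup>2"
          unfolding g_def using w(1) US.prob_space by simp
        also have "\<dots> \<le> \<epsilon> n * (B * C * \<epsilon> n) - B * C * (\<epsilon> n)\<^sup>2"
          using w(2) elim by (intro diff_right_mono mult_left_mono) auto
        also have "\<dots> = 0" by (simp add: power2_eq_square)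
        also have "0 \<le> 1 / 4 * (\<epsilon> n)\<^sup>2" by simp
        finally show "(\<integral>y. g n x y \<partial>uniform_sphere) \<le> 1 / 4 * (\<epsilon> n)\<^sup>2" .
      qed
    qed
  qed simp
  then show ?thesis
  proof eventually_elim
    case (elim \<omega>)
    from elim eventually_small[OF zero_less_one] eventually_ge_at_top[of 1] show ?case
    proof eventually_elim
      case (elim n)
      show ?case
      proof
        fix i assume i: "i \<in> {1..n}"
        let ?S = "\<Sum>j\<in>{1..n} - {i}. weight n (X n i \<omega>) (X n j \<omega>)"
        have card: "real (card ({Suc 0..n} - {i})) = real n - 1"
          using i by (simp add: of_nat_diff)
        have "(\<Sum>j\<in>{1..n} - {i}. g n (X n i \<omega>) (X n j \<omega>)) = \<epsilon> n * ?S - (real n - 1) * (B * C * (\<epsilon> n)\<^sup>2)"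
          unfolding g_def by (simp add: sum_subtractf sum_distrib_left card)
        moreover have "(\<Sum>j\<in>{1..n} - {i}. g n (X n i \<omega>) (X n j \<omega>)) < (\<epsilon> n)\<^sup>2 * (real n - 1)"
          using elim(1) i by simp
        ultimately have "\<epsilon> n * ?S \<le> \<epsilon> n * ((B * C + 1) * \<epsilon> n * (real n - 1))"
          by (simp add: power2_eq_square algebra_simps)
        then show "?S \<le> (B * C + 1) * \<epsilon> n * (real n - 1)"
          using elim(2) by simp
      qed
    qed
  qed
qed

end

section \<open>Consistency with the heat flow\<close>

context kernel_samples begin

section \<open>Vertices with a neighbour nearer to the pole\<close>

definition ascent_region :: "nat \<Rightarrow> real^3 \<Rightarrow> (real^3) set" where
  "ascent_region n x = {y. (norm (x - y))\<^sup>2 < \<epsilon> n \<and> pole \<bullet> x < pole \<bullet> y}"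

text \<open>Every point of a thin annulus around x has one of its four rotates in the ascent region,
  by \<open>ascent_rotation\<close>. Invariance of the measure then gives the region at least a
  quarter of the annulus: (1/4) (c/2) (\<epsilon>/8).\<close>

lemma ascent_region_lower:
  assumes "0 < \<epsilon> n" "\<epsilon> n \<le> 1" and x: "x \<in> sphere 0 1" and far: "\<epsilon> n / 4 \<le> (norm (x - pole))\<^sup>2"
  shows "c / 64 * \<epsilon> n \<le> measure uniform_sphere (ascent_region n x)"
proof -
  define r where "r = \<epsilon> n / 8"
  have r: "0 < r" "r \<le> 1" using assms by (simp_all add: r_def)
  have nx: "norm x = 1" using x by simp
  let ?A = "{y. c / (2 * C) * r < (norm (x - y))\<^sup>2 \<and> (norm (x - y))\<^sup>2 < r}"
  let ?R = "ascent_region n x"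
  have [measurable]: "?R \<in> sets borel" unfolding ascent_region_def by measurable
  have pt: "indicator ?A y \<le> (\<Sum>k<4. indicator ?R ((axis_rotation x ^^ k) y) :: real)"
    if y: "y \<in> sphere 0 1" for y
  proof (cases "y \<in> ?A")
    case True
    have near: "0 < (norm (x - y))\<^sup>2" "(norm (x - y))\<^sup>2 < \<epsilon> n / 8"
    proof -
      have "0 < c / (2 * C) * r" using c_pos C_pos r by simp
      then show "0 < (norm (x - y))\<^sup>2" using True by (auto elim: less_trans)
    qed (use True in \<open>simp add: r_def\<close>)
    obtain k where k: "k < 4" "pole \<bullet> x < pole \<bullet> (axis_rotation x ^^ k) y"
      using ascent_rotation[OF pole_sphere nx _ assms(1,2) far near] y by auto
    have "(norm (x - y))\<^sup>2 < \<epsilon> n" using near assms(1) by simp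
    with k(2) have "(axis_rotation x ^^ k) y \<in> ?R"
      by (simp add: ascent_region_def dist_axis_rotation_funpow[OF nx])
    then have "1 = (indicator ?R ((axis_rotation x ^^ k) y) :: real)" by simp
    also have "\<dots> \<le> (\<Sum>k<4. indicator ?R ((axis_rotation x ^^ k) y))"
      using k(1) by (intro member_le_sum) auto
    finally show ?thesis using True by simp
  next
    case False
    then show ?thesis by (simp add: sum_nonneg)
  qed
  have "c / 2 * r \<le> measure uniform_sphere ?A"
    by (rule annulus_lower[OF r x])
  also have "\<dots> = (\<integral>y. indicator ?A y \<partial>uniform_sphere)" by simp
  also have "\<dots> \<le> (\<integral>y. (\<Sum>k<4. indicator ?R ((axis_rotation x ^^ k) y)) \<partial>uniform_sphere)"
  proof (rule integral_mono_uniform_sphere)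
    show "integrable uniform_sphere (\<lambda>y. \<Sum>k<(4::nat). indicat_real ?R ((axis_rotation x ^^ k) y))"
      by (intro Bochner_Integration.integrable_sum integrable_uniform_sphere[where D = 1]) auto
  qed (use pt in \<open>auto intro!: integrable_indicator_uniform_sphere\<close>)
  also have "\<dots> = (\<Sum>k<(4::nat). \<integral>y. indicator ?R ((axis_rotation x ^^ k) y) \<partial>uniform_sphere)"
    by (intro Bochner_Integration.integral_sum integrable_uniform_sphere[where D = 1]) auto
  also have "\<dots> = 4 * measure uniform_sphere ?R"
    by (subst integral_axis_rotation_funpow[OF nx]) simp_all
  finally show ?thesis by (simp add: r_def)
qed

text \<open>If a vertex far from the pole had no neighbour in its ascent region, every summand would
  equal (c/64) \<epsilon>^2 and the sum would be exactly the threshold, which the strict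
  concentration bound excludes.\<close>

lemma AE_ascent:
  "AE \<omega> in M. \<forall>\<^sub>F n in sequentially. \<forall>i\<in>{1..n}. \<epsilon> n / 4 \<le> (norm (X n i \<omega> - pole))\<^sup>2 \<longrightarrow>
    (\<exists>j\<in>{1..n} - {i}. (norm (X n i \<omega> - X n j \<omega>))\<^sup>2 < \<epsilon> n \<and> pole \<bullet> X n i \<omega> < pole \<bullet> X n j \<omega>)"
proof -
  \<comment> \<open>Near the pole the ascent region has no guaranteed mass; F = 0 there keeps the
    mean of \<open>g\<close> nonpositive. The factor \<epsilon> in \<open>g\<close> makes its second
    moment O(\<epsilon>^2).\<close>
  define F where "F n x = (if \<epsilon> n / 4 \<le> (norm (x - pole))\<^sup>2 then c / 64 * \<epsilon> n else 0)" for n and x :: "real^3"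
  define g where "g n x y = \<epsilon> n * (F n x - indicator (ascent_region n x) y)" for n x y
  have gm: "(\<lambda>(x, y). g n x y) \<in> borel_measurable (borel \<Otimes>\<^sub>M borel)" for n
    unfolding g_def F_def ascent_region_def indicator_def by measurable
  have gm1 [measurable]: "g n x \<in> borel_measurable borel" for n x
    using measurable_compose[OF measurable_Pair1' gm, of x] by simp
  have bd: "\<bar>g n x y\<bar> \<le> (1 + c) * \<epsilon> n" if "0 < \<epsilon> n" "\<epsilon> n \<le> 1" for n x y
  proof -
    have "c * \<epsilon> n \<le> c * 1" using that c_pos by (intro mult_left_mono) auto
    then have "0 \<le> F n x" "F n x \<le> c" using that c_pos by (auto simp: F_def)
    then have "\<bar>F n x - indicator (ascent_region n x) y\<bar> \<le> 1 + c"
      by (auto simp: indicator_def)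
    then have "\<epsilon> n * \<bar>F n x - indicator (ascent_region n x) y\<bar> \<le> \<epsilon> n * (1 + c)"
      using that by (intro mult_left_mono) auto
    then show ?thesis using that by (simp add: g_def abs_mult mult.commute)
  qed
  have "AE \<omega> in M. \<forall>\<^sub>F n in sequentially. \<forall>i\<in>{1..n}.
    (\<Sum>j\<in>{1..n} - {i}. g n (X n i \<omega>) (X n j \<omega>)) < c / 64 * (\<epsilon> n)\<^sup>2 * (real n - 1)"
  proof (rule AE_pair_sums_less[where B = "1 + c" and v = "(1 + c)\<^sup>2", OF gm])
    show "\<forall>\<^sub>F n in sequentially. \<forall>x\<in>sphere 0 1. \<forall>y\<in>sphere 0 1. \<bar>g n x y\<bar> \<le> 1 + c"
      using eventually_small[OF zero_less_one]
    proof eventually_elim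
      case (elim n)
      have "(1 + c) * \<epsilon> n \<le> (1 + c) * 1"
        using elim c_pos by (intro mult_left_mono) auto
      with bd[of n] elim show ?case by (auto intro: order_trans)
    qed
    show "\<forall>\<^sub>F n in sequentially. \<forall>x\<in>sphere 0 1. (\<integral>y. (g n x y)\<^sup>2 \<partial>uniform_sphere) \<le> (1 + c)\<^sup>2 * (\<epsilon> n)\<^sup>2"
      using eventually_small[OF zero_less_one]
    proof eventually_elim
      case (elim n)
      then show ?case using integral_square_le[OF gm1 bd, of n]
        by (auto simp: power_mult_distrib)
    qed
    show "\<forall>\<^sub>F n in sequentially. \<forall>x\<in>sphere 0 1. (\<integral>y. g n x y \<partial>uniform_sphere) \<le> c / 64 / 4 * (\<epsilon> n)\<^sup>2"
      using eventually_small[OF zero_less_one]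
    proof eventually_elim
      case (elim n)
      show ?case
      proof
        fix x :: "real^3" assume x: "x \<in> sphere 0 1"
        have [measurable]: "ascent_region n x \<in> sets borel" unfolding ascent_region_def by measurable
        have "(\<integral>y. g n x y \<partial>uniform_sphere) = \<epsilon> n * (F n x - measure uniform_sphere (ascent_region n x))"
          unfolding g_def
          using integrable_indicator_uniform_sphere[of "ascent_region n x"] US.prob_space by simp
        also have "\<dots> \<le> 0"
          using ascent_region_lower[of n x] elim x
          by (intro mult_nonneg_nonpos) (auto simp: F_def)
        also have "0 \<le> c / 64 / 4 * (\<epsilon> n)\<^sup>2" using c_pos by simp
        finally show "(\<integral>y. g n x y \<partial>uniform_sphere) \<le> c / 64 / 4 * (\<epsilon> n)\<^sup>2" .
      qed
    qed
  qed (use c_pos in simp)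
  then show ?thesis
  proof eventually_elim
    case (elim \<omega>)
    from elim eventually_small[OF zero_less_one] eventually_ge_at_top[of 1] show ?case
    proof eventually_elim
      case (elim n)
      show ?case
      proof (intro ballI impI, rule ccontr)
        fix i assume i: "i \<in> {1..n}" and far: "\<epsilon> n / 4 \<le> (norm (X n i \<omega> - pole))\<^sup>2"
          and none: "\<not> (\<exists>j\<in>{1..n} - {i}. (norm (X n i \<omega> - X n j \<omega>))\<^sup>2 < \<epsilon> n \<and> pole \<bullet> X n i \<omega> < pole \<bullet> X n j \<omega>)"
        have card: "real (card ({Suc 0..n} - {i})) = real n - 1"
          using i by (simp add: of_nat_diff)
        have "g n (X n i \<omega>) (X n j \<omega>) = c / 64 * (\<epsilon> n)\<^sup>2" if "j \<in> {1..n} - {i}" for j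
          using that none far by (auto simp: g_def F_def ascent_region_def indicator_def power2_eq_square)
        then have "(\<Sum>j\<in>{1..n} - {i}. g n (X n i \<omega>) (X n j \<omega>)) = (\<Sum>j\<in>{1..n} - {i}. c / 64 * (\<epsilon> n)\<^sup>2)"
          by (rule sum.cong[OF refl])
        then have "(\<Sum>j\<in>{1..n} - {i}. g n (X n i \<omega>) (X n j \<omega>)) = (real n - 1) * (c / 64 * (\<epsilon> n)\<^sup>2)"
          by (simp add: card)
        with elim(1) i show False by (force simp: algebra_simps)
      qed
    qed
  qed
qed

section \<open>Drift of an eigenmode under the random coupling\<close>

lemma ridge_drift:
  assumes b: "norm b = 1"
  obtains D where "D \<ge> 0" "\<And>n x. 0 < \<epsilon> n \<Longrightarrow> \<epsilon> n \<le> 1 \<Longrightarrow> x \<in> sphere 0 1 \<Longrightarrow>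
    \<bar>(\<integral>y. (poly p (b \<bullet> y) - poly p (b \<bullet> x)) * weight n x y \<partial>uniform_sphere)
      - moment n / 2 * poly (legendre_op p) (b \<bullet> x)\<bar> \<le> D * sqrt (\<epsilon> n) * (\<epsilon> n)\<^sup>2"
proof -
  obtain D where D: "D \<ge> 0" "\<And>x y. norm x = 1 \<Longrightarrow> norm y = 1 \<Longrightarrow>
    \<bar>(\<Sum>k<4. poly p (b \<bullet> (axis_rotation x ^^ k) y) - poly p (b \<bullet> x)) / 4
      - (norm (x - y))\<^sup>2 / 4 * poly (legendre_op p) (b \<bullet> x)\<bar> \<le> D * norm (x - y) ^ 3"
    using ridge_rotation_average[OF b, of p] by blast
  obtain E where E: "E \<ge> 0" "\<And>z. \<bar>z\<bar> \<le> 1 \<Longrightarrow> \<bar>poly p z\<bar> \<le> E"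
    using poly_bounded_on_Icc by blast
  have "\<bar>(\<integral>y. (poly p (b \<bullet> y) - poly p (b \<bullet> x)) * weight n x y \<partial>uniform_sphere)
      - moment n / 2 * poly (legendre_op p) (b \<bullet> x)\<bar> \<le> (D * B * C) * sqrt (\<epsilon> n) * (\<epsilon> n)\<^sup>2"
    if e: "0 < \<epsilon> n" "\<epsilon> n \<le> 1" and x: "x \<in> sphere 0 1" for n x
  proof -
    have nx: "norm x = 1" using x by simp
    define L where "L = poly (legendre_op p) (b \<bullet> x)"
    define f where "f y = (poly p (b \<bullet> y) - poly p (b \<bullet> x)) * weight n x y" for y
    have contp: "poly p \<in> borel_measurable borel"
      by (intro borel_measurable_continuous_onI continuous_intros)
    have [measurable]: "(\<lambda>y. poly p (b \<bullet> y)) \<in> borel_measurable borel"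
      by (rule measurable_compose[OF _ contp]) measurable
    have [measurable]: "f \<in> borel_measurable borel" unfolding f_def by measurable
    have fb: "\<bar>f y\<bar> \<le> 2 * E * B" if "y \<in> sphere 0 1" for y
    proof -
      have "\<bar>poly p (b \<bullet> y) - poly p (b \<bullet> x)\<bar> \<le> 2 * E"
        using E(2)[OF abs_inner_unit_le[OF b, of y]] E(2)[OF abs_inner_unit_le[OF b nx]] that by simp
      then have "\<bar>poly p (b \<bullet> y) - poly p (b \<bullet> x)\<bar> * weight n x y \<le> 2 * E * B"
        using weight_le weight_nonneg E(1) by (intro mult_mono) auto
      then show ?thesis using weight_nonneg[of n x y] by (simp add: f_def abs_mult)
    qed
    \<comment> \<open>The integrand is replaced by its mean over the four rotations;
      \<open>weight\<close> factors out because it depends only on the distance to x.\<close>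
    define a where "a y = (\<Sum>k<4. f ((axis_rotation x ^^ k) y)) / 4" for y
    define h where "h y = a y - L / 2 * ((norm (x - y))\<^sup>2 / 2 * weight n x y)" for y
    have [measurable]: "a \<in> borel_measurable borel" unfolding a_def by measurable
    have w_rot: "weight n x ((axis_rotation x ^^ k) y) = weight n x y" for k y
      by (simp add: weight_def dist_axis_rotation_funpow[OF nx])
    have a_eq: "a y = (\<Sum>k<4. poly p (b \<bullet> (axis_rotation x ^^ k) y) - poly p (b \<bullet> x)) / 4 * weight n x y" for y
      unfolding a_def f_def by (simp add: w_rot sum_distrib_right)
    have h_eq: "h y = ((\<Sum>k<4. poly p (b \<bullet> (axis_rotation x ^^ k) y) - poly p (b \<bullet> x)) / 4
      - (norm (x - y))\<^sup>2 / 4 * L) * weight n x y" for y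
      unfolding h_def a_eq by (simp add: algebra_simps)
    have "\<bar>\<integral>y. h y \<partial>uniform_sphere\<bar> \<le> (D * (sqrt (\<epsilon> n) ^ 3) * B) * C * \<epsilon> n"
    proof (rule cap_integral(2)[OF e x])
      show "h \<in> borel_measurable borel" unfolding h_def by measurable
      show "h y = 0" if "\<epsilon> n < (norm (x - y))\<^sup>2" for y
        using weight_zero[OF e(1) that] by (simp add: h_eq)
      fix y :: "real^3" assume y: "y \<in> sphere 0 1" "(norm (x - y))\<^sup>2 \<le> \<epsilon> n"
      have "norm (x - y) \<le> sqrt (\<epsilon> n)" using y(2) by (rule real_le_rsqrt)
      then have "D * norm (x - y) ^ 3 \<le> D * sqrt (\<epsilon> n) ^ 3"
        using D(1) by (intro mult_left_mono power_mono) auto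
      then have "\<bar>(\<Sum>k<4. poly p (b \<bullet> (axis_rotation x ^^ k) y) - poly p (b \<bullet> x)) / 4
          - (norm (x - y))\<^sup>2 / 4 * L\<bar> \<le> D * sqrt (\<epsilon> n) ^ 3"
        using D(2)[OF nx, of y] y(1) unfolding L_def by simp
      then have "\<bar>(\<Sum>k<4. poly p (b \<bullet> (axis_rotation x ^^ k) y) - poly p (b \<bullet> x)) / 4
          - (norm (x - y))\<^sup>2 / 4 * L\<bar> * weight n x y \<le> D * sqrt (\<epsilon> n) ^ 3 * B"
        using weight_le weight_nonneg D(1) e by (intro mult_mono) auto
      then show "\<bar>h y\<bar> \<le> D * sqrt (\<epsilon> n) ^ 3 * B"
        using weight_nonneg[of n x y] by (simp add: h_eq abs_mult)
    qed
    \<comment> \<open>The third-order Taylor error \<epsilon>^(3/2) times the cap probability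
      \<epsilon>: half a power smaller than the scale \<epsilon>^2 of the drift.\<close>
    also have "(D * (sqrt (\<epsilon> n) ^ 3) * B) * C * \<epsilon> n = (D * B * C) * sqrt (\<epsilon> n) * (\<epsilon> n)\<^sup>2"
      using e by (simp add: power3_eq_cube power2_eq_square)
    also have "(\<integral>y. h y \<partial>uniform_sphere) = (\<integral>y. f y \<partial>uniform_sphere) - moment n / 2 * L"
    proof -
      have i1: "integrable uniform_sphere a"
        unfolding a_def
        by (intro integrable_divide_zero Bochner_Integration.integrable_sum integrable_uniform_sphere[where D = "2 * E * B"])
          (use fb nx in \<open>auto simp: norm_axis_rotation_funpow\<close>)
      have i2: "integrable uniform_sphere (\<lambda>y. (norm (x - y))\<^sup>2 / 2 * weight n x y)"
      proof (rule cap_integral(1)[OF e x, of _ "\<epsilon> n / 2 * B"])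
        fix y assume "(norm (x - y))\<^sup>2 \<le> \<epsilon> n"
        then show "\<bar>(norm (x - y))\<^sup>2 / 2 * weight n x y\<bar> \<le> \<epsilon> n / 2 * B"
          using weight_nonneg[of n x y] weight_le[of n x y] e
          by (simp add: abs_mult) (intro mult_mono; simp)
      qed (use weight_zero[OF e(1)] in auto)
      have "(\<integral>y. h y \<partial>uniform_sphere) = (\<integral>y. a y \<partial>uniform_sphere)
          - L / 2 * (\<integral>y. (norm (x - y))\<^sup>2 / 2 * weight n x y \<partial>uniform_sphere)"
        unfolding h_def
        by (simp only: Bochner_Integration.integral_diff[OF i1 integrable_mult_right[OF i2]] integral_mult_right_zero)
      also have "(\<integral>y. a y \<partial>uniform_sphere) = (\<integral>y. f y \<partial>uniform_sphere)"
        unfolding a_def by (rule integral_rotation_average[OF nx _ fb, symmetric]) simp_all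
      finally show ?thesis unfolding moment_eq[OF x] by simp
    qed
    finally show ?thesis by (simp add: f_def L_def)
  qed
  moreover have "D * B * C \<ge> 0" using D(1) B_pos C_pos by simp
  ultimately show thesis by (rule that[rotated])
qed

text \<open>By the Lipschitz bound the coupling part of a summand is O(sqrt \<epsilon>) on a cap of
  probability O(\<epsilon>), so its second moment is O(\<epsilon>^2). Boundedness alone would give
  O(\<epsilon>), too much for a fixed exponent.\<close>

lemma AE_ridge_sums_less:
  assumes b: "norm b = 1" and "\<eta> > 0"
  shows "AE \<omega> in M. \<forall>\<^sub>F n in sequentially. \<forall>i\<in>{1..n}.
    (\<Sum>j\<in>{1..n} - {i}. (poly p (b \<bullet> X n j \<omega>) - poly p (b \<bullet> X n i \<omega>)) * weight n (X n i \<omega>) (X n j \<omega>)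
      - moment n / 2 * poly (legendre_op p) (b \<bullet> X n i \<omega>)) < \<eta> * (\<epsilon> n)\<^sup>2 * (real n - 1)"
proof -
  obtain D where D: "D \<ge> 0" "\<And>n x. 0 < \<epsilon> n \<Longrightarrow> \<epsilon> n \<le> 1 \<Longrightarrow> x \<in> sphere 0 1 \<Longrightarrow>
    \<bar>(\<integral>y. (poly p (b \<bullet> y) - poly p (b \<bullet> x)) * weight n x y \<partial>uniform_sphere)
      - moment n / 2 * poly (legendre_op p) (b \<bullet> x)\<bar> \<le> D * sqrt (\<epsilon> n) * (\<epsilon> n)\<^sup>2"
    using ridge_drift[OF b, of p] by blast
  obtain L where L: "L \<ge> 0"
    "\<And>z y. \<bar>z\<bar> \<le> 1 \<Longrightarrow> \<bar>y\<bar> \<le> 1 \<Longrightarrow> \<bar>poly p z - poly p y\<bar> \<le> L * \<bar>z - y\<bar>"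
    using poly_lipschitz_on_Icc by blast
  obtain E where E: "E \<ge> 0" "\<And>z. \<bar>z\<bar> \<le> 1 \<Longrightarrow> \<bar>poly (legendre_op p) z\<bar> \<le> E"
    using poly_bounded_on_Icc by blast
  define f where "f n x y = (poly p (b \<bullet> y) - poly p (b \<bullet> x)) * weight n x y" for n x y
  define T where "T n x = moment n / 2 * poly (legendre_op p) (b \<bullet> x)" for n x
  have contp: "poly q \<in> borel_measurable borel" for q :: "real poly"
    by (intro borel_measurable_continuous_onI continuous_intros)
  have [measurable]: "(\<lambda>y. poly q (b \<bullet> y)) \<in> borel_measurable borel" for q
    by (rule measurable_compose[OF _ contp]) measurable
  have fm [measurable]: "f n x \<in> borel_measurable borel" for n x unfolding f_def by measurable
  have gm: "(\<lambda>(x, y). f n x y - T n x) \<in> borel_measurable (borel \<Otimes>\<^sub>M borel)" for n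
    using measurable_weight(1)[of n] unfolding f_def T_def case_prod_beta'
    by (intro borel_measurable_diff borel_measurable_times measurable_compose[OF measurable_fst] measurable_compose[OF measurable_snd])
      (auto simp: case_prod_beta')
  have fb: "\<bar>f n x y\<bar> \<le> L * sqrt (\<epsilon> n) * B" if "0 < \<epsilon> n" "x \<in> sphere 0 1" "y \<in> sphere 0 1" for n x y
  proof (cases "(norm (x - y))\<^sup>2 \<le> \<epsilon> n")
    case True
    then have r: "norm (x - y) \<le> sqrt (\<epsilon> n)" by (rule real_le_rsqrt)
    have "\<bar>poly p (b \<bullet> y) - poly p (b \<bullet> x)\<bar> \<le> L * \<bar>b \<bullet> y - b \<bullet> x\<bar>"
      using that by (intro L(2) abs_inner_unit_le[OF b]) auto
    also have "\<dots> \<le> L * sqrt (\<epsilon> n)"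
      using abs_inner_diff_unit_le[OF b, of y x] r L(1)
      by (intro mult_left_mono) (auto simp: norm_minus_commute)
    finally have "\<bar>poly p (b \<bullet> y) - poly p (b \<bullet> x)\<bar> * weight n x y \<le> L * sqrt (\<epsilon> n) * B"
      using weight_le weight_nonneg L(1) that by (intro mult_mono) auto
    then show ?thesis using weight_nonneg[of n x y] by (simp add: f_def abs_mult)
  next
    case False
    then show ?thesis using weight_zero[OF that(1), of x y] L(1) B_pos that(1) by (simp add: f_def)
  qed
  have f0: "f n x y = 0" if "0 < \<epsilon> n" "\<epsilon> n < (norm (x - y))\<^sup>2" for n x y
    using weight_zero[OF that] by (simp add: f_def)
  have Tb: "\<bar>T n x\<bar> \<le> B * C * E * (\<epsilon> n)\<^sup>2" if "0 < \<epsilon> n" "\<epsilon> n \<le> 1" "x \<in> sphere 0 1" for n x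
  proof -
    have "\<bar>T n x\<bar> = \<bar>moment n\<bar> / 2 * \<bar>poly (legendre_op p) (b \<bullet> x)\<bar>" by (simp add: T_def abs_mult)
    also have "\<dots> \<le> (B * C * (\<epsilon> n)\<^sup>2) * E"
      using moment_upper[OF that(1,2)] E(2)[OF abs_inner_unit_le[OF b, of x]] that(3) E(1)
      by (intro mult_mono) auto
    finally show ?thesis by (simp add: mult_ac)
  qed
  have "AE \<omega> in M. \<forall>\<^sub>F n in sequentially. \<forall>i\<in>{1..n}.
    (\<Sum>j\<in>{1..n} - {i}. f n (X n i \<omega>) (X n j \<omega>) - T n (X n i \<omega>)) < \<eta> * (\<epsilon> n)\<^sup>2 * (real n - 1)"
  proof (rule AE_pair_sums_less[where B = "L * B + B * C * E" and v = "2 * (L\<^sup>2 * B\<^sup>2 * C) + 2 * (B * C * E)\<^sup>2", OF gm \<open>\<eta> > 0\<close>])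
    show "\<forall>\<^sub>F n in sequentially. \<forall>x\<in>sphere 0 1. \<forall>y\<in>sphere 0 1. \<bar>f n x y - T n x\<bar> \<le> L * B + B * C * E"
      using eventually_small[OF zero_less_one]
    proof eventually_elim
      case (elim n)
      show ?case
      proof (intro ballI)
        fix x y :: "real^3" assume xy: "x \<in> sphere 0 1" "y \<in> sphere 0 1"
        have "L * sqrt (\<epsilon> n) * B \<le> L * 1 * B"
          using elim L(1) B_pos by (intro mult_right_mono mult_left_mono) auto
        moreover have "B * C * E * (\<epsilon> n)\<^sup>2 \<le> B * C * E * 1"
          using elim E(1) B_pos C_pos by (intro mult_left_mono) (auto simp: power_le_one)
        ultimately show "\<bar>f n x y - T n x\<bar> \<le> L * B + B * C * E"
          using fb[of n x y] Tb[of n x] xy elim by simp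
      qed
    qed
    show "\<forall>\<^sub>F n in sequentially. \<forall>x\<in>sphere 0 1. (\<integral>y. (f n x y - T n x)\<^sup>2 \<partial>uniform_sphere)
        \<le> (2 * (L\<^sup>2 * B\<^sup>2 * C) + 2 * (B * C * E)\<^sup>2) * (\<epsilon> n)\<^sup>2"
      using eventually_small[OF zero_less_one]
    proof eventually_elim
      case (elim n)
      show ?case
      proof
        fix x :: "real^3" assume x: "x \<in> sphere 0 1"
        have sq: "(f n x y)\<^sup>2 \<le> L\<^sup>2 * \<epsilon> n * B\<^sup>2" if "y \<in> sphere 0 1" for y
          using power_mono[OF fb[of n x y], of 2] elim x that by (simp add: power_mult_distrib)
        have int: "integrable uniform_sphere (\<lambda>y. (f n x y)\<^sup>2)"
          by (rule cap_integral(1)[of n x _ "L\<^sup>2 * \<epsilon> n * B\<^sup>2"]) (use sq elim x f0 in simp_all)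
        have int2: "\<bar>\<integral>y. (f n x y)\<^sup>2 \<partial>uniform_sphere\<bar> \<le> (L\<^sup>2 * \<epsilon> n * B\<^sup>2) * C * \<epsilon> n"
          by (rule cap_integral(2)[of n x]) (use sq elim x f0 in simp_all)
        have "(\<integral>y. (f n x y - T n x)\<^sup>2 \<partial>uniform_sphere) \<le> (\<integral>y. 2 * (f n x y)\<^sup>2 + 2 * (T n x)\<^sup>2 \<partial>uniform_sphere)"
        proof (rule integral_mono_uniform_sphere)
          show "integrable uniform_sphere (\<lambda>y. (f n x y - T n x)\<^sup>2)"
          proof (rule integrable_uniform_sphere)
            fix y :: "real^3" assume "y \<in> sphere 0 1"
            then have "\<bar>f n x y - T n x\<bar> \<le> L * sqrt (\<epsilon> n) * B + B * C * E * (\<epsilon> n)\<^sup>2"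
              using fb[of n x y] Tb[of n x] x elim by simp
            from power_mono[OF this, of 2]
            show "\<bar>(f n x y - T n x)\<^sup>2\<bar> \<le> (L * sqrt (\<epsilon> n) * B + B * C * E * (\<epsilon> n)\<^sup>2)\<^sup>2" by simp
          qed simp
          show "(f n x y - T n x)\<^sup>2 \<le> 2 * (f n x y)\<^sup>2 + 2 * (T n x)\<^sup>2" for y
            using sum_squares_bound[of "f n x y" "- T n x"] by (simp add: power2_diff)
        qed (use int in auto)
        also have "\<dots> = 2 * (\<integral>y. (f n x y)\<^sup>2 \<partial>uniform_sphere) + 2 * (T n x)\<^sup>2"
          using int US.prob_space by simp
        also have "\<dots> \<le> 2 * ((L\<^sup>2 * \<epsilon> n * B\<^sup>2) * C * \<epsilon> n) + 2 * ((B * C * E)\<^sup>2 * (\<epsilon> n)\<^sup>2)"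
        proof -
          have "(T n x)\<^sup>2 \<le> (B * C * E * \<epsilon> n)\<^sup>2"
          proof -
            have "(\<epsilon> n)\<^sup>2 \<le> \<epsilon> n" using elim by (simp add: power2_eq_square mult_left_le)
            then have "B * C * E * (\<epsilon> n)\<^sup>2 \<le> B * C * E * \<epsilon> n"
              using B_pos C_pos E(1) by (intro mult_left_mono) auto
            then have "\<bar>T n x\<bar> \<le> B * C * E * \<epsilon> n" using Tb[of n x] elim x by simp
            from power_mono[OF this, of 2] show ?thesis by simp
          qed
          then show ?thesis using int2 by (simp add: power_mult_distrib)
        qed
        also have "\<dots> = (2 * (L\<^sup>2 * B\<^sup>2 * C) + 2 * (B * C * E)\<^sup>2) * (\<epsilon> n)\<^sup>2"
          by (simp add: algebra_simps power2_eq_square)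
        finally show "(\<integral>y. (f n x y - T n x)\<^sup>2 \<partial>uniform_sphere)
          \<le> (2 * (L\<^sup>2 * B\<^sup>2 * C) + 2 * (B * C * E)\<^sup>2) * (\<epsilon> n)\<^sup>2" .
      qed
    qed
    \<comment> \<open>Ensures sqrt \<epsilon> <= \<eta> / (4 (D + 1)), so that the bias of the mean
      fits into the quarter of the threshold reserved for it.\<close>
    define e0 where "e0 = min 1 ((\<eta> / (4 * (D + 1)))\<^sup>2)"
    have "e0 > 0" using \<open>\<eta> > 0\<close> D(1) by (simp add: e0_def)
    show "\<forall>\<^sub>F n in sequentially. \<forall>x\<in>sphere 0 1. (\<integral>y. f n x y - T n x \<partial>uniform_sphere) \<le> \<eta> / 4 * (\<epsilon> n)\<^sup>2"
      using eventually_small[OF \<open>e0 > 0\<close>]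
    proof eventually_elim
      case (elim n)
      then have e: "0 < \<epsilon> n" "\<epsilon> n \<le> 1" "\<epsilon> n \<le> (\<eta> / (4 * (D + 1)))\<^sup>2" by (simp_all add: e0_def)
      show ?case
      proof
        fix x :: "real^3" assume x: "x \<in> sphere 0 1"
        have "integrable uniform_sphere (f n x)"
          by (rule integrable_uniform_sphere[OF fm fb[OF e(1) x]])
        then have "(\<integral>y. f n x y - T n x \<partial>uniform_sphere) = (\<integral>y. f n x y \<partial>uniform_sphere) - T n x"
          using US.prob_space by simp
        also have "\<dots> \<le> D * sqrt (\<epsilon> n) * (\<epsilon> n)\<^sup>2"
          using D(2)[OF e(1,2) x] by (simp add: f_def T_def)
        also have "\<dots> \<le> \<eta> / 4 * (\<epsilon> n)\<^sup>2"
        proof (rule mult_right_mono)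
          have "sqrt (\<epsilon> n) \<le> \<eta> / (4 * (D + 1))"
            using e(3) D(1) \<open>\<eta> > 0\<close> by (intro real_le_lsqrt) auto
          then have "(D + 1) * sqrt (\<epsilon> n) \<le> \<eta> / 4" using D(1) by (simp add: field_simps)
          moreover have "D * sqrt (\<epsilon> n) \<le> (D + 1) * sqrt (\<epsilon> n)" using e(1) by (intro mult_right_mono) auto
          ultimately show "D * sqrt (\<epsilon> n) \<le> \<eta> / 4" by linarith
        qed simp
        finally show "(\<integral>y. f n x y - T n x \<partial>uniform_sphere) \<le> \<eta> / 4 * (\<epsilon> n)\<^sup>2" .
      qed
    qed
  qed
  then show ?thesis by (simp add: f_def T_def)
qed

definition mean_degree :: "nat \<Rightarrow> real" where
  "mean_degree n = (real n - 1) * edge_prob n"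

text \<open>Residual of w in the linearized system, with \<open>w'\<close> the derivative in heat
  time. It is linear in the pair (w, w'), so residuals of modes add up.\<close>

definition heat_error :: "(real \<Rightarrow> real^3 \<Rightarrow> real) \<Rightarrow> (real \<Rightarrow> real^3 \<Rightarrow> real) \<Rightarrow> 'w \<Rightarrow> nat \<Rightarrow> nat \<Rightarrow> real \<Rightarrow> real" where
  "heat_error w w' \<omega> n i t = 1 / (\<epsilon> n * mean_degree n) *
     (\<Sum>j\<in>{1..n} - {i}. (w t (X n j \<omega>) - w t (X n i \<omega>)) * weight n (X n i \<omega>) (X n j \<omega>))
     - speed n * w' t (X n i \<omega>)"

text \<open>Time enters only through the common factor exp (- \<mu> t) <= 1, so one spatial estimate
  serves all t >= 0 and no union over times is needed. Using the one-sided bound for p and for - p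
  gives both signs.\<close>

lemma AE_mode_consistent:
  assumes b: "norm b = 1" and "\<mu> > 0" and p: "legendre_op p = smult (- (2 * \<mu>)) p" and "\<eta> > 0"
  shows "AE \<omega> in M. \<forall>\<^sub>F n in sequentially. \<forall>i\<in>{1..n}. \<forall>t\<ge>0.
    \<bar>heat_error (\<lambda>t x. exp (- \<mu> * t) * poly p (b \<bullet> x)) (\<lambda>t x. - \<mu> * exp (- \<mu> * t) * poly p (b \<bullet> x)) \<omega> n i t\<bar> \<le> \<eta>"
proof -
  \<comment> \<open>The normalization \<epsilon> \<open>mean_degree n\<close> is at least c
    \<epsilon>^2 (n - 1), so the threshold \<eta> c becomes \<eta> after division.\<close>
  have "\<eta> * c > 0" using \<open>\<eta> > 0\<close> c_pos by simp
  from AE_ridge_sums_less[OF b this, of p] AE_ridge_sums_less[OF b this, of "- p"]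
  show ?thesis
  proof eventually_elim
    case (elim \<omega>)
    from elim eventually_small[OF zero_less_one] eventually_ge_at_top[of 2] show ?case
    proof eventually_elim
      case (elim n)
      then have e: "0 < \<epsilon> n" "\<epsilon> n \<le> 1" by auto
      note ep = edge_prob_bounds[OF e]
      have pp: "0 < edge_prob n" using ep(1) c_pos e by (smt (verit) mult_pos_pos)
      define N where "N = real n - 1"
      have N: "N > 0" using elim by (simp add: N_def)
      show ?case
      proof (intro ballI allI impI)
        fix i t assume i: "i \<in> {1..n}" and t: "(0::real) \<le> t"
        define z where "z = b \<bullet> X n i \<omega>"
        define S where "S = (\<Sum>j\<in>{1..n} - {i}. (poly p (b \<bullet> X n j \<omega>) - poly p z) * weight n (X n i \<omega>) (X n j \<omega>))"
        have card: "real (card ({Suc 0..n} - {i})) = N"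
          using i by (simp add: of_nat_diff N_def)
        have opm: "legendre_op (- p) = - legendre_op p"
          using legendre_op_smult[of "-1" p] by simp
        have 1: "S + N * (moment n * \<mu> * poly p z) < \<eta> * c * (\<epsilon> n)\<^sup>2 * N"
          using elim(1)[rule_format, OF i]
          by (simp add: p sum_subtractf sum.distrib card S_def z_def N_def)
        have "- S - N * (moment n * \<mu> * poly p z) < \<eta> * c * (\<epsilon> n)\<^sup>2 * N"
          using elim(2)[rule_format, OF i]
          by (simp add: opm p sum_subtractf sum.distrib card S_def z_def N_def sum_negf algebra_simps)
        with 1 have abs: "\<bar>S + N * (moment n * \<mu> * poly p z)\<bar> \<le> \<eta> * c * (\<epsilon> n)\<^sup>2 * N" by linarith
        have "heat_error (\<lambda>t x. exp (- \<mu> * t) * poly p (b \<bullet> x)) (\<lambda>t x. - \<mu> * exp (- \<mu> * t) * poly p (b \<bullet> x)) \<omega> n i t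
          = exp (- \<mu> * t) * (1 / (\<epsilon> n * (N * edge_prob n)) * (S + N * (moment n * \<mu> * poly p z)))"
        proof -
          have "(\<Sum>j\<in>{1..n} - {i}. (exp (- \<mu> * t) * poly p (b \<bullet> X n j \<omega>) - exp (- \<mu> * t) * poly p (b \<bullet> X n i \<omega>))
              * weight n (X n i \<omega>) (X n j \<omega>)) = exp (- \<mu> * t) * S"
            by (simp add: S_def z_def sum_distrib_left algebra_simps)
          then show ?thesis
            using N pp e by (simp add: heat_error_def mean_degree_def N_def[symmetric] speed_def z_def[symmetric] field_simps)
        qed
        also have "\<bar>\<dots>\<bar> = exp (- \<mu> * t) * (1 / (\<epsilon> n * (N * edge_prob n)) * \<bar>S + N * (moment n * \<mu> * poly p z)\<bar>)"
          using N pp e by (simp add: abs_mult)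
        also have "\<dots> \<le> 1 * (1 / (\<epsilon> n * (N * edge_prob n)) * (\<eta> * c * (\<epsilon> n)\<^sup>2 * N))"
          using abs t \<open>\<mu> > 0\<close> N pp e by (intro mult_mono) auto
        also have "\<dots> = \<eta> * (c * \<epsilon> n / edge_prob n)"
          using N pp e by (simp add: power2_eq_square)
        also have "\<dots> \<le> \<eta> * 1"
          using ep(1) pp \<open>\<eta> > 0\<close> by (intro mult_left_mono) auto
        finally show "\<bar>heat_error (\<lambda>t x. exp (- \<mu> * t) * poly p (b \<bullet> x)) (\<lambda>t x. - \<mu> * exp (- \<mu> * t) * poly p (b \<bullet> x)) \<omega> n i t\<bar> \<le> \<eta>"
          by simp
      qed
    qed
  qed
qed

text \<open>The derivative has to be fixed before \<eta> and before the null set, so the induction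
  carries it as a witness together with the almost sure statement.\<close>

lemma AE_heat_sum_consistent:
  assumes "heat_sum w"
  shows "\<exists>w'. (\<forall>t x. ((\<lambda>t. w t x) has_real_derivative w' t x) (at t)) \<and>
    (\<forall>\<eta>>0. AE \<omega> in M. \<forall>\<^sub>F n in sequentially. \<forall>i\<in>{1..n}. \<forall>t\<ge>0. \<bar>heat_error w w' \<omega> n i t\<bar> \<le> \<eta>)"
  using assms
proof induction
  case (const a)
  show ?case
    by (intro exI[of _ "\<lambda>_ _. 0"]) (auto simp: heat_error_def)
next
  case (mode b \<mu> p)
  have "((\<lambda>t. exp (- \<mu> * t) * poly p (b \<bullet> x)) has_real_derivative - \<mu> * exp (- \<mu> * t) * poly p (b \<bullet> x)) (at t)" for t x
    by (auto intro!: derivative_eq_intros)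
  with AE_mode_consistent[OF mode] show ?case
    by (intro exI[of _ "\<lambda>t x. - \<mu> * exp (- \<mu> * t) * poly p (b \<bullet> x)"]) blast
next
  case (add w1 w2)
  obtain w1' where w1': "\<And>t x. ((\<lambda>t. w1 t x) has_real_derivative w1' t x) (at t)"
    "\<And>\<eta>. \<eta> > 0 \<Longrightarrow> AE \<omega> in M. \<forall>\<^sub>F n in sequentially. \<forall>i\<in>{1..n}. \<forall>t\<ge>0. \<bar>heat_error w1 w1' \<omega> n i t\<bar> \<le> \<eta>"
    using add.IH(1) by blast
  obtain w2' where w2': "\<And>t x. ((\<lambda>t. w2 t x) has_real_derivative w2' t x) (at t)"
    "\<And>\<eta>. \<eta> > 0 \<Longrightarrow> AE \<omega> in M. \<forall>\<^sub>F n in sequentially. \<forall>i\<in>{1..n}. \<forall>t\<ge>0. \<bar>heat_error w2 w2' \<omega> n i t\<bar> \<le> \<eta>"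
    using add.IH(2) by blast
  let ?w = "\<lambda>t x. w1 t x + w2 t x" and ?w' = "\<lambda>t x. w1' t x + w2' t x"
  have split: "heat_error ?w ?w' \<omega> n i t = heat_error w1 w1' \<omega> n i t + heat_error w2 w2' \<omega> n i t" for \<omega> n i t
    by (simp add: heat_error_def algebra_simps sum.distrib sum_subtractf)
  have "AE \<omega> in M. \<forall>\<^sub>F n in sequentially. \<forall>i\<in>{1..n}. \<forall>t\<ge>0. \<bar>heat_error ?w ?w' \<omega> n i t\<bar> \<le> \<eta>" if "\<eta> > 0" for \<eta>
    using w1'(2)[OF half_gt_zero[OF that]] w2'(2)[OF half_gt_zero[OF that]]
  proof eventually_elim
    case (elim \<omega>)
    then show ?case
    proof eventually_elim
      case (elim n)
      show ?case
      proof (intro ballI allI impI)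
        fix i t assume "i \<in> {1..n}" "(0::real) \<le> t"
        with elim have "\<bar>heat_error w1 w1' \<omega> n i t\<bar> \<le> \<eta> / 2" "\<bar>heat_error w2 w2' \<omega> n i t\<bar> \<le> \<eta> / 2"
          by blast+
        then show "\<bar>heat_error ?w ?w' \<omega> n i t\<bar> \<le> \<eta>" unfolding split by linarith
      qed
    qed
  qed
  moreover have "((\<lambda>t. ?w t x) has_real_derivative ?w' t x) (at t)" for t x
    by (intro DERIV_add w1'(1) w2'(1))
  ultimately show ?case by (intro exI[of _ ?w']) blast
qed

end

section \<open>Comparison and synchronization\<close>

text \<open>At the first time when a deviation reaches the barrier \<open>\<delta> + \<eta>' t\<close>, it is extremal among all
  vertices, and there the coupling can only pull it back.\<close>

lemma kuramoto_comparison: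
  fixes u w w' :: "real \<Rightarrow> nat \<Rightarrow> real" and a :: "nat \<Rightarrow> nat \<Rightarrow> real"
  assumes "finite I"
    and a_nonneg: "\<And>i j. 0 \<le> a i j"
    and cont_u: "\<And>i. i \<in> I \<Longrightarrow> continuous_on {0..} (\<lambda>t. u t i)"
    and cont_w: "\<And>i. i \<in> I \<Longrightarrow> continuous_on {0..} (\<lambda>t. w t i)"
    and der_u: "\<And>t i. i \<in> I \<Longrightarrow> 0 < t \<Longrightarrow> ((\<lambda>t. u t i) has_real_derivative
      (\<Sum>j\<in>I - {i}. a i j * sin (u t j - u t i))) (at t)"
    and der_w: "\<And>t i. i \<in> I \<Longrightarrow> 0 < t \<Longrightarrow> ((\<lambda>t. w t i) has_real_derivative w' t i) (at t)"
    and consistent: "\<And>t i. i \<in> I \<Longrightarrow> 0 \<le> t \<Longrightarrow> \<bar>(\<Sum>j\<in>I - {i}. a i j * sin (w t j - w t i)) - w' t i\<bar> \<le> \<eta>"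
    and "\<eta> < \<eta>'"
    and small: "\<And>t i j. i \<in> I \<Longrightarrow> j \<in> I \<Longrightarrow> 0 \<le> t \<Longrightarrow> a i j \<noteq> 0 \<Longrightarrow> \<bar>w t j - w t i\<bar> \<le> 1 / 2"
    and init: "\<And>i. i \<in> I \<Longrightarrow> \<bar>u 0 i - w 0 i\<bar> < \<delta>"
    and T: "\<delta> + \<eta>' * T \<le> 1 / 2"
    and t: "0 \<le> t" "t \<le> T" and i: "i \<in> I"
  shows "\<bar>u t i - w t i\<bar> < \<delta> + \<eta>' * t"
proof (rule ccontr)
  assume not: "\<not> ?thesis"
  have "0 \<le> \<eta>" using consistent[OF i order_refl] by linarith
  then have "\<eta>' > 0" using \<open>\<eta> < \<eta>'\<close> by simp
  define v where "v t i = u t i - w t i" for t i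
  \<comment> \<open>The times at which some vertex has reached the barrier form a compact set, which
    therefore has a least element.\<close>
  define S where "S = {s \<in> {0..T}. \<exists>i\<in>I. \<delta> + \<eta>' * s \<le> \<bar>v s i\<bar>}"
  have cont_v: "continuous_on {0..T} (\<lambda>t. v t i)" if "i \<in> I" for i T
    unfolding v_def using that
    by (intro continuous_on_diff continuous_on_subset[OF cont_u] continuous_on_subset[OF cont_w]) auto
  have "S = (\<Union>i\<in>I. {s \<in> {0..T}. \<delta> + \<eta>' * s \<le> \<bar>v s i\<bar>})"
    by (auto simp: S_def)
  moreover have "closed {s \<in> {0..T}. \<delta> + \<eta>' * s \<le> \<bar>v s i\<bar>}" if "i \<in> I" for i
    using cont_v[OF that] by (intro continuous_on_closed_Collect_le continuous_intros) auto
  ultimately have "closed S" using \<open>finite I\<close> by auto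
  moreover have "bounded S" by (rule bounded_subset[of "{0..T}"]) (auto simp: S_def)
  ultimately have "compact S" by (simp add: compact_eq_bounded_closed)
  moreover have "t \<in> S" using not t bexI[OF _ i] by (auto simp: S_def v_def not_less)
  ultimately obtain s where s: "s \<in> S" "\<And>r. r \<in> S \<Longrightarrow> s \<le> r"
    using compact_attains_inf[of S] by blast
  obtain i where i: "i \<in> I" "\<delta> + \<eta>' * s \<le> \<bar>v s i\<bar>" and s0T: "0 \<le> s" "s \<le> T"
    using s(1) by (auto simp: S_def)
  have "s \<noteq> 0" using i init[OF i(1)] by (auto simp: v_def)
  then have s0: "0 < s" using s0T by simp
  have before: "\<bar>v r j\<bar> < \<delta> + \<eta>' * r" if "0 \<le> r" "r < s" "j \<in> I" for r j
    using s(2)[of r] that s0T by (force simp: S_def not_le)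
  have at_s: "\<bar>v s j\<bar> \<le> \<delta> + \<eta>' * s" if "j \<in> I" for j
  proof -
    have cl: "closure {0..<s} = {0..s}" using s0 by simp
    have "continuous_on (closure {0..<s}) (\<lambda>s. \<bar>v s j\<bar> - (\<delta> + \<eta>' * s))"
      unfolding cl by (intro continuous_intros cont_v[OF that])
    then have "\<bar>v s j\<bar> - (\<delta> + \<eta>' * s) \<le> 0"
    proof (rule continuous_le_on_closure)
      show "s \<in> closure {0..<s}" unfolding cl using s0 by simp
      show "\<bar>v r j\<bar> - (\<delta> + \<eta>' * r) \<le> 0" if "r \<in> {0..<s}" for r
        using before[of r j] that \<open>j \<in> I\<close> by simp
    qed
    then show ?thesis by simp
  qed
  \<comment> \<open>The sign handles the upper and the lower barrier at once, as the sine is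
    odd.\<close>
  define \<sigma> :: real where "\<sigma> = (if v s i \<ge> 0 then 1 else - 1)"
  have \<sigma>: "\<bar>\<sigma>\<bar> = 1" "\<sigma> * v s i = \<bar>v s i\<bar>" by (auto simp: \<sigma>_def)
  have \<sigma>_le: "\<bar>\<sigma> * z\<bar> = \<bar>z\<bar>" for z using \<sigma>(1) by (simp add: abs_mult)
  have \<sigma>_sin: "\<sigma> * sin z = sin (\<sigma> * z)" for z by (simp add: \<sigma>_def)
  have vi: "\<sigma> * v s i = \<delta> + \<eta>' * s" using at_s[OF i(1)] i(2) \<sigma>(2) by simp
  have T': "\<delta> + \<eta>' * s \<le> 1 / 2"
  proof -
    have "\<eta>' * s \<le> \<eta>' * T" using s0T \<open>\<eta>' > 0\<close> by (intro mult_left_mono) auto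
    then show ?thesis using T by linarith
  qed
  define l where "l = \<sigma> * ((\<Sum>j\<in>I - {i}. a i j * sin (u s j - u s i)) - w' s i) - \<eta>'"
  have der: "((\<lambda>r. \<sigma> * v r i - (\<delta> + \<eta>' * r)) has_real_derivative l) (at s)"
    unfolding v_def l_def
    by (auto intro!: derivative_eq_intros der_u[OF i(1) s0] der_w[OF i(1) s0])
  have "\<sigma> * (\<Sum>j\<in>I - {i}. a i j * sin (u s j - u s i)) \<le> \<sigma> * (\<Sum>j\<in>I - {i}. a i j * sin (w s j - w s i))"
    unfolding sum_distrib_left
  proof (rule sum_mono)
    fix j assume j: "j \<in> I - {i}"
    show "\<sigma> * (a i j * sin (u s j - u s i)) \<le> \<sigma> * (a i j * sin (w s j - w s i))"
    proof (cases "a i j = 0")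
      case False
      have w: "\<bar>\<sigma> * (w s j - w s i)\<bar> \<le> 1 / 2"
        unfolding \<sigma>_le using small[of i j s] False i(1) j s0 by simp
      have vj: "\<bar>\<sigma> * v s j\<bar> \<le> \<delta> + \<eta>' * s" unfolding \<sigma>_le using at_s j by simp
      have eq: "\<sigma> * (u s j - u s i) = \<sigma> * (w s j - w s i) + (\<sigma> * v s j - \<sigma> * v s i)"
        by (simp add: v_def algebra_simps)
      \<comment> \<open>Vertex i is extremal, so the difference of deviations lies in [-1, 0]; with
        the 1/2 from \<open>small\<close>, both arguments stay in [-3/2, 1/2], where the sine
        increases because pi > 3.\<close>
      have "sin (\<sigma> * (u s j - u s i)) \<le> sin (\<sigma> * (w s j - w s i))"
        using w vj vi T' pi_gt3 unfolding eq by (intro sin_monotone_2pi_le) auto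
      then have "a i j * (\<sigma> * sin (u s j - u s i)) \<le> a i j * (\<sigma> * sin (w s j - w s i))"
        unfolding \<sigma>_sin using a_nonneg by (intro mult_left_mono)
      then show ?thesis by (simp add: mult.left_commute)
    qed simp
  qed
  then have "l \<le> \<sigma> * ((\<Sum>j\<in>I - {i}. a i j * sin (w s j - w s i)) - w' s i) - \<eta>'"
    by (simp add: l_def right_diff_distrib)
  also have "\<dots> \<le> \<eta> - \<eta>'"
    using consistent[OF i(1), of s] s0 \<sigma>_le[of "(\<Sum>j\<in>I - {i}. a i j * sin (w s j - w s i)) - w' s i"] by linarith
  finally have "l < 0" using \<open>\<eta> < \<eta>'\<close> by simp
  \<comment> \<open>A negative slope at s puts vertex i beyond the barrier just before s, against
    the minimality of s.\<close>
  then obtain d where d: "d > 0"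
    "\<And>h. 0 < h \<Longrightarrow> h < d \<Longrightarrow> \<sigma> * v s i - (\<delta> + \<eta>' * s) < \<sigma> * v (s - h) i - (\<delta> + \<eta>' * (s - h))"
    using has_real_derivative_neg_dec_left[OF der] by auto
  define h where "h = min d s / 2"
  have h: "0 < h" "h < d" "h < s" using d(1) s0 by (auto simp: h_def min_def)
  have "\<sigma> * v (s - h) i \<le> \<bar>v (s - h) i\<bar>" using \<sigma>_le[of "v (s - h) i"] by linarith
  then show False using d(2)[OF h(1,2)] before[of "s - h" i] h i(1) vi by simp
qed

section \<open>Poincare inequality on a connected weighted graph\<close>

lemma dirichlet_connected_bound:
  fixes a :: "nat \<Rightarrow> nat \<Rightarrow> real"
  assumes "finite I" and a: "\<And>i j. 0 \<le> a i j"
    and path: "(i, k) \<in> {(i, j). i \<in> I \<and> j \<in> I \<and> 0 < a i j}\<^sup>*"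
  shows "\<exists>C\<ge>0. \<forall>f::nat \<Rightarrow> real. (f k - f i)\<^sup>2 \<le> C * (\<Sum>i\<in>I. \<Sum>j\<in>I. a i j * (f j - f i)\<^sup>2)"
  using path
proof induction
  case base
  show ?case by (intro exI[of _ 0]) simp
next
  case (step j k)
  let ?Q = "\<lambda>f::nat \<Rightarrow> real. \<Sum>i\<in>I. \<Sum>j\<in>I. a i j * (f j - f i)\<^sup>2"
  obtain C where C: "C \<ge> 0" "\<And>f::nat \<Rightarrow> real. (f j - f i)\<^sup>2 \<le> C * ?Q f"
    using step.IH by blast
  have jk: "j \<in> I" "k \<in> I" "0 < a j k" using step.hyps(2) by auto
  \<comment> \<open>By (x + y)^2 <= 2 x^2 + 2 y^2, where the square over the new edge, times its
    weight, is a single term of the Dirichlet form.\<close>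
  have "(f k - f i)\<^sup>2 \<le> (2 * C + 2 / a j k) * ?Q f" for f :: "nat \<Rightarrow> real"
  proof -
    have "a j k * (f k - f j)\<^sup>2 \<le> (\<Sum>l\<in>I. a j l * (f l - f j)\<^sup>2)"
      using \<open>finite I\<close> jk a by (intro member_le_sum) auto
    also have "\<dots> \<le> ?Q f"
      using \<open>finite I\<close> jk a by (intro member_le_sum[of j I "\<lambda>i. \<Sum>j\<in>I. a i j * (f j - f i)\<^sup>2"] sum_nonneg) auto
    finally have "(f k - f j)\<^sup>2 \<le> ?Q f / a j k" using jk by (simp add: field_simps)
    moreover have "(f k - f i)\<^sup>2 \<le> 2 * (f j - f i)\<^sup>2 + 2 * (f k - f j)\<^sup>2"
    proof -
      have "0 \<le> ((f j - f i) - (f k - f j))\<^sup>2" by simp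
      then show ?thesis by (simp add: power2_eq_square algebra_simps)
    qed
    ultimately show ?thesis using C(2)[of f] by (simp add: distrib_right)
  qed
  moreover have "2 * C + 2 / a j k \<ge> 0" using C(1) jk by simp
  ultimately show ?case by blast
qed

text \<open>f i - \<theta> is the average of the differences f i - f k, each bounded along a path.
  The constant depends on the graph without control, which is harmless at fixed n; adding 1 makes it
  positive.\<close>

lemma dirichlet_poincare:
  fixes a :: "nat \<Rightarrow> nat \<Rightarrow> real"
  assumes "finite I" and a: "\<And>i j. 0 \<le> a i j"
    and conn: "\<And>i k. i \<in> I \<Longrightarrow> k \<in> I \<Longrightarrow> (i, k) \<in> {(i, j). i \<in> I \<and> j \<in> I \<and> 0 < a i j}\<^sup>*"
  shows "\<exists>C>0. \<forall>f::nat \<Rightarrow> real. \<forall>\<theta>. sum f I = real (card I) * \<theta> \<longrightarrow>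
    (\<Sum>i\<in>I. (f i - \<theta>)\<^sup>2) \<le> C * (\<Sum>i\<in>I. \<Sum>j\<in>I. a i j * (f j - f i)\<^sup>2)"
proof -
  let ?Q = "\<lambda>f::nat \<Rightarrow> real. \<Sum>i\<in>I. \<Sum>j\<in>I. a i j * (f j - f i)\<^sup>2"
  have Q0: "0 \<le> ?Q f" for f using a by (intro sum_nonneg) auto
  define c where "c i k = (SOME C. 0 \<le> C \<and> (\<forall>f::nat \<Rightarrow> real. (f k - f i)\<^sup>2 \<le> C * ?Q f))" for i k
  have c: "0 \<le> c i k \<and> (\<forall>f. (f k - f i)\<^sup>2 \<le> c i k * ?Q f)" if "i \<in> I" "k \<in> I" for i k
    unfolding c_def by (rule someI_ex, rule dirichlet_connected_bound[OF assms(1) a conn[OF that]])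
  then have c0: "\<And>i k. i \<in> I \<Longrightarrow> k \<in> I \<Longrightarrow> 0 \<le> c i k" by blast
  define D where "D = (\<Sum>i\<in>I. \<Sum>k\<in>I. c i k)"
  have D0: "0 \<le> D" unfolding D_def by (intro sum_nonneg c0)
  have cD: "c i k \<le> D" if "i \<in> I" "k \<in> I" for i k
  proof -
    have "c i k \<le> (\<Sum>k\<in>I. c i k)" using that c0 \<open>finite I\<close> by (intro member_le_sum) auto
    also have "\<dots> \<le> D" unfolding D_def using that c0 \<open>finite I\<close>
      by (intro member_le_sum[of i I "\<lambda>i. \<Sum>k\<in>I. c i k"] sum_nonneg) auto
    finally show ?thesis .
  qed
  have "(\<Sum>i\<in>I. (f i - \<theta>)\<^sup>2) \<le> (real (card I) * D + 1) * ?Q f"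
    if \<theta>: "sum f I = real (card I) * \<theta>" for f :: "nat \<Rightarrow> real" and \<theta>
  proof -
    have pt: "(f i - \<theta>)\<^sup>2 \<le> D * ?Q f" if i: "i \<in> I" for i
    proof -
      have N: "0 < real (card I)" using i \<open>finite I\<close> by (auto simp: card_gt_0_iff)
      have "real (card I) * (f i - \<theta>) = (\<Sum>k\<in>I. f i - f k)"
        using \<theta> by (simp add: sum_subtractf algebra_simps)
      also have "\<bar>\<dots>\<bar> \<le> (\<Sum>k\<in>I. sqrt (D * ?Q f))"
      proof (rule order_trans[OF sum_abs sum_mono])
        fix k assume k: "k \<in> I"
        have "(f i - f k)\<^sup>2 = (f k - f i)\<^sup>2" by (rule power2_commute)
        also have "\<dots> \<le> c i k * ?Q f" using c[OF i k] by blast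
        also have "\<dots> \<le> D * ?Q f" using cD[OF i k] Q0 by (intro mult_right_mono) auto
        finally have "sqrt ((f i - f k)\<^sup>2) \<le> sqrt (D * ?Q f)" by (rule real_sqrt_le_mono)
        then show "\<bar>f i - f k\<bar> \<le> sqrt (D * ?Q f)" by simp
      qed
      also have "\<dots> = real (card I) * sqrt (D * ?Q f)" by simp
      finally have "\<bar>f i - \<theta>\<bar> \<le> sqrt (D * ?Q f)" using N by (simp add: abs_mult)
      then have "\<bar>f i - \<theta>\<bar>\<^sup>2 \<le> (sqrt (D * ?Q f))\<^sup>2" by (intro power_mono) auto
      then show ?thesis using D0 Q0 by simp
    qed
    have "(\<Sum>i\<in>I. (f i - \<theta>)\<^sup>2) \<le> (\<Sum>i\<in>I. D * ?Q f)" by (intro sum_mono pt)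
    also have "\<dots> = real (card I) * D * ?Q f" by simp
    also have "\<dots> \<le> (real (card I) * D + 1) * ?Q f" using Q0 by (intro mult_right_mono) auto
    finally show ?thesis .
  qed
  moreover have "real (card I) * D + 1 > 0" using D0 by (simp add: add_nonneg_pos)
  ultimately show ?thesis by blast
qed

section \<open>Decay of the variance of the phases\<close>

lemma abs_sin_minus_le: "\<bar>sin x - x\<bar> \<le> \<bar>x\<bar> ^ 3 / 6" for x :: real
  using Maclaurin_sin_bound[of x 3] by (simp add: eval_nat_numeral sin_coeff_def fact_numeral field_simps)

lemma mult_sin_ge:
  fixes x :: real
  assumes "\<bar>x\<bar> \<le> 1"
  shows "x\<^sup>2 / 2 \<le> x * sin x"
proof -
  have pos: "y\<^sup>2 / 2 \<le> y * sin y" if y: "0 \<le> y" "y \<le> 1" for y :: real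
  proof -
    have "\<bar>sin y - y\<bar> \<le> y ^ 3 / 6" using abs_sin_minus_le[of y] y by simp
    then have "y - y ^ 3 / 6 \<le> sin y" by linarith
    moreover have "y ^ 3 / 6 \<le> y / 2"
    proof -
      have "y ^ 3 \<le> y * 1" using y by (simp add: power3_eq_cube mult_le_one mult.assoc mult_left_le)
      then show ?thesis using y by simp
    qed
    ultimately have "y / 2 \<le> sin y" by linarith
    then have "y * (y / 2) \<le> y * sin y" using y by (intro mult_left_mono)
    then show ?thesis by (simp add: power2_eq_square)
  qed
  show ?thesis
  proof (cases "x \<ge> 0")
    case True
    then show ?thesis using pos[of x] assms by simp
  next
    case False
    then show ?thesis using pos[of "- x"] assms by simp
  qed
qed

text \<open>The mean phase is conserved by symmetry of the coupling, and the variance is a Lyapunov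
  function that decays exponentially by the Poincare inequality of the connected graph.\<close>

lemma kuramoto_sync:
  fixes u :: "real \<Rightarrow> nat \<Rightarrow> real" and a :: "nat \<Rightarrow> nat \<Rightarrow> real"
  assumes "finite I"
    and a_nonneg: "\<And>i j. 0 \<le> a i j" and a_sym: "\<And>i j. a i j = a j i"
    and conn: "\<And>i k. i \<in> I \<Longrightarrow> k \<in> I \<Longrightarrow> (i, k) \<in> {(i, j). i \<in> I \<and> j \<in> I \<and> 0 < a i j}\<^sup>*"
    and der_u: "\<And>t i. i \<in> I \<Longrightarrow> t0 \<le> t \<Longrightarrow> ((\<lambda>t. u t i) has_real_derivative
      (\<Sum>j\<in>I - {i}. a i j * sin (u t j - u t i))) (at t)"
    and close: "\<And>t i j. i \<in> I \<Longrightarrow> j \<in> I \<Longrightarrow> t0 \<le> t \<Longrightarrow> \<bar>u t j - u t i\<bar> \<le> 1"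
  shows "\<exists>\<theta>. \<forall>i\<in>I. ((\<lambda>t. u t i) \<longlongrightarrow> \<theta>) at_top"
proof (cases "I = {}")
  case False
  define s where "s t i j = a i j * sin (u t j - u t i)" for t i j
  have s_anti: "s t j i = - s t i j" for t i j
    using sin_minus[of "u t j - u t i"] a_sym[of i j] by (simp add: s_def)
  have der: "((\<lambda>t. u t i) has_real_derivative (\<Sum>j\<in>I. s t i j)) (at t)" if "i \<in> I" "t0 \<le> t" for i t
    using der_u[OF that] sum.remove[OF \<open>finite I\<close> that(1), of "s t i"] by (simp add: s_def)
  have sum0: "(\<Sum>i\<in>I. \<Sum>j\<in>I. s t i j) = 0" for t
  proof -
    have "(\<Sum>i\<in>I. \<Sum>j\<in>I. s t i j) = (\<Sum>j\<in>I. \<Sum>i\<in>I. s t i j)" by (rule sum.swap)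
    also have "\<dots> = - (\<Sum>i\<in>I. \<Sum>j\<in>I. s t i j)"
      by (subst s_anti) (simp add: sum_negf)
    finally show ?thesis by simp
  qed
  define N where "N = real (card I)"
  have N: "N > 0" using False \<open>finite I\<close> by (simp add: N_def card_gt_0_iff)
  define \<theta> where "\<theta> = (\<Sum>i\<in>I. u t0 i) / N"
  have dmean: "((\<lambda>t. \<Sum>i\<in>I. u t i) has_real_derivative 0) (at t)" if "t0 \<le> t" for t
  proof -
    have "((\<lambda>t. \<Sum>i\<in>I. u t i) has_real_derivative (\<Sum>i\<in>I. \<Sum>j\<in>I. s t i j)) (at t)"
      by (rule DERIV_sum) (rule der[OF _ that])
    then show ?thesis by (simp add: sum0)
  qed
  have mean: "(\<Sum>i\<in>I. u t i) = N * \<theta>" if "t0 \<le> t" for t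
  proof -
    have "(\<Sum>i\<in>I. u t0 i) \<le> (\<Sum>i\<in>I. u t i)"
      using that dmean by (intro DERIV_nonneg_imp_nondecreasing[of t0 t "\<lambda>t. \<Sum>i\<in>I. u t i"]) auto
    moreover have "(\<Sum>i\<in>I. u t i) \<le> (\<Sum>i\<in>I. u t0 i)"
      using that dmean by (intro DERIV_nonpos_imp_nonincreasing[of t0 t "\<lambda>t. \<Sum>i\<in>I. u t i"]) auto
    ultimately show ?thesis using N by (simp add: \<theta>_def)
  qed
  obtain C where C: "C > 0" "\<And>f \<theta>. sum f I = N * \<theta> \<Longrightarrow>
    (\<Sum>i\<in>I. (f i - \<theta>)\<^sup>2) \<le> C * (\<Sum>i\<in>I. \<Sum>j\<in>I. a i j * (f j - f i)\<^sup>2)"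
    using dirichlet_poincare[OF \<open>finite I\<close> a_nonneg conn] unfolding N_def by blast
  define V where "V t = (\<Sum>i\<in>I. (u t i - \<theta>)\<^sup>2)" for t
  define V' where "V' t = (\<Sum>i\<in>I. 2 * (u t i - \<theta>) * (\<Sum>j\<in>I. s t i j))" for t
  have dV: "(V has_real_derivative V' t) (at t)" if "t0 \<le> t" for t
    unfolding V_def V'_def
    by (rule DERIV_sum) (auto intro!: derivative_eq_intros der that)
  have decay: "V' t \<le> - (1 / (2 * C)) * V t" if t: "t0 \<le> t" for t
  proof -
    have swap: "(\<Sum>i\<in>I. \<Sum>j\<in>I. (u t i - \<theta>) * s t i j) = - (\<Sum>i\<in>I. \<Sum>j\<in>I. (u t j - \<theta>) * s t i j)"
    proof -
      have "(\<Sum>i\<in>I. \<Sum>j\<in>I. (u t i - \<theta>) * s t i j) = (\<Sum>j\<in>I. \<Sum>i\<in>I. (u t i - \<theta>) * s t i j)" by (rule sum.swap)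
      also have "\<dots> = - (\<Sum>i\<in>I. \<Sum>j\<in>I. (u t j - \<theta>) * s t i j)"
        by (subst s_anti) (simp add: sum_negf)
      finally show ?thesis .
    qed
    have "V' t = 2 * (\<Sum>i\<in>I. \<Sum>j\<in>I. (u t i - \<theta>) * s t i j)"
      unfolding V'_def sum_distrib_left by (intro sum.cong refl) (simp only: mult.assoc)
    also have "\<dots> = (\<Sum>i\<in>I. \<Sum>j\<in>I. (u t i - \<theta>) * s t i j) - (\<Sum>i\<in>I. \<Sum>j\<in>I. (u t j - \<theta>) * s t i j)"
      using swap by simp
    also have "\<dots> = - (\<Sum>i\<in>I. \<Sum>j\<in>I. a i j * ((u t j - u t i) * sin (u t j - u t i)))"
      by (simp add: s_def algebra_simps flip: sum_subtractf sum_negf)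
    also have "\<dots> \<le> - (\<Sum>i\<in>I. \<Sum>j\<in>I. a i j * ((u t j - u t i)\<^sup>2 / 2))"
      unfolding neg_le_iff_le
      by (intro sum_mono mult_left_mono mult_sin_ge close t a_nonneg)
    also have "\<dots> = - (1 / 2) * (\<Sum>i\<in>I. \<Sum>j\<in>I. a i j * (u t j - u t i)\<^sup>2)"
      by (simp add: sum_divide_distrib)
    also have "\<dots> \<le> - (1 / 2) * (V t / C)"
      using C(2)[of "u t" \<theta>] mean[OF t] C(1) unfolding V_def
      by (intro mult_left_mono_neg) (auto simp: field_simps)
    finally show ?thesis by simp
  qed
  define \<kappa> where "\<kappa> = 1 / (2 * C)"
  have \<kappa>: "\<kappa> > 0" using C(1) by (simp add: \<kappa>_def)
  have Vbound: "V t \<le> exp (\<kappa> * (t0 - t)) * V t0" if "t0 \<le> t" for t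
  proof -
    have "exp (\<kappa> * t) * V t \<le> exp (\<kappa> * t0) * V t0"
    proof (rule DERIV_nonpos_imp_nonincreasing[OF that, of "\<lambda>t. exp (\<kappa> * t) * V t"])
      fix r assume r: "t0 \<le> r"
      have "((\<lambda>t. exp (\<kappa> * t) * V t) has_real_derivative exp (\<kappa> * r) * (\<kappa> * V r + V' r)) (at r)"
        by (auto intro!: derivative_eq_intros dV[OF r] simp: algebra_simps)
      moreover have "exp (\<kappa> * r) * (\<kappa> * V r + V' r) \<le> 0"
        using decay[OF r] by (simp add: mult_le_0_iff \<kappa>_def)
      ultimately show "\<exists>y. ((\<lambda>t. exp (\<kappa> * t) * V t) has_real_derivative y) (at r) \<and> y \<le> 0" by blast
    qed
    then have "exp (- (\<kappa> * t)) * (exp (\<kappa> * t) * V t) \<le> exp (- (\<kappa> * t)) * (exp (\<kappa> * t0) * V t0)"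
      by (intro mult_left_mono) auto
    then show ?thesis by (simp add: exp_diff exp_minus field_simps)
  qed
  have lim: "((\<lambda>t. sqrt (exp (\<kappa> * (t0 - t)) * V t0)) \<longlongrightarrow> 0) at_top"
  proof -
    have "((\<lambda>t. exp (\<kappa> * (t0 - t)) * V t0) \<longlongrightarrow> 0) at_top"
      using \<kappa> by real_asymp
    from tendsto_real_sqrt[OF this] show ?thesis by simp
  qed
  show ?thesis
  proof (intro exI[of _ \<theta>] ballI)
    fix i assume i: "i \<in> I"
    have "((\<lambda>t. u t i - \<theta>) \<longlongrightarrow> 0) at_top"
    proof (rule Lim_null_comparison[OF _ lim])
      show "\<forall>\<^sub>F t in at_top. norm (u t i - \<theta>) \<le> sqrt (exp (\<kappa> * (t0 - t)) * V t0)"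
        using eventually_ge_at_top[of t0]
      proof eventually_elim
        case (elim t)
        have "(u t i - \<theta>)\<^sup>2 \<le> V t"
          unfolding V_def using \<open>finite I\<close> i by (intro member_le_sum) auto
        also note Vbound[OF elim]
        finally have "sqrt ((u t i - \<theta>)\<^sup>2) \<le> sqrt (exp (\<kappa> * (t0 - t)) * V t0)"
          by (rule real_sqrt_le_mono)
        then show ?case by simp
      qed
    qed
    then show "((\<lambda>t. u t i) \<longlongrightarrow> \<theta>) at_top" by (simp add: LIM_zero_iff)
  qed
qed simp

section \<open>Existence of solutions\<close>

lemma integral_exp_from_0:
  fixes c \<tau> :: real
  assumes "c > 0" "0 \<le> \<tau>"
  shows "((\<lambda>s. exp (c * s)) has_integral (exp (c * \<tau>) - 1) / c) {0..\<tau>}"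
proof -
  have "((\<lambda>s. exp (c * s)) has_integral exp (c * \<tau>) / c - exp (c * 0) / c) {0..\<tau>}"
    using assms
    by (intro fundamental_theorem_of_calculus)
      (auto intro!: derivative_eq_intros simp flip: has_real_derivative_iff_has_vector_derivative)
  then show ?thesis by (simp add: diff_divide_distrib)
qed

text \<open>Weighting by \<open>exp (- 2 L t)\<close> turns the Picard operator into a contraction on the bounded
  continuous functions, which gives a global solution at once.\<close>

lemma picard_global:
  fixes F :: "'a::banach \<Rightarrow> 'a"
  assumes L: "L > 0" and lip: "\<And>x y. norm (F x - F y) \<le> L * norm (x - y)"
    and bound: "\<And>x. norm (F x) \<le> A"
  shows "\<exists>u. u 0 = v \<and> (\<forall>t\<ge>0. (u has_vector_derivative F (u t)) (at t within {0..}))"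
proof -
  define c where "c = 2 * L"
  have c: "c > 0" using L by (simp add: c_def)
  have contF: "continuous_on UNIV F"
  proof (rule lipschitz_on_continuous_on)
    show "L-lipschitz_on UNIV F" using lip L by (intro lipschitz_onI) (auto simp: dist_norm)
  qed
  \<comment> \<open>The fixed point g represents the solution multiplied by exp (- c s), which is
    bounded; the factor here restores the solution before F is applied.\<close>
  define f where "f g s = F (exp (c * s) *\<^sub>R apply_bcontfun g s)" for g :: "real \<Rightarrow>\<^sub>C 'a" and s
  define J where "J g t = integral {0..t} (f g)" for g t
  \<comment> \<open>The clamp continues the function constantly to negative times, so that it is
    bounded and continuous on the whole line.\<close>
  define H where "H g t = exp (- c * max 0 t) *\<^sub>R (v + J g (max 0 t))" for g t
  have contf: "continuous_on S (f g)" for g S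
  proof -
    have "continuous_on S (\<lambda>s. exp (c * s) *\<^sub>R apply_bcontfun g s)"
      by (intro continuous_intros) auto
    then show ?thesis unfolding f_def by (rule continuous_on_compose2[OF contF]) auto
  qed
  have intf: "f g integrable_on {0..t}" for g t by (rule integrable_continuous_real[OF contf])
  have derJ: "(J g has_vector_derivative f g t) (at t within {0..})" if "0 \<le> t" for g t
  proof -
    have "(J g has_vector_derivative f g t) (at t within {0..t + 1})"
      unfolding J_def by (rule integral_has_vector_derivative[OF contf]) (use that in auto)
    also have "at t within {0..t + 1} = at t within {0..}"
      by (rule at_within_nhd[of t "{..<t + 1}"]) auto
    finally show ?thesis .
  qed
  have contJ: "continuous_on {0..} (J g)" for g
    unfolding continuous_on_eq_continuous_within
    using derJ has_vector_derivative_continuous by fastforce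
  have contH: "continuous_on UNIV (H g)" for g
    unfolding H_def
    by (intro continuous_intros continuous_on_compose2[OF contJ]) auto
  have boundH: "norm (H g t) \<le> norm v + A / c" for g t
  proof -
    define \<tau> where "\<tau> = max 0 t"
    have \<tau>: "0 \<le> \<tau>" by (simp add: \<tau>_def)
    have A: "0 \<le> A" using bound[of 0] norm_ge_zero order_trans by blast
    have "norm (J g \<tau>) \<le> A * (\<tau> - 0)"
      unfolding J_def using \<tau> A bound intf by (intro integral_bound[OF \<tau> contf]) (simp add: f_def)
    also have "\<dots> \<le> A * (exp (c * \<tau>) / c)"
    proof (rule mult_left_mono[OF _ A])
      have "c * \<tau> \<le> exp (c * \<tau>)" using exp_ge_add_one_self[of "c * \<tau>"] by linarith
      then show "\<tau> - 0 \<le> exp (c * \<tau>) / c" using c by (simp add: field_simps)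
    qed
    finally have "exp (- c * \<tau>) * norm (J g \<tau>) \<le> exp (- c * \<tau>) * (A * (exp (c * \<tau>) / c))"
      by (intro mult_left_mono) auto
    also have "\<dots> = A / c" by (simp add: exp_minus field_simps)
    finally have 1: "exp (- c * \<tau>) * norm (J g \<tau>) \<le> A / c" .
    have 2: "exp (- c * \<tau>) * norm v \<le> 1 * norm v"
      using \<tau> c by (intro mult_right_mono) auto
    have "norm (H g t) \<le> exp (- c * \<tau>) * (norm v + norm (J g \<tau>))"
      unfolding H_def \<tau>_def[symmetric] by (simp add: norm_triangle_ineq)
    with 1 2 show ?thesis by (simp add: distrib_left)
  qed
  define \<Phi> where "\<Phi> g = Bcontfun (H g)" for g
  have app: "apply_bcontfun (\<Phi> g) = H g" for g
    unfolding \<Phi>_def by (intro Bcontfun_inverse bcontfun_normI[OF contH boundH])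
  have "dist (\<Phi> g) (\<Phi> h) \<le> 1 / 2 * dist g h" for g h
  proof -
    have "norm (apply_bcontfun (\<Phi> g - \<Phi> h) t) \<le> 1 / 2 * dist g h" for t
    proof -
      define \<tau> where "\<tau> = max 0 t"
      have \<tau>: "0 \<le> \<tau>" by (simp add: \<tau>_def)
      define d where "d = dist g h"
      have d: "0 \<le> d" by (simp add: d_def)
      have "norm (J g \<tau> - J h \<tau>) = norm (integral {0..\<tau>} (\<lambda>s. f g s - f h s))"
        unfolding J_def by (subst integral_diff) (auto intro: intf)
      also have "\<dots> \<le> integral {0..\<tau>} (\<lambda>s. L * d * exp (c * s))"
      proof (rule integral_norm_bound_integral)
        show "(\<lambda>s. f g s - f h s) integrable_on {0..\<tau>}" by (intro integrable_diff intf)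
        show "(\<lambda>s. L * d * exp (c * s)) integrable_on {0..\<tau>}"
          by (intro integrable_continuous_real continuous_intros)
        fix s
        have "norm (f g s - f h s) \<le> L * norm (exp (c * s) *\<^sub>R apply_bcontfun g s - exp (c * s) *\<^sub>R apply_bcontfun h s)"
          unfolding f_def by (rule lip)
        also have "\<dots> = L * (exp (c * s) * dist (apply_bcontfun g s) (apply_bcontfun h s))"
          by (simp add: dist_norm flip: scaleR_diff_right)
        also have "\<dots> \<le> L * (exp (c * s) * d)"
          unfolding d_def using L by (intro mult_left_mono dist_bounded) auto
        finally show "norm (f g s - f h s) \<le> L * d * exp (c * s)" by (simp add: mult_ac)
      qed
      also have "\<dots> = L * d * ((exp (c * \<tau>) - 1) / c)"
        using integral_unique[OF integral_exp_from_0[OF c \<tau>]] by simp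
      also have "\<dots> \<le> L * d * (exp (c * \<tau>) / c)"
        using L d c by (intro mult_left_mono divide_right_mono) auto
      \<comment> \<open>With c = 2 L the contraction factor is 1/2.\<close>
      also have "\<dots> = d / 2 * exp (c * \<tau>)" using L by (simp add: c_def)
      finally have "exp (- c * \<tau>) * norm (J g \<tau> - J h \<tau>) \<le> exp (- c * \<tau>) * (d / 2 * exp (c * \<tau>))"
        by (intro mult_left_mono) auto
      also have "\<dots> = d / 2" by (simp add: exp_minus field_simps)
      finally show ?thesis
        by (simp add: app H_def \<tau>_def[symmetric] d_def flip: scaleR_diff_right)
    qed
    then show ?thesis unfolding dist_norm[of "\<Phi> g"] by (rule norm_bound)
  qed
  then obtain g where g: "\<Phi> g = g"
    using banach_fix_type[of "1/2" \<Phi>] by auto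
  define u where "u t = v + J g t" for t
  have u_eq: "exp (c * t) *\<^sub>R apply_bcontfun g t = u t" if "0 \<le> t" for t
  proof -
    have "apply_bcontfun g t = H g t" using app[of g] g by simp
    then show ?thesis using that by (simp add: H_def u_def flip: exp_add)
  qed
  have "(u has_vector_derivative F (u t)) (at t within {0..})" if "0 \<le> t" for t
  proof -
    have "(u has_vector_derivative 0 + f g t) (at t within {0..})"
      unfolding u_def using derJ[OF that] by (intro has_vector_derivative_add has_vector_derivative_const)
    then show ?thesis by (simp add: f_def u_eq[OF that])
  qed
  moreover have "u 0 = v" by (simp add: u_def J_def)
  ultimately show ?thesis by blast
qed

text \<open>Admits bounded continuous functions as the state space of
  \<open>picard_global\<close>.\<close>

instance bcontfun :: (metric_space, banach) banach ..

lemma abs_sin_diff_le: "\<bar>sin x - sin y\<bar> \<le> \<bar>x - y\<bar>" for x y :: real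
proof -
  have "\<bar>sin x - sin y\<bar> = 2 * (\<bar>sin ((x - y) / 2)\<bar> * \<bar>cos ((x + y) / 2)\<bar>)"
    by (simp add: sin_diff_sin abs_mult)
  also have "\<dots> \<le> 2 * (\<bar>(x - y) / 2\<bar> * 1)"
    by (intro mult_left_mono mult_mono abs_sin_x_le_abs_x) auto
  finally show ?thesis by simp
qed

text \<open>The sine is bounded and Lipschitz, hence so is the whole vector field in the sup norm.
  Coordinates outside I are given zero velocity.\<close>

lemma kuramoto_exists:
  fixes a :: "nat \<Rightarrow> nat \<Rightarrow> real" and v :: "nat \<Rightarrow> real"
  assumes "finite I"
  shows "\<exists>u. \<forall>i\<in>I. u 0 i = v i \<and> continuous_on {0..} (\<lambda>t. u t i) \<and>
    (\<forall>t>0. ((\<lambda>t. u t i) has_real_derivative (\<Sum>j\<in>I - {i}. a i j * sin (u t j - u t i))) (at t))"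
proof -
  define G where "G x i = (if i \<in> I then \<Sum>j\<in>I - {i}. a i j * sin (x j - x i) else 0)" for x :: "nat \<Rightarrow> real" and i
  define A where "A = 1 + (\<Sum>i\<in>I. \<Sum>j\<in>I. \<bar>a i j\<bar>)"
  have A: "A > 0" unfolding A_def by (intro add_pos_nonneg sum_nonneg) auto
  have row: "(\<Sum>j\<in>I - {i}. \<bar>a i j\<bar>) \<le> A" if "i \<in> I" for i
  proof -
    have "(\<Sum>j\<in>I - {i}. \<bar>a i j\<bar>) \<le> (\<Sum>j\<in>I. \<bar>a i j\<bar>)"
      using \<open>finite I\<close> by (intro sum_mono2) auto
    also have "\<dots> \<le> (\<Sum>i\<in>I. \<Sum>j\<in>I. \<bar>a i j\<bar>)"
      using \<open>finite I\<close> that by (intro member_le_sum[of i I "\<lambda>i. \<Sum>j\<in>I. \<bar>a i j\<bar>"] sum_nonneg) auto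
    finally show ?thesis by (simp add: A_def)
  qed
  have G_bound: "\<bar>G x i\<bar> \<le> A" for x i
  proof (cases "i \<in> I")
    case True
    have "\<bar>\<Sum>j\<in>I - {i}. a i j * sin (x j - x i)\<bar> \<le> (\<Sum>j\<in>I - {i}. \<bar>a i j\<bar>)"
      by (rule order_trans[OF sum_abs sum_mono]) (simp add: abs_mult mult_left_le)
    with row[OF True] True show ?thesis by (simp add: G_def)
  qed (use A in \<open>simp add: G_def\<close>)
  have G_lip: "\<bar>G x i - G y i\<bar> \<le> 2 * A * d" if d: "\<And>j. \<bar>x j - y j\<bar> \<le> d" for x y i d
  proof (cases "i \<in> I")
    case True
    have d0: "0 \<le> d" using d[of 0] by linarith
    have "G x i - G y i = (\<Sum>j\<in>I - {i}. a i j * (sin (x j - x i) - sin (y j - y i)))"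
      using True by (simp add: G_def sum_subtractf right_diff_distrib)
    also have "\<bar>\<dots>\<bar> \<le> (\<Sum>j\<in>I - {i}. \<bar>a i j\<bar> * (2 * d))"
    proof (rule order_trans[OF sum_abs sum_mono])
      fix j
      have "\<bar>sin (x j - x i) - sin (y j - y i)\<bar> \<le> 2 * d"
        using abs_sin_diff_le[of "x j - x i" "y j - y i"] d[of j] d[of i] by linarith
      then show "\<bar>a i j * (sin (x j - x i) - sin (y j - y i))\<bar> \<le> \<bar>a i j\<bar> * (2 * d)"
        unfolding abs_mult by (intro mult_left_mono) auto
    qed
    also have "\<dots> = (\<Sum>j\<in>I - {i}. \<bar>a i j\<bar>) * (2 * d)" by (simp add: sum_distrib_right)
    also have "\<dots> \<le> A * (2 * d)" using row[OF True] d0 by (intro mult_right_mono) auto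
    finally show ?thesis by (simp add: mult_ac)
  next
    case False
    have d0: "0 \<le> d" using d[of 0] by linarith
    with False A show ?thesis by (simp add: G_def)
  qed
  \<comment> \<open>One Banach space serves every finite index set: bounded functions on the
    naturals with the discrete topology, for which continuity is automatic.\<close>
  define F :: "(nat discrete \<Rightarrow>\<^sub>C real) \<Rightarrow> (nat discrete \<Rightarrow>\<^sub>C real)" where "F x = Bcontfun (\<lambda>i. G (\<lambda>j. apply_bcontfun x (discrete j)) (of_discrete i))" for x
  have cont_nat: "continuous_on UNIV (h :: nat discrete \<Rightarrow> real)" for h
    by (simp add: continuous_on_open_vimage open_discrete)
  have F: "apply_bcontfun (F x) i = G (\<lambda>j. apply_bcontfun x (discrete j)) (of_discrete i)" for x i
    unfolding F_def using G_bound by (subst Bcontfun_inverse) (auto intro!: bcontfun_normI cont_nat)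
  define v' :: "nat discrete \<Rightarrow>\<^sub>C real" where "v' = Bcontfun (\<lambda>i. if of_discrete i \<in> I then v (of_discrete i) else 0)"
  have v': "apply_bcontfun v' (discrete i) = v i" if "i \<in> I" for i
  proof -
    have "\<bar>if i \<in> I then v i else 0\<bar> \<le> (\<Sum>i\<in>I. \<bar>v i\<bar>)" for i
      using \<open>finite I\<close> by (auto intro!: member_le_sum[of i I "\<lambda>i. \<bar>v i\<bar>"] sum_nonneg)
    then have "apply_bcontfun v' = (\<lambda>i. if of_discrete i \<in> I then v (of_discrete i) else 0)"
      unfolding v'_def
      by (intro Bcontfun_inverse bcontfun_normI[OF cont_nat, where b = "\<Sum>i\<in>I. \<bar>v i\<bar>"]) simp
    then show ?thesis using that by (simp add: discrete_inverse)
  qed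
  have "\<exists>u. u 0 = v' \<and> (\<forall>t\<ge>0. (u has_vector_derivative F (u t)) (at t within {0..}))"
  proof (rule picard_global[where F = F and L = "2 * A" and A = A])
    show "2 * A > 0" using A by simp
    show "norm (F x) \<le> A" for x using G_bound by (intro norm_bound) (simp add: F)
    show "norm (F x - F y) \<le> 2 * A * norm (x - y)" for x y
    proof (rule norm_bound)
      fix i
      have "\<bar>apply_bcontfun x (discrete j) - apply_bcontfun y (discrete j)\<bar> \<le> norm (x - y)" for j
        using norm_bounded[of "x - y" "discrete j"] by simp
      then show "norm (apply_bcontfun (F x - F y) i) \<le> 2 * A * norm (x - y)"
        using G_lip by (simp add: F)
    qed
  qed
  then obtain U where U: "U 0 = v'" "\<And>t. t \<ge> 0 \<Longrightarrow> (U has_vector_derivative F (U t)) (at t within {0..})"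
    by blast
  have ev: "bounded_linear (\<lambda>x::nat discrete \<Rightarrow>\<^sub>C real. apply_bcontfun x (discrete i))" for i
  proof (rule bounded_linear_intro[where K = 1])
    show "norm (apply_bcontfun x (discrete i)) \<le> norm x * 1" for x :: "nat discrete \<Rightarrow>\<^sub>C real"
      using norm_bounded[of x "discrete i"] by simp
  qed simp_all
  have der: "((\<lambda>t. apply_bcontfun (U t) (discrete i)) has_real_derivative G (\<lambda>j. apply_bcontfun (U t) (discrete j)) i) (at t within {0..})"
    if "0 \<le> t" for t i
    using bounded_linear.has_vector_derivative[OF ev U(2)[OF that], of i]
    by (simp add: has_real_derivative_iff_has_vector_derivative F discrete_inverse)
  show ?thesis
  proof (intro exI[of _ "\<lambda>t i. apply_bcontfun (U t) (discrete i)"] ballI conjI allI impI)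
    fix i assume i: "i \<in> I"
    show "apply_bcontfun (U 0) (discrete i) = v i" using U(1) v' i by simp
    show "continuous_on {0..} (\<lambda>t. apply_bcontfun (U t) (discrete i))"
      using der by (intro DERIV_continuous_on) auto
    fix t :: real assume t: "0 < t"
    have "at t within {0..} = at t"
      using t by (intro at_within_interior) (simp add: interior_real_atLeast)
    then show "((\<lambda>t. apply_bcontfun (U t) (discrete i)) has_real_derivative
      (\<Sum>j\<in>I - {i}. a i j * sin (apply_bcontfun (U t) (discrete j) - apply_bcontfun (U t) (discrete i)))) (at t)"
      using der[of t i] t i by (simp add: G_def)
  qed
qed

section \<open>The random geometric graph\<close>

text \<open>Both alternatives for the kernel provide the same data; \<open>k\<close> is a minimum
  over the compact interval [0, 1/2] for a smooth kernel and 1 for the indicator.\<close>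

lemma rgg_kernel_facts:
  assumes "rgg_kernel K"
  shows "\<exists>B k. 0 < k \<and> (\<lambda>s. K (max 0 s)) \<in> borel_measurable borel \<and> (\<forall>r\<ge>0. 0 \<le> K r \<and> K r \<le> B) \<and>
    (\<forall>r>1. K r = 0) \<and> (\<forall>r. 0 \<le> r \<longrightarrow> r < 1 \<longrightarrow> 0 < K r) \<and> (\<forall>r. 0 \<le> r \<longrightarrow> r \<le> 1 / 2 \<longrightarrow> k \<le> K r)"
proof -
  have nonneg: "\<And>r. 0 \<le> r \<Longrightarrow> 0 \<le> K r" and bdd: "bounded (K ` {0..})"
    and supp: "closure {r. 0 \<le> r \<and> K r \<noteq> 0} \<subseteq> {0..1}"
    and pos: "\<And>r. 0 \<le> r \<Longrightarrow> r < 1 \<Longrightarrow> 0 < K r"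
    and smooth: "(\<exists>K'. \<forall>r\<ge>0. (K has_real_derivative K' r) (at r within {0..})) \<or>
      (\<forall>r\<ge>0. K r = indicator {0..1} r)"
    using assms unfolding rgg_kernel_def by auto
  obtain B where B: "\<And>r. 0 \<le> r \<Longrightarrow> \<bar>K r\<bar> \<le> B"
    using bdd unfolding bounded_iff by auto
  have zero: "K r = 0" if "1 < r" for r
  proof (rule ccontr)
    assume "K r \<noteq> 0"
    then have "r \<in> closure {r. 0 \<le> r \<and> K r \<noteq> 0}"
      using that by (intro subsetD[OF closure_subset]) auto
    with supp that show False by auto
  qed
  have "(\<lambda>s. K (max 0 s)) \<in> borel_measurable borel \<and> (\<exists>k>0. \<forall>r. 0 \<le> r \<longrightarrow> r \<le> 1 / 2 \<longrightarrow> k \<le> K r)"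
    using smooth
  proof
    assume "\<exists>K'. \<forall>r\<ge>0. (K has_real_derivative K' r) (at r within {0..})"
    then have cont: "continuous_on {0..} K"
      by (auto simp: continuous_on_eq_continuous_within intro: DERIV_continuous)
    have "continuous_on UNIV (\<lambda>s. K (max 0 s))"
      by (rule continuous_on_compose2[OF cont]) (auto intro!: continuous_intros)
    then have "(\<lambda>s. K (max 0 s)) \<in> borel_measurable borel"
      by (rule borel_measurable_continuous_onI)
    moreover have "\<exists>x\<in>{0..1 / 2}. \<forall>y\<in>{0..1 / 2}. K x \<le> K y"
      by (rule continuous_attains_inf) (auto intro: continuous_on_subset[OF cont])
    then obtain x where "x \<in> {0..1 / 2}" "\<forall>y\<in>{0..1 / 2}. K x \<le> K y" by blast
    ultimately show ?thesis using pos[of x] by auto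
  next
    assume ind: "\<forall>r\<ge>0. K r = indicator {0..1} r"
    then have "(\<lambda>s. K (max 0 s)) = (\<lambda>s. indicator {0..1} (max 0 s))" by auto
    moreover have "(\<lambda>s::real. indicator {0..1} (max 0 s) :: real) \<in> borel_measurable borel"
      by (rule measurable_compose[where N = borel and g = "indicator {0..1}"]) simp_all
    ultimately show ?thesis using ind by (auto intro!: exI[of _ 1] simp: indicator_def)
  qed
  then obtain k where "k > 0" "\<forall>r. 0 \<le> r \<longrightarrow> r \<le> 1 / 2 \<longrightarrow> k \<le> K r"
    "(\<lambda>s. K (max 0 s)) \<in> borel_measurable borel" by blast
  then show ?thesis
    using nonneg B zero pos by (intro exI[of _ B] exI[of _ k]) (auto simp: abs_le_iff)
qed

context kernel_samples begin

text \<open>The case of a single factor in \<open>nn_integral_prod_pairs\<close>: the inner integral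
  is the cap probability, which is the same at almost every x.\<close>

lemma prob_edge:
  assumes "i \<in> {1..n}" "j \<in> {1..n}" "i \<noteq> j"
  shows "prob {\<omega> \<in> space M. (norm (X n i \<omega> - X n j \<omega>))\<^sup>2 < \<epsilon> n} = edge_prob n"
proof -
  define f :: "real^3 \<Rightarrow> real^3 \<Rightarrow> ennreal" where "f x y = indicator {y. (norm (x - y))\<^sup>2 < \<epsilon> n} y" for x y
  have fm: "(\<lambda>(x, y). f x y) \<in> borel_measurable (borel \<Otimes>\<^sub>M borel)"
    unfolding f_def indicator_def by measurable
  have n: "n \<ge> 1" using assms by simp
  note [measurable] = measurable_X[OF assms(1)] measurable_X[OF assms(2)]
  let ?A = "{\<omega> \<in> space M. (norm (X n i \<omega> - X n j \<omega>))\<^sup>2 < \<epsilon> n}"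
  have "emeasure M ?A = (\<integral>\<^sup>+\<omega>. indicator ?A \<omega> \<partial>M)" by simp
  also have "\<dots> = (\<integral>\<^sup>+\<omega>. (\<Prod>j\<in>{j}. f (X n i \<omega>) (X n j \<omega>)) \<partial>M)"
    by (intro nn_integral_cong) (auto simp: f_def indicator_def)
  also have "\<dots> = (\<integral>\<^sup>+x. (\<integral>\<^sup>+y. f x y \<partial>uniform_sphere) ^ card {j} \<partial>uniform_sphere)"
  proof (rule nn_integral_prod_pairs[OF prob_space_axioms _ _ _ _ fm])
    show "indep_vars (\<lambda>_. borel) (X n) (insert i {j})"
      using indep_vars_subset[OF indep[OF n]] assms by auto
    show "distr M borel (X n l) = uniform_sphere" if "l \<in> insert i {j}" for l
      using that assms by (intro distr_X) auto
  qed (use assms in auto)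
  also have "\<dots> = (\<integral>\<^sup>+x. ennreal (edge_prob n) \<partial>uniform_sphere)"
  proof (rule nn_integral_cong_AE)
    show "AE x in uniform_sphere. (\<integral>\<^sup>+y. f x y \<partial>uniform_sphere) ^ card {j} = ennreal (edge_prob n)"
      using AE_uniform_sphere
    proof eventually_elim
      case (elim x)
      then show ?case using edge_prob_eq[of x n] by (simp add: f_def US.emeasure_eq_measure)
    qed
  qed
  also have "\<dots> = ennreal (edge_prob n)" using US.emeasure_space_1 by simp
  finally show ?thesis by (simp add: emeasure_eq_measure edge_prob_def)
qed

lemma expected_degree:
  assumes i: "i \<in> {1..n}"
  shows "expectation (\<lambda>\<omega>. real (rgg_degree (\<epsilon> n) n (\<lambda>j. X n j \<omega>) i)) = mean_degree n"
proof -
  let ?A = "\<lambda>j. {\<omega> \<in> space M. (norm (X n i \<omega> - X n j \<omega>))\<^sup>2 < \<epsilon> n}"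
  have card: "real (card ({Suc 0..n} - {i})) = real n - 1"
    using i by (simp add: of_nat_diff)
  have A: "?A j \<in> sets M" if "j \<in> {1..n}" for j
    using measurable_X[OF i] measurable_X[OF that] by measurable
  have "expectation (\<lambda>\<omega>. real (rgg_degree (\<epsilon> n) n (\<lambda>j. X n j \<omega>) i))
      = expectation (\<lambda>\<omega>. \<Sum>j\<in>{1..n} - {i}. indicator (?A j) \<omega>)"
  proof (rule Bochner_Integration.integral_cong[OF refl])
    fix \<omega> assume "\<omega> \<in> space M"
    then have "(\<Sum>j\<in>{1..n} - {i}. indicator (?A j) \<omega>)
        = (\<Sum>j\<in>{1..n} - {i}. if (norm (X n i \<omega> - X n j \<omega>))\<^sup>2 < \<epsilon> n then 1 else (0::real))"
      by (intro sum.cong) (auto simp: indicator_def)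
    also have "\<dots> = real (card {j \<in> {1..n} - {i}. (norm (X n i \<omega> - X n j \<omega>))\<^sup>2 < \<epsilon> n})"
      by (simp flip: sum.inter_filter)
    also have "{j \<in> {1..n} - {i}. (norm (X n i \<omega> - X n j \<omega>))\<^sup>2 < \<epsilon> n}
        = {j \<in> {1..n}. rgg_edge (\<epsilon> n) (\<lambda>j. X n j \<omega>) i j}"
      by (auto simp: rgg_edge_def)
    finally show "real (rgg_degree (\<epsilon> n) n (\<lambda>j. X n j \<omega>) i) = (\<Sum>j\<in>{1..n} - {i}. indicator (?A j) \<omega>)"
      by (simp add: rgg_degree_def)
  qed
  also have "\<dots> = (\<Sum>j\<in>{1..n} - {i}. expectation (indicator (?A j)))"
    using A by (intro Bochner_Integration.integral_sum integrable_real_indicator) (auto simp: emeasure_eq_measure)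
  also have "\<dots> = (\<Sum>j\<in>{1..n} - {i}. edge_prob n)"
    using A prob_edge[OF i] by (intro sum.cong) (auto simp: Int_absorb2 sets.sets_into_space)
  also have "\<dots> = mean_degree n" by (simp add: mean_degree_def card)
  finally show ?thesis .
qed

text \<open>Every vertex outside the cap \<open>|x - pole|\<^sup>2 < \<epsilon>/4\<close> has a neighbour closer to the pole, and
  the vertices of the cap are mutually adjacent.\<close>

lemma ascent_connected:
  assumes e: "0 < \<epsilon> n" and I: "finite I"
    and ascent: "\<And>i. i \<in> I \<Longrightarrow> \<epsilon> n / 4 \<le> (norm (x i - pole))\<^sup>2 \<Longrightarrow>
      \<exists>j\<in>I. (norm (x i - x j))\<^sup>2 < \<epsilon> n \<and> pole \<bullet> x i < pole \<bullet> x j"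
    and ik: "i \<in> I" "l \<in> I"
  shows "(i, l) \<in> {(i, j). i \<in> I \<and> j \<in> I \<and> (norm (x i - x j))\<^sup>2 < \<epsilon> n}\<^sup>*"
proof -
  let ?E = "{(i, j). i \<in> I \<and> j \<in> I \<and> (norm (x i - x j))\<^sup>2 < \<epsilon> n}"
  have reach: "\<exists>m\<in>I. (i, m) \<in> ?E\<^sup>* \<and> (norm (x m - pole))\<^sup>2 < \<epsilon> n / 4" if i: "i \<in> I" for i
  proof -
    \<comment> \<open>The climb is replaced by a maximum: the highest vertex reachable from i has no
      higher neighbour, so it lies in the cap around the pole.\<close>
    define R where "R = {m \<in> I. (i, m) \<in> ?E\<^sup>*}"
    have R: "finite R" "R \<noteq> {}" using I i by (auto simp: R_def)
    have "Max ((\<lambda>m. pole \<bullet> x m) ` R) \<in> (\<lambda>m. pole \<bullet> x m) ` R" using R by (intro Max_in) auto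
    then obtain m where m: "m \<in> R" "pole \<bullet> x m = Max ((\<lambda>m. pole \<bullet> x m) ` R)" by auto
    have max: "pole \<bullet> x j \<le> pole \<bullet> x m" if "j \<in> R" for j
      unfolding m(2) using R that by (intro Max_ge) auto
    have "(norm (x m - pole))\<^sup>2 < \<epsilon> n / 4"
    proof (rule ccontr)
      assume "\<not> ?thesis"
      then obtain j where j: "j \<in> I" "(norm (x m - x j))\<^sup>2 < \<epsilon> n" "pole \<bullet> x m < pole \<bullet> x j"
        using ascent[of m] m(1) by (auto simp: R_def not_less)
      then have "(m, j) \<in> ?E" using m(1) by (auto simp: R_def)
      then have "j \<in> R" using m(1) j(1) by (auto simp: R_def intro: rtrancl_into_rtrancl)
      from max[OF this] j(3) show False by simp
    qed
    then show ?thesis using m(1) by (auto simp: R_def)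
  qed
  obtain m where m: "m \<in> I" "(i, m) \<in> ?E\<^sup>*" "(norm (x m - pole))\<^sup>2 < \<epsilon> n / 4" using reach ik by blast
  obtain m' where m': "m' \<in> I" "(l, m') \<in> ?E\<^sup>*" "(norm (x m' - pole))\<^sup>2 < \<epsilon> n / 4" using reach ik by blast
  have sym: "sym ?E" by (auto intro!: symI simp: norm_minus_commute)
  \<comment> \<open>The quarter in the cap radius is used here: the squared distance of two vertices
    of the cap is less than 2 (\<epsilon>/4) + 2 (\<epsilon>/4).\<close>
  have "(norm (x m - x m'))\<^sup>2 \<le> (norm (x m - pole) + norm (x m' - pole))\<^sup>2"
    using norm_triangle_ineq4[of "x m - pole" "x m' - pole"] by (intro power_mono) auto
  also have "\<dots> \<le> 2 * (norm (x m - pole))\<^sup>2 + 2 * (norm (x m' - pole))\<^sup>2"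
    using sum_squares_bound[of "norm (x m - pole)" "norm (x m' - pole)"] by (simp add: power2_sum)
  also have "\<dots> < \<epsilon> n" using m(3) m'(3) by linarith
  finally have "(m, m') \<in> ?E" using m(1) m'(1) by simp
  moreover have "(m', l) \<in> ?E\<^sup>*" using m'(2) sym by (meson sym_rtrancl symD)
  ultimately show ?thesis using m(2) by (meson rtrancl_into_rtrancl rtrancl_trans)
qed

end

lemma tendsto_imp_tendsto_mod_2pi:
  assumes "(f \<longlongrightarrow> \<theta>) F"
  shows "tendsto_mod_2pi f \<theta> F"
  unfolding tendsto_mod_2pi_def
proof (intro allI impI)
  fix e :: real assume "e > 0"
  from tendstoD[OF assms this] show "\<forall>\<^sub>F t in F. \<exists>k::int. \<bar>f t - (\<theta> + 2 * pi * of_int k)\<bar> < e"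
    by eventually_elim (auto intro!: exI[of _ 0] simp: dist_real_def)
qed

section \<open>Comparison of the sine coupling with the heat flow\<close>

context kernel_samples begin

text \<open>Along an edge w differs by at most L sqrt \<epsilon>, so one sine errs by
  O(\<epsilon>^(3/2)). The weights add up to O(\<epsilon> n) and the normalization is at least c
  \<epsilon>^2 (n - 1), which leaves O(sqrt \<epsilon>).\<close>

lemma sine_coupling_error:
  assumes e: "0 < \<epsilon> n" "\<epsilon> n \<le> 1" and n: "2 \<le> n" and i: "i \<in> {1..n}" and t: "0 \<le> t" and \<omega>: "\<omega> \<in> space M"
    and L: "L \<ge> 0" "\<And>x y. x \<in> sphere 0 1 \<Longrightarrow> y \<in> sphere 0 1 \<Longrightarrow> \<bar>w t x - w t y\<bar> \<le> L * norm (x - y)"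
    and sums: "(\<Sum>j\<in>{1..n} - {i}. weight n (X n i \<omega>) (X n j \<omega>)) \<le> (B * C + 1) * \<epsilon> n * (real n - 1)"
    and err: "\<bar>heat_error w w' \<omega> n i t\<bar> \<le> \<eta>"
  shows "\<bar>(\<Sum>j\<in>{1..n} - {i}. 1 / (\<epsilon> n * mean_degree n) * weight n (X n i \<omega>) (X n j \<omega>)
      * sin (w t (X n j \<omega>) - w t (X n i \<omega>))) - speed n * w' t (X n i \<omega>)\<bar>
    \<le> \<eta> + (B * C + 1) * L ^ 3 / c * sqrt (\<epsilon> n)"
proof -
  define D where "D = \<epsilon> n * mean_degree n"
  have p: "0 < c * \<epsilon> n" "c * \<epsilon> n \<le> edge_prob n" using edge_prob_bounds(1)[OF e] c_pos e by simp_all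
  have D: "(\<epsilon> n * (real n - 1)) * (c * \<epsilon> n) \<le> D" "0 < (\<epsilon> n * (real n - 1)) * (c * \<epsilon> n)"
    using p e n by (auto simp: D_def mean_degree_def mult.assoc intro!: mult_left_mono mult_pos_pos)
  then have D0: "D > 0" by linarith
  define \<Delta> where "\<Delta> j = w t (X n j \<omega>) - w t (X n i \<omega>)" for j
  define W where "W j = weight n (X n i \<omega>) (X n j \<omega>)" for j
  have W0: "0 \<le> W j" for j by (simp add: W_def weight_nonneg)
  have Xs: "X n j \<omega> \<in> sphere 0 1" if "j \<in> {1..n}" for j using in_sphere[OF that \<omega>] .
  have sin_err: "\<bar>W j * (sin (\<Delta> j) - \<Delta> j)\<bar> \<le> W j * (L * sqrt (\<epsilon> n)) ^ 3" if j: "j \<in> {1..n}" for j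
  proof (cases "W j = 0")
    case False
    then have "(norm (X n i \<omega> - X n j \<omega>))\<^sup>2 \<le> \<epsilon> n"
      using weight_zero[OF e(1), of "X n i \<omega>" "X n j \<omega>"] by (force simp: W_def not_le)
    then have "norm (X n j \<omega> - X n i \<omega>) \<le> sqrt (\<epsilon> n)"
      by (intro real_le_rsqrt) (simp add: norm_minus_commute)
    then have "\<bar>\<Delta> j\<bar> \<le> L * sqrt (\<epsilon> n)"
      using L(2)[OF Xs[OF j] Xs[OF i]] L(1) unfolding \<Delta>_def by (meson mult_left_mono order_trans)
    then have "\<bar>\<Delta> j\<bar> ^ 3 \<le> (L * sqrt (\<epsilon> n)) ^ 3" by (intro power_mono) auto
    then have "\<bar>sin (\<Delta> j) - \<Delta> j\<bar> \<le> (L * sqrt (\<epsilon> n)) ^ 3"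
      using abs_sin_minus_le[of "\<Delta> j"] zero_le_power[of "\<bar>\<Delta> j\<bar>" 3] by linarith
    then show ?thesis using W0[of j] by (simp add: abs_mult mult_left_mono)
  qed simp
  have "\<bar>\<Sum>j\<in>{1..n} - {i}. W j * (sin (\<Delta> j) - \<Delta> j)\<bar> \<le> (\<Sum>j\<in>{1..n} - {i}. W j * (L * sqrt (\<epsilon> n)) ^ 3)"
    by (rule order_trans[OF sum_abs sum_mono]) (use sin_err in auto)
  also have "\<dots> = (\<Sum>j\<in>{1..n} - {i}. W j) * (L * sqrt (\<epsilon> n)) ^ 3" by (simp add: sum_distrib_right)
  also have "\<dots> \<le> ((B * C + 1) * \<epsilon> n * (real n - 1)) * (L * sqrt (\<epsilon> n)) ^ 3"
    using sums L(1) e unfolding W_def by (intro mult_right_mono) auto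
  also have "\<dots> = (B * C + 1) * L ^ 3 / c * sqrt (\<epsilon> n) * ((\<epsilon> n * (real n - 1)) * (c * \<epsilon> n))"
    using e c_pos by (simp add: power_mult_distrib power3_eq_cube)
  also have "\<dots> \<le> (B * C + 1) * L ^ 3 / c * sqrt (\<epsilon> n) * D"
    using D B_pos C_pos c_pos L(1) e by (intro mult_left_mono) auto
  finally have "\<bar>1 / D * (\<Sum>j\<in>{1..n} - {i}. W j * (sin (\<Delta> j) - \<Delta> j))\<bar> \<le> (B * C + 1) * L ^ 3 / c * sqrt (\<epsilon> n)"
    using D0 by (simp add: abs_mult field_simps)
  moreover have "(\<Sum>j\<in>{1..n} - {i}. 1 / D * W j * sin (\<Delta> j)) - speed n * w' t (X n i \<omega>)
      = heat_error w w' \<omega> n i t + 1 / D * (\<Sum>j\<in>{1..n} - {i}. W j * (sin (\<Delta> j) - \<Delta> j))"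
    unfolding heat_error_def D_def[symmetric] W_def[symmetric] \<Delta>_def[symmetric]
    by (simp add: right_diff_distrib sum_subtractf sum_divide_distrib mult.commute)
  ultimately have "\<bar>(\<Sum>j\<in>{1..n} - {i}. 1 / D * W j * sin (\<Delta> j)) - speed n * w' t (X n i \<omega>)\<bar>
      \<le> \<eta> + (B * C + 1) * L ^ 3 / c * sqrt (\<epsilon> n)"
    using err by linarith
  then show ?thesis by (simp add: D_def W_def \<Delta>_def)
qed

text \<open>Deterministic once the sample is fixed. Comparison is used twice: up to time \<tau> with
  the time-changed heat flow, and afterwards with the constant a, whose residual is zero. From then
  on all phases lie in an arc of length 2/5.\<close>

lemma synchronizes_of_heat_comparison:
  assumes e: "0 < \<epsilon> n" "\<epsilon> n \<le> 1" and n: "2 \<le> n" and \<omega>: "\<omega> \<in> space M"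
    and d: "\<And>i. i \<in> {1..n} \<Longrightarrow> d i = mean_degree n"
    and ascent: "\<And>i. i \<in> {1..n} \<Longrightarrow> \<epsilon> n / 4 \<le> (norm (X n i \<omega> - pole))\<^sup>2 \<Longrightarrow>
      \<exists>j\<in>{1..n} - {i}. (norm (X n i \<omega> - X n j \<omega>))\<^sup>2 < \<epsilon> n \<and> pole \<bullet> X n i \<omega> < pole \<bullet> X n j \<omega>"
    and der_w: "\<And>t x. ((\<lambda>t. w t x) has_real_derivative w' t x) (at t)"
    and L: "L \<ge> 0" "\<And>t x y. 0 \<le> t \<Longrightarrow> x \<in> sphere 0 1 \<Longrightarrow> y \<in> sphere 0 1 \<Longrightarrow> \<bar>w t x - w t y\<bar> \<le> L * norm (x - y)"
      "L * sqrt (\<epsilon> n) \<le> 1 / 2"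
    and consistent: "\<And>t i. i \<in> {1..n} \<Longrightarrow> 0 \<le> t \<Longrightarrow>
      \<bar>(\<Sum>j\<in>{1..n} - {i}. 1 / (\<epsilon> n * mean_degree n) * weight n (X n i \<omega>) (X n j \<omega>)
        * sin (w t (X n j \<omega>) - w t (X n i \<omega>))) - speed n * w' t (X n i \<omega>)\<bar> \<le> \<eta>"
    and \<eta>: "\<eta> < \<eta>'" and T: "0 < T" "\<eta>' * (T / speed n) \<le> 1 / 40"
    and const: "\<And>x. x \<in> sphere 0 1 \<Longrightarrow> \<bar>w T x - a\<bar> < 1 / 40"
    and init: "\<And>i. i \<in> {1..n} \<Longrightarrow> \<bar>v i - w 0 (X n i \<omega>)\<bar> < 1 / 20"
  shows "kuramoto_synchronizes K (\<epsilon> n) n d (\<lambda>i. X n i \<omega>) v"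
proof -
  define A where "A i j = 1 / (\<epsilon> n * mean_degree n) * weight n (X n i \<omega>) (X n j \<omega>)" for i j
  have p: "0 < edge_prob n" using edge_prob_bounds(1)[OF e] c_pos e by (smt (verit) mult_pos_pos)
  have D: "0 < mean_degree n" using p n by (simp add: mean_degree_def)
  have A0: "0 \<le> A i j" for i j using e D by (simp add: A_def weight_nonneg)
  have Asym: "A i j = A j i" for i j by (simp add: A_def weight_def norm_minus_commute)
  have rhs: "1 / (\<epsilon> n * d i) * (\<Sum>j\<in>{1..n} - {i}. sin (u t j - u t i) * rgg_weight K (\<epsilon> n) (\<lambda>i. X n i \<omega>) i j)
      = (\<Sum>j\<in>{1..n} - {i}. A i j * sin (u t j - u t i))" if "i \<in> {1..n}" for u :: "real \<Rightarrow> nat \<Rightarrow> real" and t i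
    unfolding sum_distrib_left d[OF that]
    by (intro sum.cong refl) (simp add: A_def rgg_weight_def weight_eq[OF e(1)])
  have conn: "(i, l) \<in> {(i, j). i \<in> {1..n} \<and> j \<in> {1..n} \<and> 0 < A i j}\<^sup>*"
    if ik: "i \<in> {1..n}" "l \<in> {1..n}" for i l
  proof -
    have "(i, l) \<in> {(i, j). i \<in> {1..n} \<and> j \<in> {1..n} \<and> (norm (X n i \<omega> - X n j \<omega>))\<^sup>2 < \<epsilon> n}\<^sup>*"
      using ascent by (intro ascent_connected[OF e(1) _ _ ik]) (blast | simp)+
    moreover have "0 < A i j" if "(norm (X n i \<omega> - X n j \<omega>))\<^sup>2 < \<epsilon> n" for i j
      using that e D K_pos[of "(norm (X n i \<omega> - X n j \<omega>))\<^sup>2 / \<epsilon> n"] by (simp add: A_def weight_eq[OF e(1)])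
    then have "{(i, j). i \<in> {1..n} \<and> j \<in> {1..n} \<and> (norm (X n i \<omega> - X n j \<omega>))\<^sup>2 < \<epsilon> n}
        \<subseteq> {(i, j). i \<in> {1..n} \<and> j \<in> {1..n} \<and> 0 < A i j}" by auto
    note rtrancl_mono[OF this]
    ultimately show ?thesis by blast
  qed
  have sp: "0 < speed n"
  proof -
    have "0 < c\<^sup>2 * k / (32 * C\<^sup>2)" using c_pos k_pos C_pos by simp
    then show ?thesis using speed_bounds(1)[OF e] by linarith
  qed
  define \<tau> where "\<tau> = T / speed n"
  have \<tau>: "0 < \<tau>" "speed n * \<tau> = T" using T sp by (simp_all add: \<tau>_def)
  have ex: "\<exists>u. kuramoto_solution K (\<epsilon> n) n d (\<lambda>i. X n i \<omega>) v u"
  proof -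
    obtain u where u: "\<forall>i\<in>{1..n}. u 0 i = v i \<and> continuous_on {0..} (\<lambda>t. u t i) \<and>
      (\<forall>t>0. ((\<lambda>t. u t i) has_real_derivative (\<Sum>j\<in>{1..n} - {i}. A i j * sin (u t j - u t i))) (at t))"
      using kuramoto_exists[of "{1..n}" v A] by auto
    have "kuramoto_solution K (\<epsilon> n) n d (\<lambda>i. X n i \<omega>) v u"
      unfolding kuramoto_solution_def
    proof
      fix i assume i: "i \<in> {1..n}"
      show "u 0 i = v i \<and> continuous_on {0..} (\<lambda>t. u t i) \<and> (\<forall>t>0. ((\<lambda>s. u s i) has_real_derivative
        1 / (\<epsilon> n * d i) * (\<Sum>j\<in>{1..n} - {i}. sin (u t j - u t i) * rgg_weight K (\<epsilon> n) (\<lambda>i. X n i \<omega>) i j)) (at t))"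
        unfolding rhs[OF i] using u i by blast
    qed
    then show ?thesis by blast
  qed
  have "phase_synchronizes n u" if sol: "kuramoto_solution K (\<epsilon> n) n d (\<lambda>i. X n i \<omega>) v u" for u
  proof -
    have u0: "u 0 i = v i" and cont_u: "continuous_on {0..} (\<lambda>t. u t i)" if "i \<in> {1..n}" for i
      using sol that unfolding kuramoto_solution_def by auto
    have der_u: "((\<lambda>t. u t i) has_real_derivative (\<Sum>j\<in>{1..n} - {i}. A i j * sin (u t j - u t i))) (at t)"
      if "i \<in> {1..n}" "0 < t" for t i
      using sol that unfolding kuramoto_solution_def rhs[OF that(1), symmetric] by blast
    have Xs: "X n j \<omega> \<in> sphere 0 1" if "j \<in> {1..n}" for j using in_sphere[OF that \<omega>] .
    define W where "W t i = w (speed n * t) (X n i \<omega>)" for t i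
    have der_W: "((\<lambda>t. W t i) has_real_derivative speed n * w' (speed n * t) (X n i \<omega>)) (at t)" for t i
    proof -
      have "((\<lambda>t. speed n * t) has_real_derivative speed n) (at t)"
        by (auto intro!: derivative_eq_intros)
      from DERIV_chain'[OF this der_w] show ?thesis
        unfolding W_def by (subst mult.commute[of "speed n" "w' (speed n * t) (X n i \<omega>)"])
    qed
    have at_\<tau>: "\<bar>u \<tau> i - W \<tau> i\<bar> < 1 / 20 + \<eta>' * \<tau>" if i: "i \<in> {1..n}" for i
    proof (rule kuramoto_comparison[of "{1..n}" A u W "\<lambda>t i. speed n * w' (speed n * t) (X n i \<omega>)" \<eta> \<eta>' "1 / 20" \<tau>])
      show "continuous_on {0..} (\<lambda>t. W t i)" for i
        by (rule DERIV_continuous_on) (rule has_field_derivative_at_within[OF der_W])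
      show "\<bar>(\<Sum>j\<in>{1..n} - {i}. A i j * sin (W t j - W t i)) - speed n * w' (speed n * t) (X n i \<omega>)\<bar> \<le> \<eta>"
        if "i \<in> {1..n}" "0 \<le> t" for t i
        using consistent[OF that(1), of "speed n * t"] that(2) sp unfolding A_def W_def by simp
      show "\<bar>W t j - W t i\<bar> \<le> 1 / 2" if "i \<in> {1..n}" "j \<in> {1..n}" "0 \<le> t" "A i j \<noteq> 0" for t i j
      proof -
        have "weight n (X n i \<omega>) (X n j \<omega>) \<noteq> 0" using that(4) by (simp add: A_def)
        then have "(norm (X n i \<omega> - X n j \<omega>))\<^sup>2 \<le> \<epsilon> n"
          using weight_zero[OF e(1), of "X n i \<omega>" "X n j \<omega>"] by (force simp: not_le)
        then have r: "norm (X n j \<omega> - X n i \<omega>) \<le> sqrt (\<epsilon> n)"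
          by (intro real_le_rsqrt) (simp add: norm_minus_commute)
        have "\<bar>W t j - W t i\<bar> \<le> L * norm (X n j \<omega> - X n i \<omega>)"
          unfolding W_def using that sp by (intro L(2) Xs) auto
        also have "\<dots> \<le> L * sqrt (\<epsilon> n)" using r L(1) by (rule mult_left_mono)
        finally show ?thesis using L(3) by simp
      qed
      show "\<bar>u 0 i - W 0 i\<bar> < 1 / 20" if "i \<in> {1..n}" for i
        using init[OF that] u0[OF that] by (simp add: W_def)
      show "1 / 20 + \<eta>' * \<tau> \<le> 1 / 2" using T(2) unfolding \<tau>_def by linarith
    qed (use A0 cont_u der_u der_W \<eta> \<tau> i in simp_all)
    \<comment> \<open>Budget: 1/20 for the initial data, 1/40 for the growth of the barrier up to
      \<tau>, and 1/40 for the distance of \<open>w T\<close> from a.\<close>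
    have start: "\<bar>u \<tau> i - a\<bar> < 1 / 10" if i: "i \<in> {1..n}" for i
      using at_\<tau>[OF i] T(2) const[OF Xs[OF i]] unfolding W_def \<tau>(2) \<tau>_def[symmetric] by linarith
    have stay: "\<bar>u (\<tau> + t) i - a\<bar> < 1 / 5" if i: "i \<in> {1..n}" and t: "0 \<le> t" for i t
    proof -
      \<comment> \<open>Comparison needs a slope strictly above the residual 0. Letting the slope
        depend on the horizon t keeps the growth \<beta> t below 1/10 for every t, so the bound
        holds for all times.\<close>
      define \<beta> where "\<beta> = 1 / (10 * (t + 1))"
      have \<beta>: "\<beta> > 0" "\<beta> * t \<le> 1 / 10" using t by (simp_all add: \<beta>_def field_simps)
      have "\<bar>u (\<tau> + t) i - a\<bar> < 1 / 10 + \<beta> * t"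
      proof (rule kuramoto_comparison[of "{1..n}" A "\<lambda>t i. u (\<tau> + t) i" "\<lambda>_ _. a" "\<lambda>_ _. 0" 0 \<beta> "1 / 10" t])
        show "continuous_on {0..} (\<lambda>t. u (\<tau> + t) i)" if "i \<in> {1..n}" for i
          by (rule continuous_on_compose2[OF cont_u[OF that]]) (use \<tau> in \<open>auto intro!: continuous_intros\<close>)
        show "((\<lambda>t. u (\<tau> + t) i) has_real_derivative
          (\<Sum>j\<in>{1..n} - {i}. A i j * sin (u (\<tau> + t) j - u (\<tau> + t) i))) (at t)"
          if "i \<in> {1..n}" "0 < t" for t i
          using der_u[OF that(1), of "t + \<tau>"] that(2) \<tau>(1)
          unfolding DERIV_shift[of "\<lambda>t. u t i" _ t \<tau>] add.commute[of \<tau>] by simp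
      qed (use A0 start \<beta> t i in auto)
      with \<beta>(2) show ?thesis by linarith
    qed
    have "\<exists>\<theta>. \<forall>i\<in>{1..n}. ((\<lambda>t. u t i) \<longlongrightarrow> \<theta>) at_top"
    proof (rule kuramoto_sync[of "{1..n}" A \<tau>])
      show "\<bar>u t j - u t i\<bar> \<le> 1" if "i \<in> {1..n}" "j \<in> {1..n}" "\<tau> \<le> t" for t i j
      proof -
        have "\<bar>u t i - a\<bar> < 1 / 5" "\<bar>u t j - a\<bar> < 1 / 5"
          using stay[OF that(1), of "t - \<tau>"] stay[OF that(2), of "t - \<tau>"] that(3) by simp_all
        then show ?thesis by linarith
      qed
    qed (use A0 Asym conn der_u \<tau> in auto)
    then show ?thesis
      unfolding phase_synchronizes_def by (blast intro: tendsto_imp_tendsto_mod_2pi)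
  qed
  with ex show ?thesis unfolding kuramoto_synchronizes_def by blast
qed

text \<open>The heat sum w is fixed first, and with it L and T. As \<eta> depends only on these and
  on the kernel and cap constants, each almost sure statement is invoked for a single choice of
  parameters.\<close>

lemma AE_kuramoto_synchronizes:
  assumes cont: "continuous_on (sphere 0 1) u0"
    and init: "AE \<omega> in M. \<forall>\<^sub>F n in sequentially. \<forall>i\<in>{1..n}. \<bar>V n i \<omega> - u0 (X n i \<omega>)\<bar> \<le> 1 / 50"
  shows "AE \<omega> in M. \<forall>\<^sub>F n in sequentially. kuramoto_synchronizes K (\<epsilon> n) n
    (\<lambda>i. expectation (\<lambda>\<omega>'. real (rgg_degree (\<epsilon> n) n (\<lambda>j. X n j \<omega>') i))) (\<lambda>i. X n i \<omega>) (\<lambda>i. V n i \<omega>)"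
proof -
  obtain w where w: "heat_sum w" "\<And>x. x \<in> sphere 0 1 \<Longrightarrow> \<bar>u0 x - w 0 x\<bar> < 1 / 50"
    using heat_sum_dense[OF cont, of "1 / 50"] by auto
  obtain L where L: "L \<ge> 0"
    "\<And>t x y. 0 \<le> t \<Longrightarrow> x \<in> sphere 0 1 \<Longrightarrow> y \<in> sphere 0 1 \<Longrightarrow> \<bar>w t x - w t y\<bar> \<le> L * norm (x - y)"
    using heat_sum_lipschitz[OF w(1)] by blast
  obtain w' where w': "\<And>t x. ((\<lambda>t. w t x) has_real_derivative w' t x) (at t)"
    "\<And>\<eta>. \<eta> > 0 \<Longrightarrow> AE \<omega> in M. \<forall>\<^sub>F n in sequentially. \<forall>i\<in>{1..n}. \<forall>t\<ge>0. \<bar>heat_error w w' \<omega> n i t\<bar> \<le> \<eta>"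
    using AE_heat_sum_consistent[OF w(1)] by blast
  obtain a where "\<forall>\<^sub>F t in at_top. \<forall>x\<in>sphere 0 1. \<bar>w t x - a\<bar> < 1 / 40"
    using heat_sum_tendsto_const[OF w(1)] by (meson zero_less_divide_1_iff zero_less_numeral)
  then have "\<forall>\<^sub>F t in at_top. (\<forall>x\<in>sphere 0 1. \<bar>w t x - a\<bar> < 1 / 40) \<and> 0 < t"
    using eventually_gt_at_top by (rule eventually_conj)
  then obtain T where T: "0 < T" "\<And>x. x \<in> sphere 0 1 \<Longrightarrow> \<bar>w T x - a\<bar> < 1 / 40"
    using eventually_happens'[OF trivial_limit_at_top_linorder] by blast
  define \<gamma> where "\<gamma> = c\<^sup>2 * k / (32 * C\<^sup>2)"
  have \<gamma>: "0 < \<gamma>" using c_pos k_pos C_pos by (simp add: \<gamma>_def)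
  \<comment> \<open>The residual is at most 2 \<eta>, half of it from the drift and half from the
    sine, so slope 3 \<eta> is admissible; over the time T / \<open>speed n\<close> <= T / \<gamma>
    the barrier rises by at most 3 \<eta> T / \<gamma> = 1/40.\<close>
  define \<eta> where "\<eta> = \<gamma> / (120 * T)"
  have \<eta>: "0 < \<eta>" using \<gamma> T by (simp add: \<eta>_def)
  define Z where "Z = (B * C + 1) * L ^ 3 / c"
  have Z: "0 \<le> Z" using B_pos C_pos c_pos L(1) by (simp add: Z_def)
  \<comment> \<open>The first entry makes the sine error Z sqrt \<epsilon> at most \<eta>; the
    second keeps differences of w along edges below 1/2, as comparison requires.\<close>
  define e0 where "e0 = min 1 ((min (\<eta> / (Z + 1)) (1 / (2 * (L + 1))))\<^sup>2)"
  have e0: "0 < e0" using \<eta> Z L(1) by (simp add: e0_def min_def)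
  from init AE_weight_sums AE_ascent w'(2)[OF \<eta>] AE_space show ?thesis
  proof eventually_elim
    case (elim \<omega>)
    note \<omega> = elim(5)
    from elim(1-4) eventually_small[OF e0] eventually_ge_at_top[of 2] show ?case
    proof eventually_elim
      case (elim n)
      have e: "0 < \<epsilon> n" "\<epsilon> n \<le> 1" "\<epsilon> n \<le> (min (\<eta> / (Z + 1)) (1 / (2 * (L + 1))))\<^sup>2"
        using elim(5) by (simp_all add: e0_def)
      have "sqrt (\<epsilon> n) \<le> min (\<eta> / (Z + 1)) (1 / (2 * (L + 1)))"
        using e(3) \<eta> Z L(1) by (intro real_le_lsqrt) auto
      then have r: "sqrt (\<epsilon> n) \<le> \<eta> / (Z + 1)" "sqrt (\<epsilon> n) \<le> 1 / (2 * (L + 1))" by simp_all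
      have Zr: "Z * sqrt (\<epsilon> n) \<le> \<eta>"
      proof -
        have "Z * sqrt (\<epsilon> n) \<le> Z * (\<eta> / (Z + 1))" using r(1) Z by (rule mult_left_mono)
        also have "\<dots> \<le> \<eta>" using Z \<eta> by (simp add: field_simps)
        finally show ?thesis .
      qed
      have Lr: "L * sqrt (\<epsilon> n) \<le> 1 / 2"
      proof -
        have "L * sqrt (\<epsilon> n) \<le> L * (1 / (2 * (L + 1)))" using r(2) L(1) by (rule mult_left_mono)
        also have "\<dots> \<le> 1 / 2" using L(1) by (simp add: field_simps)
        finally show ?thesis .
      qed
      have sp: "\<gamma> \<le> speed n" using speed_bounds(1)[OF e(1,2)] by (simp add: \<gamma>_def)
      show ?case
      proof (rule synchronizes_of_heat_comparison[where w = w and w' = w' and L = L and \<eta> = "2 * \<eta>" and \<eta>' = "3 * \<eta>" and T = T and a = a])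
        fix t i assume i: "i \<in> {1..n}" and t: "(0::real) \<le> t"
        have "\<bar>(\<Sum>j\<in>{1..n} - {i}. 1 / (\<epsilon> n * mean_degree n) * weight n (X n i \<omega>) (X n j \<omega>)
          * sin (w t (X n j \<omega>) - w t (X n i \<omega>))) - speed n * w' t (X n i \<omega>)\<bar> \<le> \<eta> + (B * C + 1) * L ^ 3 / c * sqrt (\<epsilon> n)"
          by (rule sine_coupling_error[where w = w and w' = w' and L = L and t = t and \<eta> = \<eta> and n = n and i = i and \<omega> = \<omega>,
                OF e(1,2) elim(6) i t \<omega> L(1) L(2)[OF t]]) (use elim(2,4) i t in auto)
        also have "\<dots> \<le> 2 * \<eta>" using Zr by (simp add: Z_def)
        finally show "\<bar>(\<Sum>j\<in>{1..n} - {i}. 1 / (\<epsilon> n * mean_degree n) * weight n (X n i \<omega>) (X n j \<omega>)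
          * sin (w t (X n j \<omega>) - w t (X n i \<omega>))) - speed n * w' t (X n i \<omega>)\<bar> \<le> 2 * \<eta>" .
      next
        fix i assume i: "i \<in> {1..n}"
        have "\<bar>V n i \<omega> - u0 (X n i \<omega>)\<bar> \<le> 1 / 50" using elim(1) i by blast
        with w(2)[OF in_sphere[OF i \<omega>]] show "\<bar>V n i \<omega> - w 0 (X n i \<omega>)\<bar> < 1 / 20" by linarith
      next
        have "3 * \<eta> * (T / speed n) \<le> 3 * \<eta> * (T / \<gamma>)"
          using \<eta> T \<gamma> sp by (intro mult_left_mono divide_left_mono) auto
        also have "\<dots> = 1 / 40" using T \<gamma> by (simp add: \<eta>_def)
        finally show "3 * \<eta> * (T / speed n) \<le> 1 / 40" .
      next
        show "\<exists>j\<in>{1..n} - {i}. (norm (X n i \<omega> - X n j \<omega>))\<^sup>2 < \<epsilon> n \<and> pole \<bullet> X n i \<omega> < pole \<bullet> X n j \<omega>"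
          if "i \<in> {1..n}" "\<epsilon> n / 4 \<le> (norm (X n i \<omega> - pole))\<^sup>2" for i
          using elim(3) that by blast
      qed (use e elim(6) \<omega> expected_degree w'(1) L Lr \<eta> T in simp_all)
    qed
  qed
qed

end

theorem theorem2p4:
  fixes M :: "'w measure"
    and K :: "real \<Rightarrow> real"
    and \<epsilon> :: "nat \<Rightarrow> real"
    and X :: "nat \<Rightarrow> nat \<Rightarrow> 'w \<Rightarrow> real^3"
    and \<alpha> :: real
    and u0 :: "real^3 \<Rightarrow> real"
    and V :: "nat \<Rightarrow> nat \<Rightarrow> 'w \<Rightarrow> real"
  assumes "prob_space M"
    and "rgg_kernel K"
    and "\<And>n. n \<ge> 1 \<Longrightarrow> \<epsilon> n > 0"
    and "\<epsilon> \<longlonglongrightarrow> 0"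
    and "liminf (\<lambda>n. ereal ((\<epsilon> n)\<^sup>2 * real n / ln (real n))) = \<infinity>"
    and "\<And>n. n \<ge> 1 \<Longrightarrow> prob_space.indep_vars M (\<lambda>_. borel) (X n) {1..n}"
    and "\<And>n i \<omega>. i \<in> {1..n} \<Longrightarrow> \<omega> \<in> space M \<Longrightarrow> X n i \<omega> \<in> sphere 0 1"
    and "\<And>n i. i \<in> {1..n} \<Longrightarrow> distr M borel (X n i) = uniform_sphere"
    and "0 < \<alpha>" and "\<alpha> < 1"
    and "C2_holder_sphere \<alpha> u0"
    and "\<And>n i. i \<in> {1..n} \<Longrightarrow> V n i \<in> borel_measurable M"
    and "\<And>\<delta>. \<delta> > 0 \<Longrightarrow> summable (\<lambda>m. let n = Suc m in
           measure M {\<omega> \<in> space M. (SUP i\<in>{1..n}. \<bar>V n i \<omega> - u0 (X n i \<omega>)\<bar>) > \<delta>})"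
  shows "AE \<omega> in M. \<forall>\<^sub>F n in sequentially.
           kuramoto_synchronizes K (\<epsilon> n) n
             (\<lambda>i. prob_space.expectation M (\<lambda>\<omega>'. real (rgg_degree (\<epsilon> n) n (\<lambda>j. X n j \<omega>') i)))
             (\<lambda>i. X n i \<omega>) (\<lambda>i. V n i \<omega>)"
proof -
  interpret prob_space M by fact
  have growth: "\<forall>\<^sub>F n in sequentially. C * ln (real n) \<le> (\<epsilon> n)\<^sup>2 * real n" for C
  proof -
    have "ereal C < liminf (\<lambda>n. ereal ((\<epsilon> n)\<^sup>2 * real n / ln (real n)))"
      unfolding assms(5) by simp
    from less_LiminfD[OF this] eventually_ge_at_top[of 2] show ?thesis
    proof eventually_elim
      case (elim n)
      then have "0 < ln (real n)" by simp
      with elim(1) show ?case by (simp add: pos_less_divide_eq)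
    qed
  qed
  obtain B k where Bk: "0 < k" "(\<lambda>s. K (max 0 s)) \<in> borel_measurable borel"
    "\<forall>r\<ge>0. 0 \<le> K r \<and> K r \<le> B" "\<forall>r>1. K r = 0" "\<forall>r. 0 \<le> r \<longrightarrow> r < 1 \<longrightarrow> 0 < K r"
    "\<forall>r. 0 \<le> r \<longrightarrow> r \<le> 1 / 2 \<longrightarrow> k \<le> K r"
    using rgg_kernel_facts[OF assms(2)] by blast
  obtain c C where cC: "0 < c" "0 < C" "\<And>r x. 0 < r \<Longrightarrow> r \<le> 1 \<Longrightarrow> x \<in> sphere 0 1 \<Longrightarrow>
     c * r \<le> measure uniform_sphere {y. (norm (x - y))\<^sup>2 < r} \<and>
     measure uniform_sphere {y. (norm (x - y))\<^sup>2 \<le> r} \<le> C * r"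
    using measure_cap_bounds by blast
  interpret kernel_samples M \<epsilon> X K B k c C
    by unfold_locales (use assms(3,4,6,7,8) growth Bk cC in auto)
  obtain D1 where D1: "\<And>x. x \<noteq> 0 \<Longrightarrow> ((\<lambda>y. u0 (sgn y)) has_derivative blinfun_apply (D1 x)) (at x)"
    using assms(11) unfolding C2_holder_sphere_def by blast
  \<comment> \<open>Differentiability is given for the radial extension, which agrees with
    \<open>u0\<close> on the sphere.\<close>
  have cont0: "continuous_on (- {0}) (\<lambda>y. u0 (sgn y))"
    by (rule continuous_at_imp_continuous_on) (use D1 has_derivative_continuous in blast)
  have "continuous_on (sphere 0 1) (\<lambda>y. u0 (sgn y))"
    by (rule continuous_on_subset[OF cont0]) auto
  then have cont: "continuous_on (sphere 0 1) u0"
    by (rule continuous_on_cong[THEN iffD1, rotated 2]) (auto simp: sgn_div_norm)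
  have u0X: "(\<lambda>\<omega>. u0 (X n i \<omega>)) \<in> borel_measurable M" if i: "i \<in> {1..n}" for n i
  proof -
    \<comment> \<open>\<open>u0\<close> is arbitrary off the sphere; the radial extension, set to 0
      at the origin, is Borel and has the same values at the sample points.\<close>
    have "(\<lambda>x. indicator (- {0}) x *\<^sub>R u0 (sgn x)) \<in> borel_measurable borel"
      by (rule borel_measurable_continuous_on_indicator[OF _ cont0]) simp
    from measurable_compose[OF measurable_X[OF i] this]
    have "(\<lambda>\<omega>. indicator (- {0}) (X n i \<omega>) *\<^sub>R u0 (sgn (X n i \<omega>))) \<in> borel_measurable M" .
    then show ?thesis
    proof (rule measurable_cong[THEN iffD1, rotated])
      fix \<omega> assume "\<omega> \<in> space M"
      then have "norm (X n i \<omega>) = 1" using in_sphere[OF i] by simp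
      moreover from this have "X n i \<omega> \<noteq> 0" by auto
      ultimately show "indicator (- {0}) (X n i \<omega>) *\<^sub>R u0 (sgn (X n i \<omega>)) = u0 (X n i \<omega>)"
        by (auto simp: sgn_div_norm)
    qed
  qed
  define Bad where "Bad n = {\<omega> \<in> space M. (SUP i\<in>{1..n}. \<bar>V n i \<omega> - u0 (X n i \<omega>)\<bar>) > 1 / 50}" for n
  have bdd: "bdd_above ((\<lambda>i. \<bar>V n i \<omega> - u0 (X n i \<omega>)\<bar>) ` {1..n})" for n \<omega> by simp
  \<comment> \<open>\<open>Suc m\<close> keeps the index set nonempty, so that the supremum exceeds
    1/50 exactly if some vertex does; the finite union also shows that the event is
    measurable.\<close>
  have Bad_eq: "Bad (Suc m) = (\<Union>i\<in>{1..Suc m}. {\<omega> \<in> space M. \<bar>V (Suc m) i \<omega> - u0 (X (Suc m) i \<omega>)\<bar> > 1 / 50})" for m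
    unfolding Bad_def by (subst less_cSUP_iff[OF _ bdd]) auto
  have "Bad (Suc m) \<in> sets M" for m
    unfolding Bad_eq
  proof (intro sets.finite_UN)
    fix i assume i: "i \<in> {1..Suc m}"
    note [measurable] = u0X[OF i] assms(12)[OF i]
    show "{\<omega> \<in> space M. \<bar>V (Suc m) i \<omega> - u0 (X (Suc m) i \<omega>)\<bar> > 1 / 50} \<in> sets M" by measurable
  qed simp
  moreover have "summable (\<lambda>m. measure M (Bad (Suc m)))"
    using assms(13)[of "1 / 50"] by (simp add: Bad_def Let_def)
  ultimately have "AE \<omega> in M. \<forall>\<^sub>F m in sequentially. \<omega> \<in> space M - Bad (Suc m)"
    by (intro borel_cantelli_AE1) (auto simp: emeasure_eq_measure)
  then have "AE \<omega> in M. \<forall>\<^sub>F n in sequentially. \<forall>i\<in>{1..n}. \<bar>V n i \<omega> - u0 (X n i \<omega>)\<bar> \<le> 1 / 50"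
  proof eventually_elim
    case (elim \<omega>)
    then have "\<forall>\<^sub>F m in sequentially. \<forall>i\<in>{1..Suc m}. \<bar>V (Suc m) i \<omega> - u0 (X (Suc m) i \<omega>)\<bar> \<le> 1 / 50"
      by eventually_elim (auto simp: Bad_eq not_less)
    then show ?case by (subst (asm) eventually_sequentially_Suc)
  qed
  from AE_kuramoto_synchronizes[OF cont this] show ?thesis .
qed

end
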